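(* Fix constants $\gamma>1$ and $r_0>0$. Fix a $C^1$ function $b$ on $[0,r_0]$ with $b(t)>0$ for $t\in[0,r_0]$ and $\|b\|_{C^1([0,r_0])}\le b_0$ for some constant $b_0>0$. Fix positive constants $(\rho_0,u_0,p_0)$ with $M_0:=\sqrt{\frac{u_0^2}{\gamma p_0/\rho_0}}>1$. The notion "transonic shock solution on $[0,T]$ with shock at $t_s$ and entrance data $(\rho_0,u_0,p_0,E_0)$", denoted $(\rho,u,p,E)(t;t_s)$ and consisting of an upstream part $(\rho_-,u_-,p_-,E_-)(t)$ and a downstream part $(\rho_+,u_+,p_+,E_+)(t;t_s)$, is defined in the context. (a) There exists $\underline{E}>0$ depending on $(\gamma,r_0,b_0,\rho_0,u_0,p_0)$ such that whenever $E_0\ge\underline{E}$, the following holds for all sufficiently small $T>0$ (that is, for all $0<T\le T_0$, for some $T_0\in(0,r_0)$ depending on $(\gamma,r_0,b_0,\rho_0,u_0,p_0,E_0)$): for every $t_s\in[0,T]$ there is a unique transonic shock solution $(\rho,u,p,E)(t;t_s)$ on $[0,T]$ with shock at $t_s$ and with $$(\rho,u,p,E)(0)=(\rho_0,u_0,p_0,E_0),$$ and the resulting family satisfies $$\frac{dp_+}{dt_s}(T;t_s)<0\quad\text{for all } t_s\in[0,T].$$ (b) Suppose $\gamma\ge 2$. If $r_1\in(0,r_0)$ satisfies $\ln\frac{r_0}{r_1}<\frac{\gamma+1}{2(\gamma-1)}$, then there exists $E_*>0$ depending on $(\gamma,r_0,r_1,b_0,\rho_0,u_0,p_0)$ such that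 whenever $E_0\ge E_*$, with $T:=r_0-r_1$, for every $t_s\in[0,T]$ there is a unique transonic shock solution $(\rho,u,p,E)(t;t_s)$ on $[0,T]=[0,r_0-r_1]$ with shock at $t_s$ and with $(\rho,u,p,E)(0)=(\rho_0,u_0,p_0,E_0)$, and the resulting family satisfies $$\frac{dp_+}{dt_s}(T;t_s)<0\quad\text{for all } t_s\in[0,T].$$
   Context: Background: radial solutions of the steady Euler-Poisson system in a planar annulus $\{r_1<|x|<r_0\}$, flowing inward from the entrance $|x|=r_0$, with velocity $-u\,\mathbf e_r$ and electric force $\nabla\Phi=-E\,\mathbf e_r$, are written as functions of $t=r_0-r$, where $r=|x|$. Write $\hat t:=r_0-t$ and $'=\frac{d}{dt}$. The radial system is $$(\hat t\rho u)'=0,\qquad (\hat t\rho u^2)'+\hat t p'=\hat t\rho E,\qquad (\hat t\rho uB)'=\hat t\rho uE,\qquad (\hat tE)'=\hat t(\rho-b),\qquad\qquad (\mathrm{EP})$$ with $B=\frac12u^2+\frac{\gamma p}{(\gamma-1)\rho}$. The Mach number is $M=\frac{u}{\sqrt{\gamma p/\rho}}$; a state is supersonic if $M>1$ and subsonic if $M<1$. Let $0<T<r_0$ and $t_s\in[0,T]$. A transonic shock solution on $[0,T]$ with shock at $t_s$ and entrance data $(\rho_0,u_0,p_0,E_0)$ is $$(\rho,u,p,E)(t;t_s)=\begin{cases}(\rho_-,u_-,p_-,E_-)(t)&0\le t<t_s,\\(\rho_+,u_+,p_+,E_+)(t;t_s)&t_s\le t\le T,\end{cases}$$ where: (1) $(\rho_-,u_-,p_-,E_-)$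 is a $C^1$ solution of (EP) on $[0,T]$ with value $(\rho_0,u_0,p_0,E_0)$ at $t=0$ and with $\rho_->0$, $u_->0$, $M_-=\frac{u_-}{\sqrt{\gamma p_-/\rho_-}}>1$ on $[0,T]$; (2) $(\rho_+,u_+,p_+,E_+)(\cdot\,;t_s)$ is a $C^1$ solution of (EP) on $[t_s,T]$ with $\rho_+,u_+,p_+>0$ and $M_+=\frac{u_+}{\sqrt{\gamma p_+/\rho_+}}<1$ on $[t_s,T]$; (3) the Rankine-Hugoniot conditions hold at $t=t_s$: the quantities $\rho u$, $\rho u^2+p$, $B$ and $E$ take the same values at $t=t_s$ on the $-$ and $+$ states. Equivalently, the downstream state at $t=t_s$ is $$(\rho_+,u_+,p_+,E_+)(t_s;t_s)=\Big(\tfrac{\rho_-u_-^2}{K_-},\ \tfrac{K_-}{u_-},\ \rho_-u_-^2+p_--\rho_-K_-,\ E_-\Big)\Big|_{t=t_s},\qquad K_-=\tfrac{2(\gamma-1)}{\gamma+1}\Big(\tfrac12u_-^2+\tfrac{\gamma p_-}{(\gamma-1)\rho_-}\Big).$$ Derivatives in $t_s$ at endpoints of $[0,T]$ are one-sided. *)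

theory Defs
  imports "HOL-Analysis.Analysis"
begin

text \<open>Derivatives are taken within the set, hence one-sided at the endpoints of an interval.
  On a one-point set the derivative condition is void, so there only the value is constrained.\<close>

definition C1_on :: "real set \<Rightarrow> (real \<Rightarrow> real) \<Rightarrow> bool" where
  "C1_on S f \<longleftrightarrow>
     (\<exists>f'. continuous_on S f' \<and> (\<forall>t\<in>S. (f has_real_derivative f' t) (at t within S)))"

definition C1_norm :: "real set \<Rightarrow> (real \<Rightarrow> real) \<Rightarrow> real" where
  "C1_norm S f =
     (SUP t\<in>S. \<bar>f t\<bar>) + (SUP t\<in>S. \<bar>vector_derivative f (at t within S)\<bar>)"

definition admissible_background :: "real \<Rightarrow> real \<Rightarrow> (real \<Rightarrow> real) \<Rightarrow> bool" where
  "admissible_background r0 b0 b \<longleftrightarrow>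
     C1_on {0..r0} b \<and> (\<forall>t\<in>{0..r0}. b t > 0) \<and> C1_norm {0..r0} b \<le> b0"

record flow_state =
  rho :: real
  vel :: real
  pres :: real
  elec :: real

definition bernoulli :: "real \<Rightarrow> flow_state \<Rightarrow> real" where
  "bernoulli \<gamma> s = (vel s)\<^sup>2 / 2 + \<gamma> * pres s / ((\<gamma> - 1) * rho s)"

definition mach :: "real \<Rightarrow> flow_state \<Rightarrow> real" where
  "mach \<gamma> s = vel s / sqrt (\<gamma> * pres s / rho s)"

text \<open>\<open>C\<^sup>1\<close> solutions of the radial system on \<open>S\<close>, in the variable \<open>t = r0 - r\<close>. In the momentum
  equation, \<open>q'\<close> and \<open>p'\<close> are the derivatives at \<open>t\<close> of \<open>(r0 - t) \<rho> u\<^sup>2\<close> and of the pressure.\<close>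

definition EP_solution_on ::
  "real \<Rightarrow> real \<Rightarrow> (real \<Rightarrow> real) \<Rightarrow> real set \<Rightarrow> (real \<Rightarrow> flow_state) \<Rightarrow> bool" where
  "EP_solution_on \<gamma> r0 b S W \<longleftrightarrow>
     C1_on S (\<lambda>t. rho (W t)) \<and> C1_on S (\<lambda>t. vel (W t)) \<and>
     C1_on S (\<lambda>t. pres (W t)) \<and> C1_on S (\<lambda>t. elec (W t)) \<and>
     (\<forall>t\<in>S.
        ((\<lambda>s. (r0 - s) * rho (W s) * vel (W s)) has_real_derivative 0) (at t within S) \<and>
        (\<exists>q' p'.
           ((\<lambda>s. (r0 - s) * rho (W s) * (vel (W s))\<^sup>2) has_real_derivative q') (at t within S) \<and>
           ((\<lambda>s. pres (W s)) has_real_derivative p') (at t within S) \<and>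
           q' + (r0 - t) * p' = (r0 - t) * rho (W t) * elec (W t)) \<and>
        ((\<lambda>s. (r0 - s) * rho (W s) * vel (W s) * bernoulli \<gamma> (W s)) has_real_derivative
           (r0 - t) * rho (W t) * vel (W t) * elec (W t)) (at t within S) \<and>
        ((\<lambda>s. (r0 - s) * elec (W s)) has_real_derivative
           (r0 - t) * (rho (W t) - b t)) (at t within S))"

definition rankine_hugoniot :: "real \<Rightarrow> flow_state \<Rightarrow> flow_state \<Rightarrow> bool" where
  "rankine_hugoniot \<gamma> l r \<longleftrightarrow>
     rho l * vel l = rho r * vel r \<and>
     rho l * (vel l)\<^sup>2 + pres l = rho r * (vel r)\<^sup>2 + pres r \<and>
     bernoulli \<gamma> l = bernoulli \<gamma> r \<and>
     elec l = elec r"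

text \<open>The solution is given by its upstream part \<open>U\<close> on \<open>{0..T}\<close>, with entrance data \<open>s0\<close>, and its
  downstream part \<open>V\<close> on \<open>{ts..T}\<close>; the flow itself is \<open>U\<close> on \<open>{0..<ts}\<close> and \<open>V\<close> on \<open>{ts..T}\<close>.
  Values outside these intervals are irrelevant. Upstream, positivity of the pressure follows from
  \<open>mach \<gamma> (U t) > 1\<close>, since \<open>sqrt x \<le> 0\<close> for \<open>x \<le> 0\<close> and division by zero gives zero.\<close>

definition transonic_shock ::
  "real \<Rightarrow> real \<Rightarrow> (real \<Rightarrow> real) \<Rightarrow> real \<Rightarrow> flow_state \<Rightarrow> real \<Rightarrow>
    (real \<Rightarrow> flow_state) \<Rightarrow> (real \<Rightarrow> flow_state) \<Rightarrow> bool" where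
  "transonic_shock \<gamma> r0 b T s0 ts U V \<longleftrightarrow>
     EP_solution_on \<gamma> r0 b {0..T} U \<and> U 0 = s0 \<and>
     (\<forall>t\<in>{0..T}. rho (U t) > 0 \<and> vel (U t) > 0 \<and> mach \<gamma> (U t) > 1) \<and>
     EP_solution_on \<gamma> r0 b {ts..T} V \<and>
     (\<forall>t\<in>{ts..T}. rho (V t) > 0 \<and> vel (V t) > 0 \<and> pres (V t) > 0 \<and> mach \<gamma> (V t) < 1) \<and>
     rankine_hugoniot \<gamma> (U ts) (V ts)"

text \<open>For every shock location in \<open>{0..T}\<close> there is a unique transonic shock solution, and the exit
  pressure is differentiable in the shock location with negative derivative. The upstream part \<open>U\<close>
  does not depend on the shock location; \<open>V ts\<close> is the downstream part for the shock at \<open>ts\<close>.\<close>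

definition unique_shocks_with_decreasing_exit_pressure ::
  "real \<Rightarrow> real \<Rightarrow> (real \<Rightarrow> real) \<Rightarrow> real \<Rightarrow> flow_state \<Rightarrow> bool" where
  "unique_shocks_with_decreasing_exit_pressure \<gamma> r0 b T s0 \<longleftrightarrow>
     (\<exists>U V.
        (\<forall>ts\<in>{0..T}.
           transonic_shock \<gamma> r0 b T s0 ts U (V ts) \<and>
           (\<forall>U' V'. transonic_shock \<gamma> r0 b T s0 ts U' V' \<longrightarrow>
              (\<forall>t\<in>{0..T}. U' t = U t) \<and> (\<forall>t\<in>{ts..T}. V' t = V ts t))) \<and>
        (\<forall>ts\<in>{0..T}. \<exists>d<0.
           ((\<lambda>s. pres (V s T)) has_real_derivative d) (at ts within {0..T})))"

end

theory Submission
  imports Defs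
begin

text \<open>On a smooth piece of the flow the flux \<open>J = x \<rho> u\<close>, with \<open>x = r0 - t\<close>, and the
  entropy are constant, and the Bernoulli function satisfies \<open>B' = E\<close>. At given radius, flux
  and entropy, \<open>B\<close> is a function of the density with a single minimum, at the sonic state.
  Hence \<open>B\<close> determines the density on the supersonic branch and on the subsonic branch, and
  with \<open>F = x E\<close> a flow of either kind is the same as a solution of the planar system
  \<open>B' = F / x\<close>, \<open>F' = x \<rho> - x b\<close>.

  The flow stays away from the sonic state. The sonic value of \<open>B\<close> is a multiple of
  \<open>x powr (- k)\<close> with \<open>k = 2 (\<gamma> - 1) / (\<gamma> + 1)\<close>, so the quotient \<open>w\<close> of \<open>B\<close> and
  this power increases exactly when \<open>F > k B\<close>. As the density is positive, \<open>F\<close> loses only a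
  bounded amount, and integration gives \<open>B \<le> B_in + (F + C t) ln (r0 / x)\<close>. If
  \<open>k ln (r0 / x) < 1\<close> on the whole interval and \<open>E0\<close> is large, this implies
  \<open>F > k B\<close>. The bound involves only \<open>B\<close> and \<open>F\<close>, which are continuous across a shock, so
  it holds ahead of the shock and behind it (lemma \<open>accelerating\<close>). For existence there
  remains the danger of blow-up behind the shock. For \<open>\<gamma> \<ge> 2\<close> the subsonic density grows at
  most linearly in \<open>B\<close>, and the solutions are global; for \<open>\<gamma> < 2\<close> a short interval prevents
  it. Uniqueness follows from Gronwall's inequality.

  The exit pressure is differentiated in the shock position \<open>s\<close> by means of the linearised
  system. Let \<open>\<beta>\<close> and \<open>\<phi>\<close> be the derivatives of \<open>B\<close> and \<open>F\<close> behind the shock. At the shock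
  \<open>\<beta> = 0\<close>, because \<open>B\<close> and \<open>B'\<close> are continuous across it, and
  \<open>\<phi> = x (\<rho>\<^sub>- - \<rho>\<^sub>+) < 0\<close>, because a shock compresses. As \<open>w\<close> increases ahead of the
  shock, so do the Mach number there and the entropy behind the shock (lemma \<open>a_down_deriv\<close>).
  On the subsonic branch the density increases with \<open>B\<close> and, at given \<open>B\<close>, decreases with the
  entropy. The linearised system is therefore cooperative with a nonpositive source, and
  \<open>\<beta> \<le> 0\<close> at the exit (lemma \<open>exit_bernoulli_nonincreasing\<close>). Finally, on the subsonic
  branch the pressure increases with \<open>B\<close> and, at given \<open>B\<close>, decreases with the entropy, so its
  derivative in \<open>s\<close> is negative (lemma \<open>exit_pressure_decreasing\<close>).\<close>

section \<open>Ordinary differential equations\<close>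

lemma nondecreasing_if_derivative_nonneg_within:
  fixes f f' :: "real \<Rightarrow> real"
  assumes "a \<le> b"
    and der: "\<And>t. t \<in> {a..b} \<Longrightarrow> (f has_real_derivative f' t) (at t within {a..b})"
    and nonneg: "\<And>t. a < t \<Longrightarrow> t < b \<Longrightarrow> 0 \<le> f' t"
  shows "f a \<le> f b"
proof (rule DERIV_nonneg_imp_increasing_open[OF assms(1)])
  show "\<exists>y. (f has_real_derivative y) (at x) \<and> 0 \<le> y" if "a < x" "x < b" for x
    using der[of x] nonneg[of x] that by (auto simp: at_within_Icc_at)
  show "continuous_on {a..b} f"
    by (rule DERIV_continuous_on[OF der])
qed

text \<open>Adding \<open>e\<^sup>2\<close> to the squared norm absorbs the forcing:
  \<open>2 (D \<bullet> d) \<le> (2 K + 1) (D \<bullet> D + e\<^sup>2)\<close>, so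
  \<open>(D \<bullet> D + e\<^sup>2) exp (- (2 K + 1) t)\<close> decreases. Uniqueness is the case \<open>e = 0\<close>;
  a small \<open>e\<close> compares the solutions of two nearby equations.\<close>

lemma gronwall_norm:
  fixes D d :: "real \<Rightarrow> 'a::real_inner"
  assumes "a \<le> b" "0 \<le> K" "0 \<le> e"
    and der: "\<And>t. t \<in> {a..b} \<Longrightarrow> (D has_vector_derivative d t) (at t within {a..b})"
    and bound: "\<And>t. t \<in> {a..b} \<Longrightarrow> norm (d t) \<le> K * norm (D t) + e"
  shows "norm (D b) \<le> (norm (D a) + e) * exp ((2 * K + 1) * (b - a))"
proof -
  define c where "c = 2 * K + 1"
  define Q where "Q t = - ((D t \<bullet> D t + e\<^sup>2) * exp (- c * t))" for t
  have "Q a \<le> Q b"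
  proof (rule nondecreasing_if_derivative_nonneg_within[OF \<open>a \<le> b\<close>])
    fix t assume t: "t \<in> {a..b}"
    have "((\<lambda>t. D t \<bullet> D t) has_derivative (\<lambda>h. D t \<bullet> (h *\<^sub>R d t) + (h *\<^sub>R d t) \<bullet> D t))
        (at t within {a..b})"
      using der[OF t] unfolding has_vector_derivative_def by (intro has_derivative_inner)
    then have "((\<lambda>t. D t \<bullet> D t) has_real_derivative 2 * (D t \<bullet> d t)) (at t within {a..b})"
      by (rule has_derivative_imp_has_field_derivative) (simp add: inner_commute)
    from DERIV_cmult_right[OF this]
    show "(Q has_real_derivative (c * (D t \<bullet> D t + e\<^sup>2) - 2 * (D t \<bullet> d t)) * exp (- c * t))
        (at t within {a..b})"
      unfolding Q_def
      by (auto intro!: derivative_eq_intros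
            \<open>((\<lambda>t. D t \<bullet> D t) has_real_derivative 2 * (D t \<bullet> d t)) (at t within {a..b})\<close>
            simp: algebra_simps)
  next
    fix t assume "a < t" "t < b"
    then have t: "t \<in> {a..b}" by simp
    have "D t \<bullet> d t \<le> norm (D t) * norm (d t)" by (rule norm_cauchy_schwarz)
    also have "\<dots> \<le> norm (D t) * (K * norm (D t) + e)"
      by (rule mult_left_mono[OF bound[OF t]]) simp
    finally have "2 * (D t \<bullet> d t) \<le> 2 * K * (norm (D t))\<^sup>2 + 2 * norm (D t) * e"
      by (simp add: power2_eq_square algebra_simps)
    also have "2 * norm (D t) * e \<le> (norm (D t))\<^sup>2 + e\<^sup>2"
      by (rule sum_squares_bound)
    finally have "2 * (D t \<bullet> d t) \<le> (2 * K + 1) * (norm (D t))\<^sup>2 + e\<^sup>2"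
      by (simp add: algebra_simps)
    moreover have "e\<^sup>2 \<le> c * e\<^sup>2"
      using mult_right_mono[of 1 c "e\<^sup>2"] \<open>0 \<le> K\<close> by (simp add: c_def)
    ultimately have "2 * (D t \<bullet> d t) \<le> c * (D t \<bullet> D t + e\<^sup>2)"
      by (simp add: c_def dot_square_norm algebra_simps)
    then show "0 \<le> (c * (D t \<bullet> D t + e\<^sup>2) - 2 * (D t \<bullet> d t)) * exp (- c * t)"
      by simp
  qed
  then have "(D b \<bullet> D b + e\<^sup>2) * exp (- c * b) \<le> (D a \<bullet> D a + e\<^sup>2) * exp (- c * a)"
    by (simp add: Q_def)
  then have "(D b \<bullet> D b + e\<^sup>2) * exp (- c * b) * exp (c * b)
      \<le> (D a \<bullet> D a + e\<^sup>2) * exp (- c * a) * exp (c * b)"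
    by (rule mult_right_mono) simp
  then have le: "D b \<bullet> D b + e\<^sup>2 \<le> (D a \<bullet> D a + e\<^sup>2) * exp (c * (b - a))"
    by (simp add: mult.assoc flip: exp_add) (simp add: algebra_simps)
  have E: "1 \<le> exp (c * (b - a))"
    using \<open>a \<le> b\<close> \<open>0 \<le> K\<close> by (simp add: c_def)
  have "(norm (D b))\<^sup>2 \<le> ((norm (D a))\<^sup>2 + e\<^sup>2) * exp (c * (b - a))"
    using le by (simp add: dot_square_norm) (use zero_le_power2[of e] in linarith)
  also have "\<dots> \<le> (norm (D a) + e)\<^sup>2 * (exp (c * (b - a)))\<^sup>2"
  proof (rule mult_mono)
    show "(norm (D a))\<^sup>2 + e\<^sup>2 \<le> (norm (D a) + e)\<^sup>2"
      using \<open>0 \<le> e\<close> by (simp add: power2_sum)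
    show "exp (c * (b - a)) \<le> (exp (c * (b - a)))\<^sup>2"
      using mult_right_mono[OF E, of "exp (c * (b - a))"] by (simp add: power2_eq_square)
  qed auto
  finally have "(norm (D b))\<^sup>2 \<le> ((norm (D a) + e) * exp (c * (b - a)))\<^sup>2"
    by (simp add: power_mult_distrib)
  then show ?thesis
    unfolding c_def by (rule power2_le_imp_le) (use \<open>0 \<le> e\<close> in simp)
qed

text \<open>The starting time may lie anywhere in the interval, and the solution extends to both
  sides of it. Integrating from the left end and subtracting the value at \<open>s\<close> treats both
  sides with a single integral function. In the norm weighted by \<open>exp (2 l \<bar>t - s\<bar>)\<close> the
  Picard operator is a contraction on the whole interval at once.\<close>

lemma ode_solution_exists:
  fixes f :: "real \<Rightarrow> 'a::banach \<Rightarrow> 'a"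
  assumes s: "s \<in> {a..b}"
    and cont: "\<And>y. continuous_on {a..b} y \<Longrightarrow> continuous_on {a..b} (\<lambda>t. f t (y t))"
    and lip: "\<And>t x y. t \<in> {a..b} \<Longrightarrow> norm (f t x - f t y) \<le> L * norm (x - y)"
  obtains y where "y s = y0"
    and "\<And>t. t \<in> {a..b} \<Longrightarrow> (y has_vector_derivative f t (y t)) (at t within {a..b})"
proof -
  define l where "l = \<bar>L\<bar> + 1"
  have l: "0 < l" by (simp add: l_def)
  have lip': "norm (f t x - f t y) \<le> l * norm (x - y)" if "t \<in> {a..b}" for t x y
  proof -
    have "L * norm (x - y) \<le> l * norm (x - y)"
      by (rule mult_right_mono) (auto simp: l_def)
    then show ?thesis using lip[OF that, of x y] by linarith
  qed
  define \<omega> where "\<omega> t = exp (2 * l * \<bar>t - s\<bar>)" for t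
  have \<omega>: "0 < \<omega> t" for t by (simp add: \<omega>_def)
  have \<omega>_cont: "continuous_on A \<omega>" for A
    unfolding \<omega>_def by (intro continuous_intros)
  define v where "v g t = \<omega> t *\<^sub>R apply_bcontfun g t" for g :: "real \<Rightarrow>\<^sub>C 'a" and t
  have v_cont: "continuous_on A (v g)" for g A
    unfolding v_def by (intro continuous_intros \<omega>_cont continuous_on_apply_bcontfun)
  define I where "I g t = integral {a..t} (\<lambda>t. f t (v g t))" for g t
  have I: "(I g has_vector_derivative f t (v g t)) (at t within {a..b})" if "t \<in> {a..b}" for g t
    unfolding I_def using integral_has_vector_derivative[OF cont[OF v_cont] that] .
  have I_cont: "continuous_on {a..b} (I g)" for g
    by (rule continuous_on_vector_derivative[OF I])
  define R where "R g t = (1 / \<omega> t) *\<^sub>R (y0 + I g t - I g s)" for g t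
  have R_cont: "continuous_on {a..b} (R g)" for g
    unfolding R_def by (intro continuous_intros I_cont \<omega>_cont) (use \<omega> in \<open>auto simp: less_le\<close>)
  define P where "P g = Bcontfun (ext_cont (R g) a b)" for g
  have ab: "a \<le> b" using s by simp
  have bcont: "ext_cont (R g) a b \<in> bcontfun" for g
  proof -
    have "bounded (range (ext_cont (R g) a b))"
      unfolding ext_cont_def
      by (rule clamp_bounded) (use R_cont[of g] in \<open>auto intro!: compact_imp_bounded compact_continuous_image\<close>)
    moreover have "continuous_on UNIV (ext_cont (R g) a b)"
      using R_cont[of g] by (intro continuous_on_ext_cont) auto
    ultimately show ?thesis unfolding bcontfun_def by simp
  qed
  have P: "apply_bcontfun (P g) t = R g (clamp a b t)" for g t
    unfolding P_def Bcontfun_inverse[OF bcont] by (simp add: ext_cont_def)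
  (* Integrating the Lipschitz bound l against the weight, which grows at rate 2 l, leaves 1 / 2. *)
  have contr: "dist (P g) (P h) \<le> 1 / 2 * dist g h" for g h
  proof (rule dist_bound)
    fix t0
    define t where "t = clamp a b t0"
    have t: "t \<in> {a..b}"
      using clamp_in_interval[of a b t0] ab by (simp add: t_def)
    define d where "d t = I g t - I h t" for t
    have d: "(d has_vector_derivative f t (v g t) - f t (v h t)) (at t within {a..b})"
      if "t \<in> {a..b}" for t
      unfolding d_def using I[OF that] by (intro derivative_intros)
    have d_at: "(d has_vector_derivative f t (v g t) - f t (v h t)) (at t)" if "a < t" "t < b" for t
      using d[of t] that by (simp add: at_within_Icc_at)
    have d_cont: "continuous_on {a..b} d"
      by (rule continuous_on_vector_derivative[OF d])
    have d_le: "norm (f t (v g t) - f t (v h t)) \<le> l * \<omega> t * dist g h" if "t \<in> {a..b}" for t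
    proof -
      have "norm (f t (v g t) - f t (v h t)) \<le> l * norm (v g t - v h t)"
        by (rule lip'[OF that])
      also have "norm (v g t - v h t) = \<omega> t * dist (apply_bcontfun g t) (apply_bcontfun h t)"
        using \<omega>[of t] by (simp add: v_def dist_norm flip: scaleR_diff_right)
      also have "\<dots> \<le> \<omega> t * dist g h"
        using \<omega>[of t] by (intro mult_left_mono dist_bounded) auto
      finally show ?thesis using l by (simp add: mult.assoc)
    qed
    have "norm (d t - d s) \<le> \<omega> t * (1 / 2 * dist g h)"
    proof (cases t s rule: linorder_cases)
      case equal then show ?thesis using \<omega>[of t] by simp
    next
      case greater
      define \<phi> where "\<phi> t = 1 / 2 * dist g h * exp (2 * l * (t - s))" for t
      have "norm (d t - d s) \<le> \<phi> t - \<phi> s"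
      proof (rule differentiable_bound_general[OF greater])
        show "continuous_on {s..t} d"
          by (rule continuous_on_subset[OF d_cont]) (use s t in auto)
        show "continuous_on {s..t} \<phi>" unfolding \<phi>_def by (intro continuous_intros)
        fix x assume x: "s < x" "x < t"
        show "(d has_vector_derivative f x (v g x) - f x (v h x)) (at x)"
          using x s t by (intro d_at) auto
        show "(\<phi> has_vector_derivative l * \<omega> x * dist g h) (at x)"
          unfolding \<phi>_def \<omega>_def using x
          by (auto intro!: derivative_eq_intros
              simp flip: has_real_derivative_iff_has_vector_derivative)
        show "norm (f x (v g x) - f x (v h x)) \<le> l * \<omega> x * dist g h"
          using x s t by (intro d_le) auto
      qed
      also have "\<dots> \<le> \<phi> t" by (simp add: \<phi>_def)
      also have "\<dots> = \<omega> t * (1 / 2 * dist g h)" using greater by (simp add: \<phi>_def \<omega>_def)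
      finally show ?thesis .
    next
      case less
      define \<phi> where "\<phi> t = - (1 / 2 * dist g h * exp (2 * l * (s - t)))" for t
      have "norm (d s - d t) \<le> \<phi> s - \<phi> t"
      proof (rule differentiable_bound_general[OF less])
        show "continuous_on {t..s} d"
          by (rule continuous_on_subset[OF d_cont]) (use s t in auto)
        show "continuous_on {t..s} \<phi>" unfolding \<phi>_def by (intro continuous_intros)
        fix x assume x: "t < x" "x < s"
        show "(d has_vector_derivative f x (v g x) - f x (v h x)) (at x)"
          using x s t by (intro d_at) auto
        show "(\<phi> has_vector_derivative l * \<omega> x * dist g h) (at x)"
          unfolding \<phi>_def \<omega>_def using x
          by (auto intro!: derivative_eq_intros
              simp flip: has_real_derivative_iff_has_vector_derivative)
        show "norm (f x (v g x) - f x (v h x)) \<le> l * \<omega> x * dist g h"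
          using x s t by (intro d_le) auto
      qed
      also have "\<dots> \<le> - \<phi> t" by (simp add: \<phi>_def)
      also have "\<dots> = \<omega> t * (1 / 2 * dist g h)" using less by (simp add: \<phi>_def \<omega>_def)
      finally show ?thesis by (simp add: norm_minus_commute)
    qed
    moreover have "dist (apply_bcontfun (P g) t0) (apply_bcontfun (P h) t0) = norm (d t - d s) / \<omega> t"
    proof -
      have "R g t - R h t = (1 / \<omega> t) *\<^sub>R (d t - d s)"
        by (simp add: R_def d_def algebra_simps)
      then show ?thesis using \<omega>[of t] by (simp add: P dist_norm t_def[symmetric])
    qed
    ultimately show "dist (apply_bcontfun (P g) t0) (apply_bcontfun (P h) t0) \<le> 1 / 2 * dist g h"
      using pos_divide_le_eq[OF \<omega>[of t], of "norm (d t - d s)" "1 / 2 * dist g h"]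
      by (simp add: mult.commute)
  qed
  then obtain g where g: "P g = g"
    using banach_fix_type[of "1 / 2" P] by auto
  have v: "v g t = y0 + I g t - I g s" if "t \<in> {a..b}" for t
  proof -
    have "clamp a b t = t" using that by (simp add: clamp_cancel_cbox)
    then have "apply_bcontfun g t = R g t" using P[of g t] by (simp add: g)
    then show ?thesis using \<omega>[of t] by (simp add: v_def R_def)
  qed
  show thesis
  proof (rule that[of "v g"])
    show "v g s = y0" using v[OF s] by simp
    fix t assume t: "t \<in> {a..b}"
    have "((\<lambda>t. y0 + I g t - I g s) has_vector_derivative f t (v g t)) (at t within {a..b})"
      using I[OF t, of g] by (auto intro!: derivative_eq_intros)
    then show "(v g has_vector_derivative f t (v g t)) (at t within {a..b})"
      by (rule has_vector_derivative_transform[OF t, rotated]) (simp add: v)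
  qed
qed

text \<open>Both the starting time and the field depend on the parameter \<open>s\<close>. The remainder
  \<open>y s - y s0 - (s - s0) \<eta>\<close> solves the linearised equation up to an error that is
  small compared with \<open>s - s0\<close>, and Gronwall's inequality carries this from the starting
  time to \<open>b\<close>. The initial value of \<open>\<eta>\<close> has two contributions: the starting point moves with
  velocity \<open>U'\<close>, while during the delay the reference solution moves with velocity
  \<open>f s0 (U s0) s0\<close>. As every \<open>y s\<close> is defined on the whole interval, the comparison can
  run from time \<open>s\<close> on, whether \<open>s\<close> precedes \<open>s0\<close> or follows it.\<close>

theorem solution_differentiable_in_starting_time:
  fixes f :: "real \<Rightarrow> 'a::real_inner \<Rightarrow> real \<Rightarrow> 'a" and y :: "real \<Rightarrow> real \<Rightarrow> 'a"
  assumes s0: "s0 \<in> {a..b}" and "0 \<le> K"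
    and lip: "\<And>t s x z. t \<in> {a..b} \<Longrightarrow> s \<in> {a..b} \<Longrightarrow> norm (f t x s - f t z s) \<le> K * norm (x - z)"
    and sol: "\<And>t s. t \<in> {a..b} \<Longrightarrow> s \<in> {a..b} \<Longrightarrow>
      (y s has_vector_derivative f t (y s t) s) (at t within {a..b})"
    and init: "\<And>s. s \<in> {a..b} \<Longrightarrow> y s s = U s"
    and U: "(U has_vector_derivative U') (at s0 within {a..b})"
    and lin: "\<And>t. t \<in> {a..b} \<Longrightarrow> linear (A t)"
    and A: "\<And>t x. t \<in> {a..b} \<Longrightarrow> norm (A t x) \<le> K * norm x"
    and r: "\<And>t. t \<in> {a..b} \<Longrightarrow> norm (r t) \<le> R"
    and frechet: "\<And>e. 0 < e \<Longrightarrow> \<exists>d>0. \<forall>t\<in>{a..b}. \<forall>s\<in>{a..b}. \<forall>x.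
      \<bar>s - s0\<bar> < d \<longrightarrow> norm (x - y s0 t) < d \<longrightarrow>
      norm (f t x s - f t (y s0 t) s0 - A t (x - y s0 t) - (s - s0) *\<^sub>R r t)
        \<le> e * (norm (x - y s0 t) + \<bar>s - s0\<bar>)"
    and \<eta>: "\<And>t. t \<in> {a..b} \<Longrightarrow> (\<eta> has_vector_derivative A t (\<eta> t) + r t) (at t within {a..b})"
    and \<eta>0: "\<eta> s0 = U' - f s0 (U s0) s0"
  shows "((\<lambda>s. y s b) has_vector_derivative \<eta> b) (at s0 within {a..b})"
proof -
  define E where "E = exp ((2 * K + 1) * (b - a))"
  have E: "0 < E" by (simp add: E_def)
  have E_mono: "exp ((2 * K + 1) * (t - s)) \<le> E" if "s \<in> {a..b}" "t \<in> {a..b}" for s t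
    using that \<open>0 \<le> K\<close> by (auto simp: E_def intro!: mult_left_mono)
  have "0 \<le> R" using r[OF s0] norm_ge_zero order_trans by blast

  have "((\<lambda>s. U s - y s0 s) has_vector_derivative \<eta> s0) (at s0 within {a..b})"
    using has_vector_derivative_diff[OF U sol[OF s0 s0]] \<eta>0 init[OF s0] by simp
  then have start: "\<exists>d>0. \<forall>s\<in>{a..b}. \<bar>s - s0\<bar> < d \<longrightarrow>
      norm (U s - y s0 s - (s - s0) *\<^sub>R \<eta> s0) \<le> e * \<bar>s - s0\<bar>" if "0 < e" for e
    using that init[OF s0]
    unfolding has_vector_derivative_def has_derivative_within_alt by simp

  obtain d1 where d1: "0 < d1" and start1: "\<And>s. s \<in> {a..b} \<Longrightarrow> \<bar>s - s0\<bar> < d1 \<Longrightarrow>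
      norm (U s - y s0 s - (s - s0) *\<^sub>R \<eta> s0) \<le> \<bar>s - s0\<bar>"
    using start[of 1] by auto
  obtain d2 where d2: "0 < d2" and par: "\<And>s t. s \<in> {a..b} \<Longrightarrow> t \<in> {a..b} \<Longrightarrow> \<bar>s - s0\<bar> < d2 \<Longrightarrow>
      norm (f t (y s0 t) s - f t (y s0 t) s0) \<le> (1 + R) * \<bar>s - s0\<bar>"
  proof -
    obtain d where "0 < d" and d: "\<forall>t\<in>{a..b}. \<forall>s\<in>{a..b}. \<forall>x.
      \<bar>s - s0\<bar> < d \<longrightarrow> norm (x - y s0 t) < d \<longrightarrow>
      norm (f t x s - f t (y s0 t) s0 - A t (x - y s0 t) - (s - s0) *\<^sub>R r t)
        \<le> 1 * (norm (x - y s0 t) + \<bar>s - s0\<bar>)"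
      using frechet[of 1] by auto
    show ?thesis
    proof (rule that[OF \<open>0 < d\<close>])
      fix s t assume st: "s \<in> {a..b}" "t \<in> {a..b}" "\<bar>s - s0\<bar> < d"
      have "norm (f t (y s0 t) s - f t (y s0 t) s0 - (s - s0) *\<^sub>R r t) \<le> \<bar>s - s0\<bar>"
        using d[rule_format, of t s "y s0 t"] st \<open>0 < d\<close> linear_0[OF lin] by simp
      moreover have "norm ((s - s0) *\<^sub>R r t) \<le> \<bar>s - s0\<bar> * R"
        using r[OF st(2)] by (simp add: mult_left_mono)
      ultimately show "norm (f t (y s0 t) s - f t (y s0 t) s0) \<le> (1 + R) * \<bar>s - s0\<bar>"
        using norm_triangle_sub[of "f t (y s0 t) s - f t (y s0 t) s0" "(s - s0) *\<^sub>R r t"]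
        by (simp add: algebra_simps)
    qed
  qed
  define M where "M = (norm (\<eta> s0) + 1 + (1 + R)) * E"
  have "0 < norm (\<eta> s0) + 1 + (1 + R)"
    using norm_ge_zero[of "\<eta> s0"] \<open>0 \<le> R\<close> by linarith
  then have M: "0 < M" using E by (simp add: M_def)
  (* A first estimate of order one in s - s0; it makes the Frechet remainder small. *)
  have close: "norm (y s t - y s0 t) \<le> M * \<bar>s - s0\<bar>"
    if s: "s \<in> {a..b}" "\<bar>s - s0\<bar> < d1" "\<bar>s - s0\<bar> < d2" and t: "t \<in> {s..b}" for s t
  proof -
    have sub: "{s..t} \<subseteq> {a..b}" using s t by auto
    have "norm (y s t - y s0 t)
        \<le> (norm (y s s - y s0 s) + (1 + R) * \<bar>s - s0\<bar>) * exp ((2 * K + 1) * (t - s))"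
    proof (rule gronwall_norm)
      show "s \<le> t" using t by simp
      show "0 \<le> K" by fact
      show "0 \<le> (1 + R) * \<bar>s - s0\<bar>" using \<open>0 \<le> R\<close> by simp
      fix \<tau> assume \<tau>: "\<tau> \<in> {s..t}"
      then have \<tau>': "\<tau> \<in> {a..b}" using sub by auto
      show "((\<lambda>t. y s t - y s0 t) has_vector_derivative f \<tau> (y s \<tau>) s - f \<tau> (y s0 \<tau>) s0)
          (at \<tau> within {s..t})"
        by (intro has_vector_derivative_diff
            has_vector_derivative_within_subset[OF sol sub] \<tau>' s s0)
      have "norm (f \<tau> (y s \<tau>) s - f \<tau> (y s0 \<tau>) s0)
          \<le> norm (f \<tau> (y s \<tau>) s - f \<tau> (y s0 \<tau>) s) + norm (f \<tau> (y s0 \<tau>) s - f \<tau> (y s0 \<tau>) s0)"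
        using norm_triangle_ineq[of "f \<tau> (y s \<tau>) s - f \<tau> (y s0 \<tau>) s"
            "f \<tau> (y s0 \<tau>) s - f \<tau> (y s0 \<tau>) s0"] by simp
      also have "\<dots> \<le> K * norm (y s \<tau> - y s0 \<tau>) + (1 + R) * \<bar>s - s0\<bar>"
        by (intro add_mono lip par \<tau>' s)
      finally show "norm (f \<tau> (y s \<tau>) s - f \<tau> (y s0 \<tau>) s0)
          \<le> K * norm (y s \<tau> - y s0 \<tau>) + (1 + R) * \<bar>s - s0\<bar>" .
    qed
    also have "\<dots> \<le> ((norm (\<eta> s0) + 1) * \<bar>s - s0\<bar> + (1 + R) * \<bar>s - s0\<bar>) * E"
    proof (intro mult_mono add_mono order_refl)
      have "norm (U s - y s0 s) \<le> \<bar>s - s0\<bar> + \<bar>s - s0\<bar> * norm (\<eta> s0)"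
        using start1[OF s(1,2)] norm_triangle_sub[of "U s - y s0 s" "(s - s0) *\<^sub>R \<eta> s0"]
        unfolding norm_scaleR real_norm_def by linarith
      then show "norm (y s s - y s0 s) \<le> (norm (\<eta> s0) + 1) * \<bar>s - s0\<bar>"
        by (simp add: init[OF s(1)] algebra_simps)
      show "exp ((2 * K + 1) * (t - s)) \<le> E" using s t by (intro E_mono) auto
    qed (use \<open>0 \<le> R\<close> in auto)
    finally show ?thesis by (simp add: M_def algebra_simps)
  qed

  have main: "\<exists>d>0. \<forall>s\<in>{a..b}. \<bar>s - s0\<bar> < d \<longrightarrow>
      norm (y s b - y s0 b - (s - s0) *\<^sub>R \<eta> b) \<le> e * \<bar>s - s0\<bar>" if "0 < e" for e
  proof -
    define e' where "e' = e / ((3 + M) * E)"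
    have e': "0 < e'" using \<open>0 < e\<close> E M by (simp add: e'_def)
    obtain d3 where d3: "0 < d3" and start3: "\<And>s. s \<in> {a..b} \<Longrightarrow> \<bar>s - s0\<bar> < d3 \<Longrightarrow>
      norm (U s - y s0 s - (s - s0) *\<^sub>R \<eta> s0) \<le> e' * \<bar>s - s0\<bar>"
      using start[OF e'] by auto
    obtain d4 where d4: "0 < d4" and fre: "\<And>s t x. t \<in> {a..b} \<Longrightarrow> s \<in> {a..b} \<Longrightarrow>
      \<bar>s - s0\<bar> < d4 \<Longrightarrow> norm (x - y s0 t) < d4 \<Longrightarrow>
      norm (f t x s - f t (y s0 t) s0 - A t (x - y s0 t) - (s - s0) *\<^sub>R r t)
        \<le> e' * (norm (x - y s0 t) + \<bar>s - s0\<bar>)"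
      using frechet[OF e'] by blast
    have "continuous_on {a..b} \<eta>"
      by (rule continuous_on_vector_derivative[OF \<eta>])
    then obtain d5 where d5: "0 < d5" and \<eta>c: "\<And>s. s \<in> {a..b} \<Longrightarrow> \<bar>s - s0\<bar> < d5 \<Longrightarrow>
        norm (\<eta> s - \<eta> s0) \<le> e'"
      using s0 e' unfolding continuous_on_iff dist_norm real_norm_def by (meson less_imp_le)
    (* Below d4 / M the first estimate brings y s into the range of the expansion. *)
    define d where "d = Min {d1, d2, d3, d4, d5, d4 / M}"
    have d: "0 < d" "d \<le> d1" "d \<le> d2" "d \<le> d3" "d \<le> d4" "d \<le> d5" "d \<le> d4 / M"
      using d1 d2 d3 d4 d5 M by (auto simp: d_def)
    show ?thesis
    proof (intro exI conjI ballI impI)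
      show "0 < d" by (rule d)
      fix s assume s: "s \<in> {a..b}" and "\<bar>s - s0\<bar> < d"
      then have sd: "\<bar>s - s0\<bar> < d1" "\<bar>s - s0\<bar> < d2" "\<bar>s - s0\<bar> < d3" "\<bar>s - s0\<bar> < d4"
        "\<bar>s - s0\<bar> < d5" "\<bar>s - s0\<bar> < d4 / M"
        using d by linarith+
      have sub: "{s..b} \<subseteq> {a..b}" using s by auto
      define D where "D t = y s t - y s0 t - (s - s0) *\<^sub>R \<eta> t" for t
      have "norm (D b) \<le> (norm (D s) + e' * (M + 1) * \<bar>s - s0\<bar>) * exp ((2 * K + 1) * (b - s))"
      proof (rule gronwall_norm)
        show "s \<le> b" using s by simp
        show "0 \<le> K" by fact
        show "0 \<le> e' * (M + 1) * \<bar>s - s0\<bar>" using e' M by simp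
        fix t assume t: "t \<in> {s..b}"
        then have t': "t \<in> {a..b}" using sub by auto
        show "(D has_vector_derivative f t (y s t) s - f t (y s0 t) s0
            - (s - s0) *\<^sub>R (A t (\<eta> t) + r t)) (at t within {s..b})"
          unfolding D_def
          by (intro has_vector_derivative_diff
              bounded_linear.has_vector_derivative[OF bounded_linear_scaleR_right]
              has_vector_derivative_within_subset[OF sol sub]
              has_vector_derivative_within_subset[OF \<eta> sub] t' s s0)
        have cl: "norm (y s t - y s0 t) \<le> M * \<bar>s - s0\<bar>"
          by (rule close[OF s sd(1,2) t])
        also have "\<dots> < d4" using sd(6) M by (simp add: pos_less_divide_eq mult.commute)
        finally have "norm (f t (y s t) s - f t (y s0 t) s0 - A t (y s t - y s0 t) - (s - s0) *\<^sub>R r t)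
            \<le> e' * (norm (y s t - y s0 t) + \<bar>s - s0\<bar>)"
          by (intro fre t' s sd)
        also have "\<dots> \<le> e' * (M * \<bar>s - s0\<bar> + \<bar>s - s0\<bar>)"
          using cl e' by (intro mult_left_mono) auto
        finally have rem: "norm (f t (y s t) s - f t (y s0 t) s0 - A t (y s t - y s0 t) - (s - s0) *\<^sub>R r t)
            \<le> e' * (M + 1) * \<bar>s - s0\<bar>" by (simp add: algebra_simps)
        have "A t (D t) = A t (y s t - y s0 t) - (s - s0) *\<^sub>R A t (\<eta> t)"
          unfolding D_def using lin[OF t'] by (simp add: linear_diff linear_scale)
        then have "f t (y s t) s - f t (y s0 t) s0 - (s - s0) *\<^sub>R (A t (\<eta> t) + r t)
          = A t (D t) + (f t (y s t) s - f t (y s0 t) s0 - A t (y s t - y s0 t) - (s - s0) *\<^sub>R r t)"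
          by (simp add: algebra_simps)
        then have "norm (f t (y s t) s - f t (y s0 t) s0 - (s - s0) *\<^sub>R (A t (\<eta> t) + r t))
            \<le> norm (A t (D t))
              + norm (f t (y s t) s - f t (y s0 t) s0 - A t (y s t - y s0 t) - (s - s0) *\<^sub>R r t)"
          by (simp only: norm_triangle_ineq)
        then show "norm (f t (y s t) s - f t (y s0 t) s0 - (s - s0) *\<^sub>R (A t (\<eta> t) + r t))
            \<le> K * norm (D t) + e' * (M + 1) * \<bar>s - s0\<bar>"
          using A[OF t', of "D t"] rem by linarith
      qed
      also have "\<dots> \<le> (2 * e' * \<bar>s - s0\<bar> + e' * (M + 1) * \<bar>s - s0\<bar>) * E"
      proof (intro mult_mono add_mono order_refl)
        have "D s = (U s - y s0 s - (s - s0) *\<^sub>R \<eta> s0) - (s - s0) *\<^sub>R (\<eta> s - \<eta> s0)"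
          by (simp add: D_def init[OF s] algebra_simps)
        then have "norm (D s) \<le> norm (U s - y s0 s - (s - s0) *\<^sub>R \<eta> s0) + \<bar>s - s0\<bar> * norm (\<eta> s - \<eta> s0)"
          using norm_triangle_ineq4[of "U s - y s0 s - (s - s0) *\<^sub>R \<eta> s0" "(s - s0) *\<^sub>R (\<eta> s - \<eta> s0)"]
          by simp
        also have "\<dots> \<le> e' * \<bar>s - s0\<bar> + \<bar>s - s0\<bar> * e'"
          by (intro add_mono mult_left_mono start3 \<eta>c s sd) auto
        finally show "norm (D s) \<le> 2 * e' * \<bar>s - s0\<bar>" by simp
        show "exp ((2 * K + 1) * (b - s)) \<le> E" using s by (intro E_mono) auto
      qed (use e' M in auto)
      also have "\<dots> = e' * ((3 + M) * E) * \<bar>s - s0\<bar>"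
        by (simp add: algebra_simps)
      also have "e' * ((3 + M) * E) = e"
        using E M by (simp add: e'_def)
      finally show "norm (y s b - y s0 b - (s - s0) *\<^sub>R \<eta> b) \<le> e * \<bar>s - s0\<bar>"
        by (simp add: D_def)
    qed
  qed
  then show ?thesis
    unfolding has_vector_derivative_def has_derivative_within_alt
    by (auto intro: bounded_linear_scaleR_left)
qed

lemma mean_value_between:
  fixes f f' :: "real \<Rightarrow> real"
  assumes "\<And>\<xi>. \<bar>\<xi> - x0\<bar> \<le> \<bar>x - x0\<bar> \<Longrightarrow> (f has_real_derivative f' \<xi>) (at \<xi>)"
  obtains \<xi> where "\<bar>\<xi> - x0\<bar> \<le> \<bar>x - x0\<bar>" "f x - f x0 = f' \<xi> * (x - x0)"
proof (cases x x0 rule: linorder_cases)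
  case less
  then have "\<exists>\<xi>>x. \<xi> < x0 \<and> f x0 - f x = (x0 - x) * f' \<xi>"
    by (intro MVT2[OF less] assms) auto
  then obtain \<xi> where "x < \<xi>" "\<xi> < x0" "f x0 - f x = (x0 - x) * f' \<xi>" by auto
  then show thesis by (intro that[of \<xi>]) (auto simp: algebra_simps)
next
  case equal
  then show thesis using that[of x] by simp
next
  case greater
  then have "\<exists>\<xi>>x0. \<xi> < x \<and> f x - f x0 = (x - x0) * f' \<xi>"
    by (intro MVT2[OF greater] assms) auto
  then obtain \<xi> where "x0 < \<xi>" "\<xi> < x" "f x - f x0 = (x - x0) * f' \<xi>" by auto
  then show thesis by (intro that[of \<xi>]) (auto simp: algebra_simps)
qed

text \<open>One \<open>d\<close> serves all times: the partial derivatives are uniformly continuous on a compact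
  neighbourhood of the curve \<open>(t, x0 t, a0)\<close>, and the mean value theorem applies in one
  variable after the other.\<close>

lemma uniform_first_order_expansion:
  fixes G Gx Ga :: "real \<Rightarrow> real \<Rightarrow> real \<Rightarrow> real" and x0 :: "real \<Rightarrow> real"
  assumes a0: "0 < a0"
    and dx: "\<And>t x a. t \<in> {p..q} \<Longrightarrow> 0 < a \<Longrightarrow> ((\<lambda>x. G t x a) has_real_derivative Gx t x a) (at x)"
    and da: "\<And>t x a. t \<in> {p..q} \<Longrightarrow> 0 < a \<Longrightarrow> ((\<lambda>a. G t x a) has_real_derivative Ga t x a) (at a)"
    and cx: "continuous_on ({p..q} \<times> UNIV \<times> {0<..}) (\<lambda>(t, x, a). Gx t x a)"
    and ca: "continuous_on ({p..q} \<times> UNIV \<times> {0<..}) (\<lambda>(t, x, a). Ga t x a)"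
    and x0: "continuous_on {p..q} x0"
    and "0 < e"
  obtains d where "0 < d" "d < a0"
    and "\<And>t x a. t \<in> {p..q} \<Longrightarrow> \<bar>x - x0 t\<bar> < d \<Longrightarrow> \<bar>a - a0\<bar> < d \<Longrightarrow>
      \<bar>G t x a - G t (x0 t) a0 - Gx t (x0 t) a0 * (x - x0 t) - Ga t (x0 t) a0 * (a - a0)\<bar>
        \<le> e * (\<bar>x - x0 t\<bar> + \<bar>a - a0\<bar>)"
proof -
  have "bounded (x0 ` {p..q})"
    by (intro compact_imp_bounded compact_continuous_image x0) simp
  then obtain R where "\<forall>x\<in>x0 ` {p..q}. norm x \<le> R"
    unfolding bounded_iff by blast
  then have R: "\<bar>x0 t\<bar> \<le> R" if "t \<in> {p..q}" for t
    using that by auto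
  define N where "N = {p..q} \<times> {- R - 1..R + 1} \<times> {a0 / 2..2 * a0}"
  have "compact N" unfolding N_def by (intro compact_Times) auto
  moreover have N: "N \<subseteq> {p..q} \<times> UNIV \<times> {0<..}" using a0 by (auto simp: N_def)
  ultimately have
    ux: "uniformly_continuous_on N (\<lambda>(t, x, a). Gx t x a)" and
    ua: "uniformly_continuous_on N (\<lambda>(t, x, a). Ga t x a)"
    using cx ca by (auto intro!: compact_uniformly_continuous intro: continuous_on_subset)
  obtain d1 where d1: "0 < d1" "\<And>u v. u \<in> N \<Longrightarrow> v \<in> N \<Longrightarrow> dist v u < d1 \<Longrightarrow>
      dist (case v of (t, x, a) \<Rightarrow> Gx t x a) (case u of (t, x, a) \<Rightarrow> Gx t x a) < e"
    using ux \<open>0 < e\<close> unfolding uniformly_continuous_on_def by meson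
  obtain d2 where d2: "0 < d2" "\<And>u v. u \<in> N \<Longrightarrow> v \<in> N \<Longrightarrow> dist v u < d2 \<Longrightarrow>
      dist (case v of (t, x, a) \<Rightarrow> Ga t x a) (case u of (t, x, a) \<Rightarrow> Ga t x a) < e"
    using ua \<open>0 < e\<close> unfolding uniformly_continuous_on_def by meson
  define d where "d = Min {d1 / 2, d2 / 2, 1, a0 / 2}"
  have d: "0 < d" "d \<le> d1 / 2" "d \<le> d2 / 2" "d \<le> 1" "d \<le> a0 / 2"
    using d1 d2 a0 by (auto simp: d_def)
  have dist3: "dist (t, x, a) (t, x', a') \<le> \<bar>x - x'\<bar> + \<bar>a - a'\<bar>" for t x a x' a' :: real
    using sqrt_sum_squares_le_sum_abs[of "x - x'" "a - a'"] by (simp add: dist_Pair_Pair dist_real_def)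
  show thesis
  proof (rule that[of d])
    show "0 < d" by (rule d)
    show "d < a0" using d a0 by linarith
    fix t x a assume t: "t \<in> {p..q}" and x: "\<bar>x - x0 t\<bar> < d" and a: "\<bar>a - a0\<bar> < d"
    have "0 < a" using a d a0 by linarith
    have inN: "(t, x', a') \<in> N" if "\<bar>x' - x0 t\<bar> \<le> \<bar>x - x0 t\<bar>" "\<bar>a' - a0\<bar> \<le> \<bar>a - a0\<bar>" for x' a'
      using that t x a R[OF t] d unfolding N_def by (auto simp: abs_le_iff)
    have near: "dist (t, x', a') (t, x0 t, a0) < d1" "dist (t, x', a') (t, x0 t, a0) < d2"
      if "\<bar>x' - x0 t\<bar> \<le> \<bar>x - x0 t\<bar>" "\<bar>a' - a0\<bar> \<le> \<bar>a - a0\<bar>" for x' a'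
      using dist3[of t x' a' "x0 t" a0] that x a d by linarith+
    have inN0: "(t, x0 t, a0) \<in> N" by (rule inN) auto
    obtain \<xi> where \<xi>: "\<bar>\<xi> - x0 t\<bar> \<le> \<bar>x - x0 t\<bar>" "G t x a - G t (x0 t) a = Gx t \<xi> a * (x - x0 t)"
      by (rule mean_value_between[where x = x and ?x0.0 = "x0 t" and f = "\<lambda>x. G t x a", OF dx[OF t \<open>0 < a\<close>]])
    have "0 < \<alpha>" if "\<bar>\<alpha> - a0\<bar> \<le> \<bar>a - a0\<bar>" for \<alpha> using that a d a0 by linarith
    then obtain \<alpha> where \<alpha>: "\<bar>\<alpha> - a0\<bar> \<le> \<bar>a - a0\<bar>"
      "G t (x0 t) a - G t (x0 t) a0 = Ga t (x0 t) \<alpha> * (a - a0)"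
      using mean_value_between[of a0 a "\<lambda>a. G t (x0 t) a" "Ga t (x0 t)"] da[OF t] by metis
    have 1: "\<bar>Gx t \<xi> a - Gx t (x0 t) a0\<bar> \<le> e"
      using d1(2)[OF inN0 inN[OF \<xi>(1)] near(1)[OF \<xi>(1)], of a] by (simp add: dist_real_def)
    have 2: "\<bar>Ga t (x0 t) \<alpha> - Ga t (x0 t) a0\<bar> \<le> e"
      using d2(2)[OF inN0 inN[OF _ \<alpha>(1)] near(2)[OF _ \<alpha>(1)], of "x0 t"] by (simp add: dist_real_def)
    have "G t x a - G t (x0 t) a0 - Gx t (x0 t) a0 * (x - x0 t) - Ga t (x0 t) a0 * (a - a0)
      = (Gx t \<xi> a - Gx t (x0 t) a0) * (x - x0 t) + (Ga t (x0 t) \<alpha> - Ga t (x0 t) a0) * (a - a0)"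
      using \<xi>(2) \<alpha>(2) by (simp add: algebra_simps)
    also have "\<bar>\<dots>\<bar> \<le> \<bar>Gx t \<xi> a - Gx t (x0 t) a0\<bar> * \<bar>x - x0 t\<bar>
        + \<bar>Ga t (x0 t) \<alpha> - Ga t (x0 t) a0\<bar> * \<bar>a - a0\<bar>"
      by (rule abs_triangle_ineq[THEN order_trans]) (simp add: abs_mult)
    also have "\<dots> \<le> e * \<bar>x - x0 t\<bar> + e * \<bar>a - a0\<bar>"
      by (intro add_mono mult_right_mono 1 2) auto
    finally show "\<bar>G t x a - G t (x0 t) a0 - Gx t (x0 t) a0 * (x - x0 t) - Ga t (x0 t) a0 * (a - a0)\<bar>
        \<le> e * (\<bar>x - x0 t\<bar> + \<bar>a - a0\<bar>)" by (simp add: algebra_simps)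
  qed
qed

text \<open>Each unknown pushes the other one in its own direction, because \<open>m\<close> and \<open>q\<close> are
  nonnegative. The sum of the squared positive parts therefore satisfies a linear differential
  inequality, and it vanishes at the start.\<close>

lemma cooperative_system_nonpos:
  fixes \<beta> \<phi> :: "real \<Rightarrow> real"
  assumes "a \<le> b" "0 \<le> K"
    and \<beta>: "\<And>t. t \<in> {a..b} \<Longrightarrow> (\<beta> has_real_derivative m t * \<phi> t) (at t within {a..b})"
    and \<phi>: "\<And>t. t \<in> {a..b} \<Longrightarrow> (\<phi> has_real_derivative q t * \<beta> t + r t) (at t within {a..b})"
    and m: "\<And>t. t \<in> {a..b} \<Longrightarrow> 0 \<le> m t \<and> m t \<le> K"
    and q: "\<And>t. t \<in> {a..b} \<Longrightarrow> 0 \<le> q t \<and> q t \<le> K"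
    and r: "\<And>t. t \<in> {a..b} \<Longrightarrow> r t \<le> 0"
    and init: "\<beta> a \<le> 0" "\<phi> a \<le> 0"
  shows "\<beta> b \<le> 0"
proof -
  (* Unlike the positive part itself, its square is differentiable at 0. *)
  have pos_part: "((\<lambda>x. (max x 0)\<^sup>2) has_real_derivative 2 * max x 0) (at x)" for x :: real
  proof (cases x "0::real" rule: linorder_cases)
    case less
    have "((\<lambda>x::real. 0) has_real_derivative 2 * max x 0) (at x)" using less by simp
    moreover have "eventually (\<lambda>x::real. 0 = (max x 0)\<^sup>2) (nhds x)"
      using eventually_nhds_in_open[of "{..<0}" x] less by (auto elim!: eventually_mono)
    ultimately show ?thesis by (subst (asm) DERIV_cong_ev[OF refl _ refl]) auto
  next
    case greater
    have "((\<lambda>x::real. x\<^sup>2) has_real_derivative 2 * max x 0) (at x)"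
      using greater by (auto intro!: derivative_eq_intros)
    moreover have "eventually (\<lambda>x::real. x\<^sup>2 = (max x 0)\<^sup>2) (nhds x)"
      using eventually_nhds_in_open[of "{0<..}" x] greater by (auto elim!: eventually_mono)
    ultimately show ?thesis by (subst (asm) DERIV_cong_ev[OF refl _ refl]) auto
  next
    case equal
    have "((\<lambda>h::real. max h 0 ^ 2 / h) \<longlongrightarrow> 0) (at 0)"
    proof (rule Lim_null_comparison)
      show "\<forall>\<^sub>F h in at 0. norm (max h 0 ^ 2 / h) \<le> \<bar>h::real\<bar>"
        by (intro always_eventually allI) (auto simp: max_def power2_eq_square)
      show "((\<lambda>h::real. \<bar>h\<bar>) \<longlongrightarrow> 0) (at 0)"
        by (rule tendsto_eq_intros refl | simp)+
    qed
    then show ?thesis using equal by (simp add: DERIV_def)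
  qed
  define Q where "Q t = - (((max (\<beta> t) 0)\<^sup>2 + (max (\<phi> t) 0)\<^sup>2) * exp (- (2 * K) * t))" for t
  define Q' where "Q' t = (2 * K * ((max (\<beta> t) 0)\<^sup>2 + (max (\<phi> t) 0)\<^sup>2)
      - (2 * max (\<beta> t) 0 * (m t * \<phi> t) + 2 * max (\<phi> t) 0 * (q t * \<beta> t + r t))) * exp (- (2 * K) * t)" for t
  have "Q a \<le> Q b"
  proof (rule nondecreasing_if_derivative_nonneg_within[OF \<open>a \<le> b\<close>])
    fix t assume t: "t \<in> {a..b}"
    note d = DERIV_add[OF DERIV_chain2[OF pos_part \<beta>[OF t]] DERIV_chain2[OF pos_part \<phi>[OF t]]]
    have e: "((\<lambda>t. exp (- (2 * K) * t)) has_real_derivative - (2 * K) * exp (- (2 * K) * t))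
        (at t within {a..b})"
      by (auto intro!: derivative_eq_intros)
    show "(Q has_real_derivative Q' t)
        (at t within {a..b})"
      unfolding Q_def Q'_def using DERIV_minus[OF DERIV_mult[OF d e]] by (simp add: algebra_simps)
  next
    fix t assume "a < t" "t < b"
    then have t: "t \<in> {a..b}" by simp
    define B P where "B = max (\<beta> t) 0" and "P = max (\<phi> t) 0"
    have BP: "0 \<le> B" "0 \<le> P" "\<beta> t \<le> B" "\<phi> t \<le> P" by (auto simp: B_def P_def)
    have "B * (m t * \<phi> t) \<le> B * (K * P)"
      using m[OF t] BP by (intro mult_left_mono order_trans[OF mult_left_mono mult_right_mono]) auto
    moreover have "P * (q t * \<beta> t + r t) \<le> P * (K * B)"
    proof (rule mult_left_mono)
      have "q t * \<beta> t \<le> K * B"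
        using q[OF t] BP by (intro order_trans[OF mult_left_mono mult_right_mono]) auto
      then show "q t * \<beta> t + r t \<le> K * B" using r[OF t] by simp
    qed (rule BP)
    ultimately have "2 * B * (m t * \<phi> t) + 2 * P * (q t * \<beta> t + r t) \<le> 2 * K * (2 * B * P)"
      by (simp add: algebra_simps)
    also have "\<dots> \<le> 2 * K * (B\<^sup>2 + P\<^sup>2)"
      using \<open>0 \<le> K\<close> sum_squares_bound[of B P] by (intro mult_left_mono) auto
    finally show "0 \<le> Q' t"
      unfolding B_def P_def Q'_def by simp
  qed
  then have "((max (\<beta> b) 0)\<^sup>2 + (max (\<phi> b) 0)\<^sup>2) * exp (- (2 * K) * b) \<le> 0"
    using init by (simp add: Q_def max_def)
  then have "(max (\<beta> b) 0)\<^sup>2 + (max (\<phi> b) 0)\<^sup>2 \<le> 0"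
    by (simp add: mult_le_0_iff not_le[symmetric])
  then have "max (\<beta> b) 0 = 0"
    using sum_power2_le_zero_iff by blast
  then show ?thesis by simp
qed

section \<open>States of a polytropic gas\<close>

lemma powr_less_one_iff: "0 < r \<Longrightarrow> 0 < z \<Longrightarrow> z powr r < 1 \<longleftrightarrow> z < 1"
  for z r :: real
  using powr_less_mono2[of r z 1] powr_mono2[of r 1 z] by (fastforce simp: not_less[symmetric])

lemma one_less_powr_iff: "0 < r \<Longrightarrow> 0 < z \<Longrightarrow> 1 < z powr r \<longleftrightarrow> 1 < z"
  for z r :: real
  using powr_less_mono2[of r 1 z] powr_mono2[of r z 1] by (fastforce simp: not_less[symmetric])

locale polytropic_gas =
  fixes \<gamma> :: real
  assumes gamma_gt_1: "\<gamma> > 1"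
begin

text \<open>At given flux and entropy the sonic value of the Bernoulli function is proportional to
  the power \<open>- k\<close> of the radius; and \<open>k B\<close> is the squared velocity of the sonic states with
  Bernoulli value \<open>B\<close>.\<close>

definition k :: real where "k = 2 * (\<gamma> - 1) / (\<gamma> + 1)"

text \<open>The Bernoulli function in units of \<open>c\<^sup>2\<close>, where \<open>c\<close> is the speed at which the flow with
  the same flux and entropy would be sonic, as a function of \<open>z = c / u\<close>. It decreases on
  the supersonic side \<open>z < 1\<close> to the minimum \<open>1 / k\<close> and increases on the subsonic side
  \<open>z > 1\<close>.\<close>

definition g :: "real \<Rightarrow> real" where "g z = 1 / (2 * z\<^sup>2) + z powr (\<gamma> - 1) / (\<gamma> - 1)"

definition g' :: "real \<Rightarrow> real" where "g' z = (z powr (\<gamma> + 1) - 1) / z ^ 3"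

definition critical_speed :: "real \<Rightarrow> real \<Rightarrow> real" where
  "critical_speed a x = sqrt a * x powr (- (k / 2))"

text \<open>Coordinates for the states at radius \<open>x\<close>. The flux \<open>J = x \<rho> u\<close> and the entropy
  parameter \<open>a\<close> are constant along smooth flow, so that \<open>z\<close> is the only gas variable left. For
  given \<open>J\<close>, the parameter \<open>a\<close> is an increasing function of \<open>p / \<rho>\<^sup>\<gamma>\<close>.\<close>

definition gas_state :: "real \<Rightarrow> real \<Rightarrow> real \<Rightarrow> real \<Rightarrow> real \<Rightarrow> flow_state" where
  "gas_state J a x z e = (let c = critical_speed a x in
     \<lparr>rho = J * z / (x * c), vel = c / z, pres = J * c * z powr \<gamma> / (\<gamma> * x), elec = e\<rparr>)"

lemma k_pos: "0 < k" and inverse_k: "1 / k = 1 / 2 + 1 / (\<gamma> - 1)"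
  using gamma_gt_1 by (auto simp: k_def field_simps)

lemma g_1: "g 1 = 1 / k"
  using inverse_k by (simp add: g_def)

lemma g'_pos_iff: "0 < z \<Longrightarrow> 0 < g' z \<longleftrightarrow> 1 < z"
  and g'_neg_iff: "0 < z \<Longrightarrow> g' z < 0 \<longleftrightarrow> z < 1"
  using gamma_gt_1 powr_less_one_iff[of "\<gamma> + 1" z] one_less_powr_iff[of "\<gamma> + 1" z]
  by (simp_all add: g'_def zero_less_divide_iff divide_less_0_iff)

lemma powr_to_power: "0 < z \<Longrightarrow> z powr (\<gamma> - 2) = z powr (\<gamma> + 1) / z ^ 3"
  for z :: real
  using powr_diff[of z "\<gamma> + 1" 3] by (simp add: powr_numeral)

lemma g_deriv:
  assumes "0 < z"
  shows "(g has_real_derivative g' z) (at z)"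
proof -
  have "((\<lambda>z. 1 / (2 * z\<^sup>2)) has_real_derivative - 1 / z ^ 3) (at z)"
    using assms by (auto intro!: derivative_eq_intros simp: power2_eq_square power3_eq_cube field_simps)
  moreover have "((\<lambda>z. z powr (\<gamma> - 1) / (\<gamma> - 1)) has_real_derivative z powr (\<gamma> - 2)) (at z)"
    using DERIV_cdivide[OF has_real_derivative_powr[OF assms, of "\<gamma> - 1"], of "\<gamma> - 1"] gamma_gt_1
    by simp
  ultimately show ?thesis
    using DERIV_add assms by (fastforce simp: g_def[abs_def] g'_def powr_to_power diff_divide_distrib)
qed

lemma g_cont: "S \<subseteq> {0<..} \<Longrightarrow> continuous_on S g"
  by (rule DERIV_continuous_on[where D = g']) (auto intro: DERIV_subset[OF g_deriv])

lemma g_less_subsonic: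
  assumes "1 \<le> z" "z < z'"
  shows "g z < g z'"
proof (rule DERIV_pos_imp_increasing_open[OF assms(2)])
  show "\<exists>y. (g has_real_derivative y) (at x) \<and> 0 < y" if "z < x" "x < z'" for x
    using g_deriv[of x] g'_pos_iff[of x] that assms by (intro exI[of _ "g' x"]) auto
qed (use assms in \<open>auto intro: g_cont\<close>)

lemma g_less_supersonic:
  assumes "0 < z" "z < z'" "z' \<le> 1"
  shows "g z' < g z"
proof (rule DERIV_neg_imp_decreasing_open[OF assms(2)])
  show "\<exists>y. (g has_real_derivative y) (at x) \<and> y < 0" if "z < x" "x < z'" for x
    using g_deriv[of x] g'_neg_iff[of x] that assms by (intro exI[of _ "g' x"]) auto
qed (use assms in \<open>auto intro: g_cont\<close>)

lemma g_gt: "0 < z \<Longrightarrow> z \<noteq> 1 \<Longrightarrow> 1 / k < g z"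
  using g_less_subsonic[of 1 z] g_less_supersonic[of z 1]
  by (cases z "1::real" rule: linorder_cases) (auto simp: g_1)

definition subsonic :: "real \<Rightarrow> real" where "subsonic w = (THE z. 1 < z \<and> g z = w)"

definition supersonic :: "real \<Rightarrow> real" where "supersonic w = (THE z. 0 < z \<and> z < 1 \<and> g z = w)"

lemma subsonic_g:
  assumes "1 < z"
  shows "subsonic (g z) = z"
  unfolding subsonic_def
proof (rule the_equality)
  fix z' assume "1 < z' \<and> g z' = g z"
  then show "z' = z"
    using assms g_less_subsonic[of z z'] g_less_subsonic[of z' z]
    by (cases z z' rule: linorder_cases) auto
qed (use assms in auto)

lemma supersonic_g:
  assumes "0 < z" "z < 1"
  shows "supersonic (g z) = z"
  unfolding supersonic_def
proof (rule the_equality)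
  fix z' assume "0 < z' \<and> z' < 1 \<and> g z' = g z"
  then show "z' = z"
    using assms g_less_supersonic[of z z'] g_less_supersonic[of z' z]
    by (cases z z' rule: linorder_cases) auto
qed (use assms in auto)

lemma subsonic:
  assumes "1 / k < w"
  shows "1 < subsonic w" "g (subsonic w) = w"
proof -
  define Z where "Z = max 2 (((\<gamma> - 1) * w) powr (1 / (\<gamma> - 1)))"
  have w: "0 < w" using assms k_pos by (meson divide_pos_pos less_trans zero_less_one)
  have "(\<gamma> - 1) * w = (((\<gamma> - 1) * w) powr (1 / (\<gamma> - 1))) powr (\<gamma> - 1)"
    using w gamma_gt_1 by (simp add: powr_powr)
  also have "\<dots> \<le> Z powr (\<gamma> - 1)"
    using w gamma_gt_1 by (intro powr_mono2) (auto simp: Z_def)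
  finally have "w \<le> Z powr (\<gamma> - 1) / (\<gamma> - 1)"
    using gamma_gt_1 by (simp add: field_simps)
  also have "\<dots> \<le> g Z" by (simp add: g_def)
  finally have "\<exists>z\<ge>1. z \<le> Z \<and> g z = w"
    using assms by (intro IVT') (auto simp: g_1 Z_def intro: g_cont)
  then obtain z where "1 \<le> z" "g z = w" by auto
  then have "1 < z" using assms g_1 by (cases "z = 1") auto
  then show "1 < subsonic w" "g (subsonic w) = w"
    using subsonic_g \<open>g z = w\<close> by auto
qed

lemma supersonic:
  assumes "1 / k < w"
  shows "0 < supersonic w" "supersonic w < 1" "g (supersonic w) = w"
proof -
  define Z where "Z = min (1 / 2) (1 / sqrt (2 * w))"
  have w: "0 < w" using assms k_pos by (meson divide_pos_pos less_trans zero_less_one)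
  have "Z \<le> 1 / 2" by (simp add: Z_def)
  then have Z: "0 < Z" "Z < 1" using w by (auto simp: Z_def)
  have "Z\<^sup>2 \<le> (1 / sqrt (2 * w))\<^sup>2"
    using Z by (intro power_mono) (auto simp: Z_def)
  also have "\<dots> = 1 / (2 * w)" using w by (simp add: power_divide)
  finally have "w \<le> 1 / (2 * Z\<^sup>2)" using w Z by (simp add: field_simps)
  also have "\<dots> \<le> g Z" using gamma_gt_1 by (simp add: g_def)
  finally have "\<exists>z\<ge>Z. z \<le> 1 \<and> g z = w"
    using assms Z by (intro IVT2') (auto simp: g_1 intro: g_cont)
  then obtain z where z: "Z \<le> z" "z \<le> 1" "g z = w" by auto
  then have "z < 1" using assms g_1 by (cases "z = 1") auto
  then show "0 < supersonic w" "supersonic w < 1" "g (supersonic w) = w"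
    using supersonic_g[of z] z Z by auto
qed

text \<open>The common properties of the two inverses of \<open>g\<close> above its minimum, on which the
  reduction of the Euler-Poisson system rests.\<close>

definition branch :: "(real \<Rightarrow> real) \<Rightarrow> bool" where
  "branch h \<longleftrightarrow> (\<forall>w>1 / k. 0 < h w \<and> h w \<noteq> 1 \<and> g (h w) = w
     \<and> (h has_real_derivative 1 / g' (h w)) (at w))"

lemma inverse_branch:
  assumes "open S" "S \<subseteq> {0<..} - {1}"
    and S: "\<And>w. 1 / k < w \<Longrightarrow> h w \<in> S \<and> g (h w) = w"
    and inv: "\<And>z. z \<in> S \<Longrightarrow> h (g z) = z"
  shows "branch h"
proof -
  have "(h has_real_derivative 1 / g' (h w)) (at w)" if w: "1 / k < w" for w
  proof -
    obtain d where d: "0 < d" "cball (h w) d \<subseteq> S"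
      using S[OF w] \<open>open S\<close> open_contains_cball by blast
    have ball: "z \<in> S" if "\<bar>z - h w\<bar> \<le> d" for z
      using d that by (auto simp: subset_iff dist_real_def abs_minus_commute)
    have "isCont h (g (h w))"
    proof (rule isCont_inverse_function[where f = g and x = "h w", OF d(1)])
      fix z assume "\<bar>z - h w\<bar> \<le> d"
      then have "z \<in> S" by (rule ball)
      then show "h (g z) = z" by (rule inv)
      show "isCont g z"
        using g_deriv[of z] \<open>z \<in> S\<close> assms(2) DERIV_isCont by blast
    qed
    then have "isCont h w" using S[OF w] by simp
    moreover have "0 < h w" "h w \<noteq> 1" using S[OF w] assms(2) by auto
    ultimately have "(h has_real_derivative inverse (g' (h w))) (at w)"
      using g'_pos_iff[of "h w"] g'_neg_iff[of "h w"] S w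
      by (intro DERIV_inverse_function[where f = g and a = "1 / k" and b = "w + 1"] g_deriv) auto
    then show ?thesis by (simp add: inverse_eq_divide)
  qed
  then show ?thesis
    using S assms(2) by (auto simp: branch_def)
qed

lemma branch_subsonic: "branch subsonic"
  by (rule inverse_branch[of "{1<..}"]) (use subsonic subsonic_g in auto)

lemma branch_supersonic: "branch supersonic"
  by (rule inverse_branch[of "{0<..<1}"]) (use supersonic supersonic_g in auto)

lemma branchD:
  assumes "branch h" "1 / k < w"
  shows "0 < h w" "h w \<noteq> 1" "g (h w) = w" "(h has_real_derivative 1 / g' (h w)) (at w)"
  using assms by (auto simp: branch_def)

lemma branch_cont: "branch h \<Longrightarrow> S \<subseteq> {1 / k<..} \<Longrightarrow> continuous_on S h"
  by (rule DERIV_continuous_on[where D = "\<lambda>w. 1 / g' (h w)"])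
    (auto intro!: DERIV_subset[OF branchD(4)])

lemma g'_cont: "S \<subseteq> {0<..} \<Longrightarrow> continuous_on S g'"
  unfolding g'_def by (intro continuous_intros) auto

lemma branch_deriv_cont:
  assumes "branch h" "S \<subseteq> {1 / k<..}"
  shows "continuous_on S (\<lambda>w. 1 / g' (h w))"
proof -
  have "continuous_on S (\<lambda>w. g' (h w))"
    by (rule continuous_on_compose2[OF g'_cont branch_cont[OF assms], of "{0<..}"])
      (use assms branchD(1) in auto)
  moreover have "g' (h w) \<noteq> 0" if "w \<in> S" for w
  proof -
    have "0 < h w" "h w \<noteq> 1" using branchD[OF assms(1)] assms(2) that by auto
    then show ?thesis using g'_pos_iff[of "h w"] g'_neg_iff[of "h w"] by linarith
  qed
  ultimately show ?thesis by (intro continuous_intros) auto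
qed

lemma critical_speed_pos: "0 < a \<Longrightarrow> 0 < x \<Longrightarrow> 0 < critical_speed a x"
  by (simp add: critical_speed_def)

lemma critical_speed_sq: "0 < a \<Longrightarrow> 0 < x \<Longrightarrow> (critical_speed a x)\<^sup>2 = a / x powr k"
proof -
  assume "0 < a" "0 < x"
  have "(x powr (- (k / 2)))\<^sup>2 = x powr (- k)"
    by (subst powr_power) (use \<open>0 < x\<close> in auto)
  then show ?thesis
    unfolding critical_speed_def power_mult_distrib
    using \<open>0 < a\<close> by (simp add: powr_minus_divide)
qed

lemma gas_state_pos:
  assumes "0 < J" "0 < a" "0 < x" "0 < z"
  shows "0 < rho (gas_state J a x z e)" "0 < vel (gas_state J a x z e)"
    "0 < pres (gas_state J a x z e)"
  using assms critical_speed_pos[of a x] gamma_gt_1 by (auto simp: gas_state_def Let_def)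

lemma elec_gas_state [simp]: "elec (gas_state J a x z e) = e"
  by (simp add: gas_state_def Let_def)

lemma flux_gas_state:
  assumes "0 < J" "0 < a" "0 < x" "0 < z"
  shows "x * rho (gas_state J a x z e) * vel (gas_state J a x z e) = J"
  using assms critical_speed_pos[of a x] by (simp add: gas_state_def Let_def)

lemma sound_speed_gas_state:
  assumes "0 < J" "0 < a" "0 < x" "0 < z"
  shows "\<gamma> * pres (gas_state J a x z e) / rho (gas_state J a x z e)
    = (critical_speed a x)\<^sup>2 * z powr (\<gamma> - 1)"
proof -
  have "z powr \<gamma> = z powr (\<gamma> - 1) * z"
    using assms by (simp add: powr_diff)
  then show ?thesis
    using assms critical_speed_pos[of a x] gamma_gt_1
    by (simp add: gas_state_def Let_def power2_eq_square field_simps)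
qed

lemma mach_gas_state:
  assumes "0 < J" "0 < a" "0 < x" "0 < z"
  shows "mach \<gamma> (gas_state J a x z e) = z powr (- ((\<gamma> + 1) / 2))"
proof -
  let ?c = "critical_speed a x"
  have c: "0 < ?c" using critical_speed_pos assms by simp
  have "sqrt (?c\<^sup>2 * z powr (\<gamma> - 1)) = ?c * z powr ((\<gamma> - 1) / 2)"
    using c assms by (simp add: real_sqrt_mult powr_half_sqrt[symmetric] powr_powr)
  then have "mach \<gamma> (gas_state J a x z e) = (?c / z) / (?c * z powr ((\<gamma> - 1) / 2))"
    unfolding mach_def sound_speed_gas_state[OF assms] by (simp add: gas_state_def Let_def)
  also have "\<dots> = 1 / (z * z powr ((\<gamma> - 1) / 2))" using c by simp
  also have "z * z powr ((\<gamma> - 1) / 2) = z powr ((\<gamma> + 1) / 2)"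
    using assms powr_add[of z 1 "(\<gamma> - 1) / 2"] by (simp add: field_simps)
  finally show ?thesis by (simp only: powr_minus_divide)
qed

lemma mach_gas_state_iff:
  assumes "0 < J" "0 < a" "0 < x" "0 < z"
  shows "mach \<gamma> (gas_state J a x z e) < 1 \<longleftrightarrow> 1 < z"
    and "1 < mach \<gamma> (gas_state J a x z e) \<longleftrightarrow> z < 1"
proof -
  define m where "m = z powr ((\<gamma> + 1) / 2)"
  have m: "0 < m" "m < 1 \<longleftrightarrow> z < 1" "1 < m \<longleftrightarrow> 1 < z"
    using assms(4) gamma_gt_1 powr_less_one_iff[of "(\<gamma> + 1) / 2" z]
      one_less_powr_iff[of "(\<gamma> + 1) / 2" z] by (auto simp: m_def)
  have "mach \<gamma> (gas_state J a x z e) = 1 / m"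
    unfolding mach_gas_state[OF assms] m_def by (rule powr_minus_divide)
  then show "mach \<gamma> (gas_state J a x z e) < 1 \<longleftrightarrow> 1 < z"
    "1 < mach \<gamma> (gas_state J a x z e) \<longleftrightarrow> z < 1"
    using m by simp_all
qed

lemma bernoulli_gas_state:
  assumes "0 < J" "0 < a" "0 < x" "0 < z"
  shows "bernoulli \<gamma> (gas_state J a x z e) = a / x powr k * g z"
proof -
  have "bernoulli \<gamma> s = (vel s)\<^sup>2 / 2 + (\<gamma> * pres s / rho s) / (\<gamma> - 1)" for s
    by (simp add: bernoulli_def)
  moreover have "vel (gas_state J a x z e) = critical_speed a x / z"
    by (simp add: gas_state_def Let_def)
  ultimately have "bernoulli \<gamma> (gas_state J a x z e) =
      (critical_speed a x / z)\<^sup>2 / 2 + (critical_speed a x)\<^sup>2 * z powr (\<gamma> - 1) / (\<gamma> - 1)"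
    by (simp only: sound_speed_gas_state[OF assms])
  also have "\<dots> = (critical_speed a x)\<^sup>2 * g z"
    by (simp add: g_def power_divide distrib_left)
  finally show ?thesis
    unfolding critical_speed_sq[OF assms(2,3)] .
qed

text \<open>The coordinate \<open>z\<close> of a given state: the power \<open>- 2 / (\<gamma> + 1)\<close> of the Mach number.\<close>

definition zed :: "flow_state \<Rightarrow> real" where
  "zed s = (\<gamma> * pres s / (rho s * (vel s)\<^sup>2)) powr (1 / (\<gamma> + 1))"

text \<open>The coordinate \<open>a\<close> of a given state at radius \<open>x\<close>.\<close>

definition invariant :: "real \<Rightarrow> flow_state \<Rightarrow> real" where
  "invariant x s = (vel s * zed s)\<^sup>2 * x powr k"

lemma gas_state_complete:
  assumes "0 < x" "0 < rho s" "0 < vel s" "0 < pres s"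
  shows "s = gas_state (x * rho s * vel s) (invariant x s) x (zed s) (elec s)"
    and "0 < zed s" "0 < invariant x s"
proof -
  show z: "0 < zed s" using assms gamma_gt_1 by (simp add: zed_def)
  show "0 < invariant x s" using z assms by (simp add: invariant_def)
  have c: "critical_speed (invariant x s) x = vel s * zed s"
    using assms z by (simp add: critical_speed_def invariant_def real_sqrt_mult
        powr_half_sqrt[symmetric] powr_powr flip: powr_add)
  have "zed s powr (\<gamma> + 1) = \<gamma> * pres s / (rho s * (vel s)\<^sup>2)"
    using assms gamma_gt_1 by (simp add: zed_def powr_powr)
  then have "zed s * zed s powr \<gamma> = \<gamma> * pres s / (rho s * (vel s)\<^sup>2)"
    using z by (simp add: powr_add mult.commute)
  then have "x * rho s * vel s * (vel s * zed s) * zed s powr \<gamma> / (\<gamma> * x) = pres s"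
    using assms gamma_gt_1 by (simp add: field_simps power2_eq_square)
  then show "s = gas_state (x * rho s * vel s) (invariant x s) x (zed s) (elec s)"
    using assms z by (intro flow_state.equality) (auto simp: gas_state_def Let_def c)
qed

text \<open>The right-hand side contains only the flux and the entropy; hence \<open>a\<close> is constant along
  smooth flow.\<close>

lemma ln_invariant:
  assumes "0 < x" "0 < rho s" "0 < vel s" "0 < pres s"
  shows "(\<gamma> + 1) / 2 * ln (invariant x s)
    = ln \<gamma> + (\<gamma> - 1) * ln (x * rho s * vel s) + (ln (pres s) - \<gamma> * ln (rho s))"
proof -
  have z: "0 < zed s" using gas_state_complete(2)[OF assms] .
  have lz: "(\<gamma> + 1) * ln (zed s) = ln \<gamma> + ln (pres s) - ln (rho s) - 2 * ln (vel s)"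
    using assms gamma_gt_1 by (simp add: zed_def ln_powr ln_div ln_mult ln_realpow)
  have "ln (invariant x s) = 2 * ln (vel s) + 2 * ln (zed s) + k * ln x"
    using assms z by (simp add: invariant_def ln_mult ln_powr ln_realpow)
  then have "(\<gamma> + 1) / 2 * ln (invariant x s)
      = (\<gamma> + 1) * ln (vel s) + (\<gamma> + 1) * ln (zed s) + (\<gamma> - 1) * ln x"
    using gamma_gt_1 by (simp add: k_def field_simps)
  then show ?thesis
    unfolding lz using assms by (simp add: ln_mult algebra_simps)
qed

lemma inj_gas_state_zed:
  assumes "0 < J" "0 < a" "0 < x" "0 < z"
  shows "zed (gas_state J a x z e) = z" "invariant x (gas_state J a x z e) = a"
proof -
  let ?c = "critical_speed a x"
  have c: "0 < ?c" using critical_speed_pos assms by simp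
  have "\<gamma> * pres (gas_state J a x z e) / (rho (gas_state J a x z e) * (vel (gas_state J a x z e))\<^sup>2)
     = z powr \<gamma> * z"
    using assms c gamma_gt_1 by (simp add: gas_state_def Let_def field_simps power2_eq_square)
  also have "\<dots> = z powr (\<gamma> + 1)" using assms by (simp add: powr_add)
  finally show z: "zed (gas_state J a x z e) = z"
    using assms gamma_gt_1 by (simp add: zed_def powr_powr)
  have "vel (gas_state J a x z e) = ?c / z" by (simp add: gas_state_def Let_def)
  then show "invariant x (gas_state J a x z e) = a"
    unfolding invariant_def z using assms critical_speed_sq[OF assms(2,3)] by simp
qed

end

section \<open>Reduction of the Euler-Poisson system to a planar system\<close>

lemma has_real_derivative_cong_on:
  assumes "\<And>s. s \<in> S \<Longrightarrow> f s = h s" "t \<in> S" "(h has_real_derivative D) (at t within S)"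
  shows "(f has_real_derivative D) (at t within S)"
  by (rule has_field_derivative_transform_within[OF assms(3) zero_less_one assms(2)])
    (simp add: assms(1))

lemma has_real_derivative_unique_Icc:
  assumes "s < T" "t \<in> {s..T}"
    and "(f has_real_derivative D) (at t within {s..T})"
    and "(f has_real_derivative D') (at t within {s..T})"
  shows "D = D'"
  by (rule vector_derivative_unique_within_closed_interval[of s T t f])
    (use assms in \<open>auto simp: has_real_derivative_iff_has_vector_derivative\<close>)

lemma C1_on_mult:
  assumes "C1_on S f" "C1_on S h"
  shows "C1_on S (\<lambda>t. f t * h t)"
proof -
  obtain f' h' where f: "continuous_on S f'" "\<And>t. t \<in> S \<Longrightarrow> (f has_real_derivative f' t) (at t within S)"
    and h: "continuous_on S h'" "\<And>t. t \<in> S \<Longrightarrow> (h has_real_derivative h' t) (at t within S)"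
    using assms unfolding C1_on_def by blast
  have "continuous_on S (\<lambda>t. f' t * h t + h' t * f t)"
    by (intro continuous_intros f h DERIV_continuous_on[OF f(2)] DERIV_continuous_on[OF h(2)])
  then show ?thesis
    unfolding C1_on_def using DERIV_mult[OF f(2) h(2)] by blast
qed

lemma C1_on_const: "C1_on S (\<lambda>t. c)"
  unfolding C1_on_def by (rule exI[of _ "\<lambda>_. 0"]) auto

lemma C1_on_powr:
  assumes "C1_on S f" "\<And>t. t \<in> S \<Longrightarrow> 0 < f t"
  shows "C1_on S (\<lambda>t. f t powr p)"
proof -
  obtain f' where f: "continuous_on S f'" "\<And>t. t \<in> S \<Longrightarrow> (f has_real_derivative f' t) (at t within S)"
    using assms unfolding C1_on_def by blast
  have "\<forall>t\<in>S. f t \<noteq> 0" using assms(2) by (metis less_irrefl)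
  then have "continuous_on S (\<lambda>t. p * f t powr (p - 1) * f' t)"
    by (intro continuous_intros f DERIV_continuous_on[OF f(2)])
  then show ?thesis
    unfolding C1_on_def
    using DERIV_chain2[OF has_real_derivative_powr[OF assms(2)] f(2)] by blast
qed

lemma C1_on_cong:
  assumes "\<And>t. t \<in> S \<Longrightarrow> f t = h t" "C1_on S h"
  shows "C1_on S f"
  using assms has_real_derivative_cong_on[of S f h] unfolding C1_on_def by blast

context polytropic_gas
begin

text \<open>The product of radius and density, as a function of the Bernoulli value \<open>B\<close> on the
  branch \<open>h\<close>.\<close>

definition density_source :: "real \<Rightarrow> real \<Rightarrow> (real \<Rightarrow> real) \<Rightarrow> real \<Rightarrow> real \<Rightarrow> real" where
  "density_source J a h x B = J * x powr (k / 2) / sqrt a * h (B * x powr k / a)"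

text \<open>The unknowns are the Bernoulli function \<open>B\<close> and \<open>F = x E\<close>, where \<open>x = r0 - t\<close>.
  Both are continuous across a shock; only the branch \<open>h\<close> and the parameter \<open>a\<close> change there.\<close>

definition reduced_system ::
  "real \<Rightarrow> (real \<Rightarrow> real) \<Rightarrow> real \<Rightarrow> real \<Rightarrow> (real \<Rightarrow> real) \<Rightarrow> real set \<Rightarrow> (real \<Rightarrow> real) \<Rightarrow> (real \<Rightarrow> real) \<Rightarrow> bool"
  where "reduced_system r0 b J a h S B F \<longleftrightarrow> (\<forall>t\<in>S.
    (B has_real_derivative F t / (r0 - t)) (at t within S) \<and>
    (F has_real_derivative density_source J a h (r0 - t) (B t) - (r0 - t) * b t) (at t within S))"

lemma density_source_gas_state:
  assumes "0 < J" "0 < a" "0 < x"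
  shows "x * rho (gas_state J a x (h (B * x powr k / a)) e) = density_source J a h x B"
  using assms by (simp add: gas_state_def Let_def density_source_def critical_speed_def
      powr_minus_divide)

text \<open>With constant flux the energy equation says \<open>B' = E\<close>. Subtracting the momentum
  equation leaves the conservation of \<open>p / \<rho>\<^sup>\<gamma>\<close>, so \<open>a\<close> is constant as well, and \<open>B\<close>
  determines the gas state on each branch.\<close>

theorem EP_solution_reduces:
  assumes "s \<le> T" "T < r0"
    and EP: "EP_solution_on \<gamma> r0 b {s..T} W"
    and pos: "\<And>t. t \<in> {s..T} \<Longrightarrow> 0 < rho (W t) \<and> 0 < vel (W t) \<and> 0 < pres (W t)"
    and J: "J = (r0 - s) * rho (W s) * vel (W s)" and a: "a = invariant (r0 - s) (W s)"
    and h: "\<And>t. t \<in> {s..T} \<Longrightarrow> h (g (zed (W t))) = zed (W t)"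
    and B: "B = (\<lambda>t. bernoulli \<gamma> (W t))" and F: "F = (\<lambda>t. (r0 - t) * elec (W t))"
  shows "reduced_system r0 b J a h {s..T} B F"
    and "\<And>t. t \<in> {s..T} \<Longrightarrow> g (zed (W t)) = B t * (r0 - t) powr k / a"
    and "\<And>t. t \<in> {s..T} \<Longrightarrow>
      W t = gas_state J a (r0 - t) (h (B t * (r0 - t) powr k / a)) (F t / (r0 - t))"
proof -
  let ?S = "{s..T}"
  have x: "0 < r0 - t" if "t \<in> ?S" for t using that \<open>T < r0\<close> by simp
  have sS: "s \<in> ?S" using \<open>s \<le> T\<close> by simp
  have "\<exists>c. \<forall>t\<in>?S. (r0 - t) * rho (W t) * vel (W t) = c"
    using EP by (intro has_field_derivative_zero_constant) (auto simp: EP_solution_on_def)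
  then have flux: "(r0 - t) * rho (W t) * vel (W t) = J" if "t \<in> ?S" for t
    using that sS J by metis
  have "0 < J" using J pos[OF sS] x[OF sS] by simp
  have "((\<lambda>t. 1 / J * ((r0 - t) * rho (W t) * vel (W t) * bernoulli \<gamma> (W t))) has_real_derivative
      1 / J * ((r0 - t) * rho (W t) * vel (W t) * elec (W t))) (at t within ?S)" if "t \<in> ?S" for t
    using EP that by (intro DERIV_cmult) (auto simp: EP_solution_on_def)
  then have B': "(B has_real_derivative elec (W t)) (at t within ?S)" if "t \<in> ?S" for t
    using that \<open>0 < J\<close> unfolding B
    by (intro has_real_derivative_cong_on[where f = "\<lambda>t. bernoulli \<gamma> (W t)" and
        h = "\<lambda>t. 1 / J * ((r0 - t) * rho (W t) * vel (W t) * bernoulli \<gamma> (W t))"])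
      (auto simp: flux)

  have "\<exists>c. \<forall>t\<in>?S. ln (pres (W t)) - \<gamma> * ln (rho (W t)) = c"
  proof (cases "s = T")
    case True then show ?thesis by auto
  next
    case False
    then have "s < T" using \<open>s \<le> T\<close> by simp
    (* Away from one-point intervals derivatives are unique, so the equations can be compared.
       *)
    show ?thesis
    proof (rule has_field_derivative_zero_constant)
      fix t assume t: "t \<in> ?S"
      obtain r' u' p' where r: "((\<lambda>t. rho (W t)) has_real_derivative r') (at t within ?S)"
        and u: "((\<lambda>t. vel (W t)) has_real_derivative u') (at t within ?S)"
        and p: "((\<lambda>t. pres (W t)) has_real_derivative p') (at t within ?S)"
        using EP t unfolding EP_solution_on_def C1_on_def by blast
      obtain q1 p1 where q1: "((\<lambda>s. (r0 - s) * rho (W s) * (vel (W s))\<^sup>2) has_real_derivative q1) (at t within ?S)"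
        and p1: "((\<lambda>s. pres (W s)) has_real_derivative p1) (at t within ?S)"
        and mom: "q1 + (r0 - t) * p1 = (r0 - t) * rho (W t) * elec (W t)"
        using EP t unfolding EP_solution_on_def by blast
      have "p1 = p'"
        by (rule has_real_derivative_unique_Icc[OF \<open>s < T\<close> t p1 p])
      have "((\<lambda>s. J * vel (W s)) has_real_derivative q1) (at t within ?S)"
        by (rule has_real_derivative_cong_on[OF _ t q1])
          (use flux in \<open>simp add: power2_eq_square mult.assoc\<close>)
      then have "q1 = J * u'"
        using has_real_derivative_unique_Icc[OF \<open>s < T\<close> t _ DERIV_cmult[OF u, of J]] by auto
      have "(r0 - t) * (rho (W t) * vel (W t) * u' + p') = (r0 - t) * (rho (W t) * elec (W t))"
        using mom unfolding \<open>q1 = J * u'\<close> \<open>p1 = p'\<close> flux[OF t, symmetric] by (simp add: algebra_simps)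
      then have mom': "rho (W t) * vel (W t) * u' + p' = rho (W t) * elec (W t)"
        using x[OF t] by simp
      have "((\<lambda>t. (vel (W t))\<^sup>2 / 2 + \<gamma> * pres (W t) / ((\<gamma> - 1) * rho (W t))) has_real_derivative
          vel (W t) * u' + \<gamma> / (\<gamma> - 1) * ((p' * rho (W t) - pres (W t) * r') / (rho (W t))\<^sup>2)) (at t within ?S)"
      proof -
        have "((\<lambda>t. (vel (W t))\<^sup>2 / 2) has_real_derivative vel (W t) * u') (at t within ?S)"
          by (auto intro!: derivative_eq_intros u)
        moreover have "((\<lambda>t. \<gamma> / (\<gamma> - 1) * (pres (W t) / rho (W t))) has_real_derivative
            \<gamma> / (\<gamma> - 1) * ((p' * rho (W t) - pres (W t) * r') / (rho (W t))\<^sup>2)) (at t within ?S)"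
          unfolding power2_eq_square using pos[OF t] by (intro DERIV_cmult DERIV_divide r p) auto
        ultimately show ?thesis by (simp add: DERIV_add)
      qed
      then have "elec (W t) = vel (W t) * u' + \<gamma> / (\<gamma> - 1) * ((p' * rho (W t) - pres (W t) * r') / (rho (W t))\<^sup>2)"
        using has_real_derivative_unique_Icc[OF \<open>s < T\<close> t B'[OF t]] by (simp add: B bernoulli_def)
      then have "rho (W t) * vel (W t) * u' + p'
          = rho (W t) * (vel (W t) * u' + \<gamma> / (\<gamma> - 1) * ((p' * rho (W t) - pres (W t) * r') / (rho (W t))\<^sup>2))"
        using mom' by simp
      then have "(\<gamma> - 1) * p' * rho (W t) = \<gamma> * (p' * rho (W t) - pres (W t) * r')"
        using pos[OF t] gamma_gt_1 by (simp add: field_simps power2_eq_square)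
      then have "p' * rho (W t) = \<gamma> * pres (W t) * r'" by (simp add: algebra_simps)
      then have "p' / pres (W t) - \<gamma> * (r' / rho (W t)) = 0"
        using pos[OF t] by (simp add: field_simps)
      moreover have "((\<lambda>t. ln (pres (W t)) - \<gamma> * ln (rho (W t))) has_real_derivative
          p' / pres (W t) - \<gamma> * (r' / rho (W t))) (at t within ?S)"
        using pos[OF t] by (auto intro!: derivative_eq_intros r p simp: field_simps)
      ultimately show "((\<lambda>t. ln (pres (W t)) - \<gamma> * ln (rho (W t))) has_real_derivative 0) (at t within ?S)"
        by simp
    qed simp
  qed
  then have entropy: "ln (pres (W t)) - \<gamma> * ln (rho (W t)) = ln (pres (W s)) - \<gamma> * ln (rho (W s))"
    if "t \<in> ?S" for t using that sS by metis
  have "0 < a" unfolding a using gas_state_complete(3) x[OF sS] pos[OF sS] by blast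
  have inv: "invariant (r0 - t) (W t) = a" if t: "t \<in> ?S" for t
  proof -
    have "(\<gamma> + 1) / 2 * ln (invariant (r0 - t) (W t)) = (\<gamma> + 1) / 2 * ln (invariant (r0 - s) (W s))"
      using pos[OF t] pos[OF sS] x[OF t] x[OF sS]
      by (simp only: ln_invariant flux[OF t] flux[OF sS] entropy[OF t])
    then have "ln (invariant (r0 - t) (W t)) = ln a"
      using gamma_gt_1 by (simp add: a)
    then show ?thesis
      using \<open>0 < a\<close> gas_state_complete(3)[OF x[OF t], of "W t"] pos[OF t] by simp
  qed
  have state: "W t = gas_state J a (r0 - t) (zed (W t)) (elec (W t))" "0 < zed (W t)"
    if t: "t \<in> ?S" for t
    using gas_state_complete(1,2)[OF x[OF t], of "W t"] pos[OF t] flux[OF t] inv[OF t] by auto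
  show w: "g (zed (W t)) = B t * (r0 - t) powr k / a" if t: "t \<in> ?S" for t
  proof -
    have "B t = a / (r0 - t) powr k * g (zed (W t))"
      using bernoulli_gas_state[OF \<open>0 < J\<close> \<open>0 < a\<close> x[OF t] state(2)[OF t], of "elec (W t)"]
      by (simp add: B state(1)[OF t, symmetric])
    then show ?thesis using \<open>0 < a\<close> x[OF t] by (simp add: field_simps)
  qed
  show st: "W t = gas_state J a (r0 - t) (h (B t * (r0 - t) powr k / a)) (F t / (r0 - t))"
    if t: "t \<in> ?S" for t
    using state(1)[OF t] h[OF t] w[OF t] x[OF t] by (simp add: F)
  show "reduced_system r0 b J a h ?S B F"
    unfolding reduced_system_def
  proof (intro ballI conjI)
    fix t assume t: "t \<in> ?S"
    show "(B has_real_derivative F t / (r0 - t)) (at t within ?S)"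
      using B'[OF t] x[OF t] by (simp add: F)
    have "(r0 - t) * rho (W t) = density_source J a h (r0 - t) (B t)"
      using density_source_gas_state[OF \<open>0 < J\<close> \<open>0 < a\<close> x[OF t], of h "B t" "F t / (r0 - t)"]
      by (simp only: st[OF t, symmetric])
    moreover have "(F has_real_derivative (r0 - t) * (rho (W t) - b t)) (at t within ?S)"
      using EP t by (auto simp: EP_solution_on_def F)
    ultimately show "(F has_real_derivative density_source J a h (r0 - t) (B t) - (r0 - t) * b t) (at t within ?S)"
      by (simp add: algebra_simps)
  qed
qed

lemma gas_state_powr:
  assumes "0 < a" "0 < x" "0 < z"
  shows "rho (gas_state J a x z e) = J / sqrt a * (z * x powr (k / 2 - 1))"
    and "vel (gas_state J a x z e) = sqrt a * (x powr (- (k / 2)) * z powr (- 1))"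
    and "pres (gas_state J a x z e) = J * sqrt a / \<gamma> * (x powr (- (k / 2) - 1) * z powr \<gamma>)"
proof -
  define P where "P = x powr (k / 2)"
  have P: "0 < P" using assms by (simp add: P_def)
  have e: "x powr (k / 2 - 1) = P / x" "x powr (- (k / 2)) = 1 / P"
    "x powr (- (k / 2) - 1) = 1 / (P * x)" "z powr (- 1) = 1 / z"
    using assms by (simp_all add: P_def powr_diff powr_minus_divide)
  show "rho (gas_state J a x z e) = J / sqrt a * (z * x powr (k / 2 - 1))"
    "vel (gas_state J a x z e) = sqrt a * (x powr (- (k / 2)) * z powr (- 1))"
    "pres (gas_state J a x z e) = J * sqrt a / \<gamma> * (x powr (- (k / 2) - 1) * z powr \<gamma>)"
    unfolding e gas_state_def Let_def critical_speed_def
    using assms P by (simp_all add: mult_ac)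
qed

text \<open>The distance from the sonic state is measured by \<open>w = B x\<^sup>k / a\<close>, which equals
  \<open>1 / k\<close> at the sonic state: a flow with \<open>F > k B\<close> moves away from it, on either
  branch.\<close>

lemma scaled_bernoulli_derivative:
  assumes "t < r0" and B: "(B has_real_derivative F / (r0 - t)) (at t within S)"
  shows "((\<lambda>t. B t * (r0 - t) powr k / a) has_real_derivative
    (r0 - t) powr (k - 1) * (F - k * B t) / a) (at t within S)"
proof -
  define X where "X = r0 - t"
  have X: "0 < X" using \<open>t < r0\<close> by (simp add: X_def)
  have "((\<lambda>t. r0 - t) has_real_derivative - 1) (at t within S)"
    by (auto intro!: derivative_eq_intros)
  from DERIV_chain2[OF has_real_derivative_powr[OF X[unfolded X_def]] this, of k]
  have xp: "((\<lambda>t. (r0 - t) powr k) has_real_derivative - (k * X powr (k - 1))) (at t within S)"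
    by (simp add: X_def)
  have "X powr k = X powr (k - 1) * X" using X by (simp add: powr_diff)
  then have "(F / X * X powr k + - (k * X powr (k - 1)) * B t) / a = X powr (k - 1) * (F - k * B t) / a"
    using X by (simp add: algebra_simps)
  then show ?thesis
    using DERIV_cong[OF DERIV_cdivide[OF DERIV_mult[OF B xp], of a]] by (simp only: X_def)
qed

text \<open>The energy equation is the equation for \<open>B\<close>. Since \<open>a\<close> is constant, the momentum
  equation is an algebraic consequence of it, once the derivatives of velocity and pressure
  are expressed by \<open>z\<close> and its derivative.\<close>

theorem EP_solution_from_reduced:
  assumes "T < r0" "0 < J" "0 < a" and h: "branch h"
    and red: "reduced_system r0 b J a h {s..T} B F"
    and range: "\<And>t. t \<in> {s..T} \<Longrightarrow> 1 / k < B t * (r0 - t) powr k / a"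
    and b: "continuous_on {s..T} b"
    and W: "W = (\<lambda>t. gas_state J a (r0 - t) (h (B t * (r0 - t) powr k / a)) (F t / (r0 - t)))"
  shows "EP_solution_on \<gamma> r0 b {s..T} W"
proof -
  let ?S = "{s..T}"
  define w where "w t = B t * (r0 - t) powr k / a" for t
  define z where "z t = h (w t)" for t
  have x: "0 < r0 - t" if "t \<in> ?S" for t using that \<open>T < r0\<close> by simp
  have z: "0 < z t" "z t \<noteq> 1" "g (z t) = w t" if "t \<in> ?S" for t
    using branchD[OF h range[OF that]] by (auto simp: z_def w_def)
  have W: "W t = gas_state J a (r0 - t) (z t) (F t / (r0 - t))" for t
    by (simp add: W z_def w_def)
  have B': "(B has_real_derivative F t / (r0 - t)) (at t within ?S)"
    and F': "(F has_real_derivative density_source J a h (r0 - t) (B t) - (r0 - t) * b t) (at t within ?S)"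
    if "t \<in> ?S" for t
    using red that by (auto simp: reduced_system_def)
  have x': "((\<lambda>t. r0 - t) has_real_derivative - 1) (at t within ?S)" for t
    by (auto intro!: derivative_eq_intros)
  have xp: "((\<lambda>t. (r0 - t) powr p) has_real_derivative - (p * (r0 - t) powr (p - 1))) (at t within ?S)"
    if "t \<in> ?S" for t p
    using DERIV_chain2[OF has_real_derivative_powr[OF x[OF that]] x', of p] by simp
  define w' where "w' t = (r0 - t) powr (k - 1) * (F t - k * B t) / a" for t
  have w': "(w has_real_derivative w' t) (at t within ?S)" if t: "t \<in> ?S" for t
    unfolding w_def[abs_def] w'_def
    by (rule scaled_bernoulli_derivative[OF _ B'[OF t]]) (use x[OF t] in simp)
  define z' where "z' t = w' t / g' (z t)" for t
  have z': "(z has_real_derivative z' t) (at t within ?S)" if t: "t \<in> ?S" for t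
    using DERIV_chain2[OF branchD(4)[OF h range[OF t], folded w_def] w'[OF t]]
    by (simp add: z_def[abs_def] z'_def)
  have g'z: "g' (z t) \<noteq> 0" if t: "t \<in> ?S" for t
    using g'_pos_iff[OF z(1)[OF t]] g'_neg_iff[OF z(1)[OF t]] z(2)[OF t] by linarith
  have Bcont: "continuous_on ?S B" and Fcont: "continuous_on ?S F" and zcont: "continuous_on ?S z"
    using DERIV_continuous_on[OF B'] DERIV_continuous_on[OF F'] DERIV_continuous_on[OF z'] by auto
  have xpcont: "continuous_on ?S (\<lambda>t. (r0 - t) powr p)" for p
    using x by (intro continuous_intros) fastforce
  have "continuous_on ?S w'"
    unfolding w'_def using \<open>0 < a\<close> by (intro continuous_intros Bcont Fcont xpcont) auto
  moreover have "continuous_on ?S (\<lambda>t. g' (z t))"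
    by (rule continuous_on_compose2[OF g'_cont zcont, of "{0<..}"]) (use z in auto)
  ultimately have "continuous_on ?S z'"
    unfolding z'_def using g'z by (intro continuous_intros) auto
  then have zC1: "C1_on ?S z" unfolding C1_on_def using z' by blast
  have xC1: "C1_on ?S (\<lambda>t. r0 - t)"
    unfolding C1_on_def using x' by (intro exI[of _ "\<lambda>_. - 1"]) auto
  have source_eq: "density_source J a h (r0 - t) (B t) = J / sqrt a * ((r0 - t) powr (k / 2) * z t)" for t
    by (simp add: density_source_def z_def w_def)
  have "continuous_on ?S (\<lambda>t. density_source J a h (r0 - t) (B t) - (r0 - t) * b t)"
    unfolding source_eq using \<open>0 < a\<close> by (intro continuous_intros xpcont zcont b) auto
  then have FC1: "C1_on ?S F" unfolding C1_on_def using F' by blast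
  have rhoW: "rho (W t) = J / sqrt a * (z t * (r0 - t) powr (k / 2 - 1))"
    and velW: "vel (W t) = sqrt a * ((r0 - t) powr (- (k / 2)) * z t powr (- 1))"
    and presW: "pres (W t) = J * sqrt a / \<gamma> * ((r0 - t) powr (- (k / 2) - 1) * z t powr \<gamma>)"
    and elecW: "elec (W t) = F t * (r0 - t) powr (- 1)" if t: "t \<in> ?S" for t
    unfolding W gas_state_powr[OF \<open>0 < a\<close> x[OF t] z(1)[OF t]] elec_gas_state
    using x[OF t] by (simp_all add: powr_minus_divide)
  have xpC1: "C1_on ?S (\<lambda>t. (r0 - t) powr p)" for p
    by (rule C1_on_powr[OF xC1]) (rule x)
  have zpC1: "C1_on ?S (\<lambda>t. z t powr p)" for p
    by (rule C1_on_powr[OF zC1]) (rule z(1))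
  have C1: "C1_on ?S (\<lambda>t. rho (W t))" "C1_on ?S (\<lambda>t. vel (W t))" "C1_on ?S (\<lambda>t. pres (W t))"
      "C1_on ?S (\<lambda>t. elec (W t))"
    by (rule C1_on_cong, erule rhoW velW presW elecW,
        intro C1_on_mult C1_on_const zC1 FC1 xpC1 zpC1)+
  have flux: "(r0 - t) * rho (W t) * vel (W t) = J" if t: "t \<in> ?S" for t
    unfolding W by (rule flux_gas_state[OF \<open>0 < J\<close> \<open>0 < a\<close> x[OF t] z(1)[OF t]])
  have bern: "bernoulli \<gamma> (W t) = B t" if t: "t \<in> ?S" for t
    unfolding W bernoulli_gas_state[OF \<open>0 < J\<close> \<open>0 < a\<close> x[OF t] z(1)[OF t]] z(3)[OF t]
    using \<open>0 < a\<close> x[OF t] by (simp add: w_def)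
  have elec: "elec (W t) = F t / (r0 - t)" for t by (simp add: W)
  show ?thesis
    unfolding EP_solution_on_def
  proof (intro conjI ballI C1)
    fix t assume t: "t \<in> ?S"
    show "((\<lambda>s. (r0 - s) * rho (W s) * vel (W s)) has_real_derivative 0) (at t within ?S)"
      by (rule has_real_derivative_cong_on[OF flux t DERIV_const])
    have "((\<lambda>s. J * B s) has_real_derivative J * (F t / (r0 - t))) (at t within ?S)"
      by (rule DERIV_cmult[OF B'[OF t]])
    then show "((\<lambda>s. (r0 - s) * rho (W s) * vel (W s) * bernoulli \<gamma> (W s)) has_real_derivative
        (r0 - t) * rho (W t) * vel (W t) * elec (W t)) (at t within ?S)"
      unfolding elec flux[OF t]
      by (rule has_real_derivative_cong_on[OF _ t, rotated]) (simp add: flux bern)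
    have "(r0 - t) * rho (W t) = density_source J a h (r0 - t) (B t)"
      unfolding W using density_source_gas_state[OF \<open>0 < J\<close> \<open>0 < a\<close> x[OF t], of h "B t"]
      by (simp add: z_def w_def)
    then have "(F has_real_derivative (r0 - t) * (rho (W t) - b t)) (at t within ?S)"
      using F'[OF t] by (simp add: right_diff_distrib)
    then show "((\<lambda>s. (r0 - s) * elec (W s)) has_real_derivative (r0 - t) * (rho (W t) - b t)) (at t within ?S)"
      by (rule has_real_derivative_cong_on[OF _ t, rotated]) (use x in \<open>force simp: elec\<close>)
    define X c where "X = r0 - t" and "c = critical_speed a X"
    have X: "0 < X" using x[OF t] by (simp add: X_def)
    have c: "0 < c" "c = sqrt a * X powr (- (k / 2))"
      using critical_speed_pos[OF \<open>0 < a\<close> X] by (auto simp: c_def critical_speed_def)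
    have zt: "0 < z t" by (rule z(1)[OF t])
    define u' where "u' = k / 2 * c / (X * z t) - c * z' t / (z t)\<^sup>2"
    define p' where "p' = J * c * z t powr \<gamma> / (\<gamma> * X) * (k / (2 * X) + 1 / X + \<gamma> * z' t / z t)"
    define P where "P = X powr (- (k / 2))"
    have c': "c = sqrt a * P" by (simp add: c(2) P_def)
    have zp: "((\<lambda>t. z t powr p) has_real_derivative p * (z t powr p / z t) * z' t) (at t within ?S)" for p
      using DERIV_chain2[OF has_real_derivative_powr[OF zt] z'[OF t], of p] zt by (simp add: powr_diff)
    have Xp: "((\<lambda>t. (r0 - t) powr p) has_real_derivative - (p * (X powr p / X))) (at t within ?S)" for p
      using xp[OF t, of p] X by (simp add: powr_diff X_def)
    have "sqrt a * (- (- (k / 2) * (X powr - (k / 2) / X)) * z t powr - 1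
        + - 1 * (z t powr - 1 / z t) * z' t * (r0 - t) powr - (k / 2)) = u'"
    proof -
      have "z t powr (- 1) = 1 / z t" using zt by (simp add: powr_minus_divide)
      then show ?thesis
        unfolding u'_def c' X_def[symmetric] P_def[symmetric] using X zt
        by (simp add: field_simps power2_eq_square)
    qed
    from DERIV_cong[OF DERIV_cmult[OF DERIV_mult[OF Xp[of "- (k / 2)"] zp[of "- 1"]], of "sqrt a"] this]
    have "((\<lambda>t. sqrt a * ((r0 - t) powr (- (k / 2)) * z t powr (- 1))) has_real_derivative u') (at t within ?S)" .
    then have vel': "((\<lambda>s. vel (W s)) has_real_derivative u') (at t within ?S)"
      by (rule has_real_derivative_cong_on[OF _ t, rotated]) (simp only: velW)
    have "J * sqrt a / \<gamma> * (- ((- (k / 2) - 1) * (X powr (- (k / 2) - 1) / X)) * z t powr \<gamma>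
        + \<gamma> * (z t powr \<gamma> / z t) * z' t * (r0 - t) powr (- (k / 2) - 1)) = p'"
    proof -
      have "X powr (- (k / 2) - 1) = P / X" using X by (simp add: P_def powr_diff)
      show ?thesis
        unfolding p'_def c' X_def[symmetric] \<open>X powr (- (k / 2) - 1) = P / X\<close> using X zt gamma_gt_1
        by (simp add: field_simps power2_eq_square)
    qed
    from DERIV_cong[OF DERIV_cmult[OF DERIV_mult[OF Xp[of "- (k / 2) - 1"] zp[of \<gamma>]], of "J * sqrt a / \<gamma>"] this]
    have "((\<lambda>t. J * sqrt a / \<gamma> * ((r0 - t) powr (- (k / 2) - 1) * z t powr \<gamma>)) has_real_derivative p') (at t within ?S)" .
    then have pres': "((\<lambda>s. pres (W s)) has_real_derivative p') (at t within ?S)"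
      by (rule has_real_derivative_cong_on[OF _ t, rotated]) (simp only: presW)
    show "\<exists>q' p'.
           ((\<lambda>s. (r0 - s) * rho (W s) * (vel (W s))\<^sup>2) has_real_derivative q') (at t within ?S) \<and>
           ((\<lambda>s. pres (W s)) has_real_derivative p') (at t within ?S) \<and>
           q' + (r0 - t) * p' = (r0 - t) * rho (W t) * elec (W t)"
    proof (intro exI conjI)
      show "((\<lambda>s. pres (W s)) has_real_derivative p') (at t within ?S)" by (rule pres')
      show "((\<lambda>s. (r0 - s) * rho (W s) * (vel (W s))\<^sup>2) has_real_derivative J * u') (at t within ?S)"
        by (rule has_real_derivative_cong_on[OF _ t DERIV_cmult[OF vel']])
          (simp add: power2_eq_square flux flip: mult.assoc)
      define E where "E = F t / X"
      have csq: "c\<^sup>2 = a / X powr k"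
        unfolding c_def by (rule critical_speed_sq[OF \<open>0 < a\<close> X])
      have "c\<^sup>2 * (g' (z t) * z' t) = c\<^sup>2 * w' t"
        using g'z[OF t] by (simp add: z'_def)
      also have "\<dots> = E - k * B t / X"
        using X \<open>0 < a\<close> unfolding csq w'_def E_def
        by (simp add: X_def[symmetric] powr_diff field_simps)
      also have "B t = c\<^sup>2 * g (z t)"
        unfolding csq z(3)[OF t] using X \<open>0 < a\<close> by (simp add: w_def X_def[symmetric])
      finally have E: "E = c\<^sup>2 * (k * g (z t) / X + g' (z t) * z' t)" by (simp add: algebra_simps)
      have "J * u' + X * p' = J * z t / c * E"
      proof -
        define Z where "Z = z t powr \<gamma>"
        have g: "g (z t) = 1 / (2 * (z t)\<^sup>2) + Z / (z t * (\<gamma> - 1))"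
          using zt by (simp add: g_def Z_def powr_diff field_simps)
        have g': "g' (z t) = (Z * z t - 1) / z t ^ 3"
          using zt by (simp add: g'_def Z_def powr_add)
        have "k + 2 = 2 / (\<gamma> + 1) * (2 * \<gamma>)" "k = 2 / (\<gamma> + 1) * (\<gamma> - 1)"
          using gamma_gt_1 by (simp_all add: k_def field_simps)
        then have kk: "(k + 2) / (2 * \<gamma>) = k / (\<gamma> - 1)"
          using gamma_gt_1 by (metis nonzero_mult_div_cancel_right diff_gt_0_iff_gt less_irrefl
              mult_pos_pos zero_less_numeral less_trans zero_less_one)
        have "J * u' + X * p' = J * c * (k / (2 * X * z t) - z' t / (z t)\<^sup>2
            + Z / X * ((k + 2) / (2 * \<gamma>)) + Z * z' t / z t)"
          unfolding u'_def p'_def Z_def[symmetric] using X zt gamma_gt_1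
          by (simp add: field_simps power2_eq_square)
        also have "\<dots> = J * c * (k / (2 * X * z t) - z' t / (z t)\<^sup>2
            + Z / X * (k / (\<gamma> - 1)) + Z * z' t / z t)"
          unfolding kk ..
        also have "\<dots> = J * z t / c * E"
          unfolding E g g' using X zt c(1) gamma_gt_1
          by (simp add: divide_simps power2_eq_square power3_eq_cube) (simp add: algebra_simps)
        finally show ?thesis .
      qed
      moreover have "(r0 - t) * rho (W t) = J * z t / c"
        using X by (simp add: W gas_state_def Let_def c_def X_def[symmetric])
      ultimately show "J * u' + (r0 - t) * p' = (r0 - t) * rho (W t) * elec (W t)"
        by (simp add: elec E_def X_def[symmetric])
    qed
  qed
qed

end

section \<open>Growth of the Bernoulli function\<close>

text \<open>As \<open>F\<close> loses at most \<open>C\<close> per unit time, its present value bounds all earlier ones up to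
  a constant. Integrating \<open>B' = F / x\<close> then bounds \<open>B\<close> by the present value of \<open>F\<close> times
  the logarithm of the ratio of the radii.\<close>

lemma bernoulli_growth:
  fixes B F f :: "real \<Rightarrow> real"
  assumes st: "s \<le> t" "t < r0" "0 \<le> C"
    and B: "\<And>\<tau>. \<tau> \<in> {s..t} \<Longrightarrow> (B has_real_derivative F \<tau> / (r0 - \<tau>)) (at \<tau> within {s..t})"
    and F: "\<And>\<tau>. \<tau> \<in> {s..t} \<Longrightarrow> (F has_real_derivative f \<tau>) (at \<tau> within {s..t})"
    and f: "\<And>\<tau>. \<tau> \<in> {s..t} \<Longrightarrow> - C \<le> f \<tau>"
  shows "F s \<le> F t + C * (t - s)"
    and "B t \<le> B s + (F t + C * (t - s)) * (ln (r0 - s) - ln (r0 - t))"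
proof -
  have F_le: "F \<tau> \<le> F t + C * (t - \<tau>)" if \<tau>: "\<tau> \<in> {s..t}" for \<tau>
  proof -
    have sub: "{\<tau>..t} \<subseteq> {s..t}" using \<tau> by auto
    have "F \<tau> + C * \<tau> \<le> F t + C * t"
    proof (rule nondecreasing_if_derivative_nonneg_within[where f = "\<lambda>u. F u + C * u" and f' = "\<lambda>\<tau>. f \<tau> + C"])
      show "\<tau> \<le> t" using \<tau> by simp
      fix u assume u: "u \<in> {\<tau>..t}"
      show "((\<lambda>u. F u + C * u) has_real_derivative f u + C) (at u within {\<tau>..t})"
        using u sub by (auto intro!: derivative_eq_intros DERIV_subset[OF F])
    next
      fix u assume "\<tau> < u" "u < t"
      then show "0 \<le> f u + C" using f[of u] \<tau> by simp
    qed
    then show ?thesis by (simp add: algebra_simps)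
  qed
  show "F s \<le> F t + C * (t - s)" using F_le[of s] st by simp
  define G where "G = F t + C * (t - s)"
  have "- B s - G * ln (r0 - s) \<le> - B t - G * ln (r0 - t)"
  proof (rule nondecreasing_if_derivative_nonneg_within[OF st(1), where
        f = "\<lambda>\<tau>. - B \<tau> - G * ln (r0 - \<tau>)" and f' = "\<lambda>\<tau>. (G - F \<tau>) / (r0 - \<tau>)"])
    fix \<tau> assume \<tau>: "\<tau> \<in> {s..t}"
    show "((\<lambda>\<tau>. - B \<tau> - G * ln (r0 - \<tau>)) has_real_derivative (G - F \<tau>) / (r0 - \<tau>)) (at \<tau> within {s..t})"
      using \<tau> st by (auto intro!: derivative_eq_intros B simp: diff_divide_distrib)
  next
    fix \<tau> assume \<tau>: "s < \<tau>" "\<tau> < t"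
    have "C * (t - \<tau>) \<le> C * (t - s)" using \<tau> st by (intro mult_left_mono) auto
    then have "F \<tau> \<le> G" using F_le[of \<tau>] \<tau> by (simp add: G_def)
    then show "0 \<le> (G - F \<tau>) / (r0 - \<tau>)" using \<tau> st by simp
  qed
  then show "B t \<le> B s + (F t + C * (t - s)) * (ln (r0 - s) - ln (r0 - t))"
    unfolding G_def[symmetric] right_diff_distrib[of G] by linarith
qed

text \<open>The bounds accumulated since the entrance. They involve the current values of \<open>B\<close> and
  \<open>F\<close> only, and hence pass through a shock.\<close>

definition growth_controlled ::
  "real \<Rightarrow> real \<Rightarrow> real \<Rightarrow> real \<Rightarrow> real \<Rightarrow> real \<Rightarrow> real \<Rightarrow> bool" where
  "growth_controlled r0 C Bi Fi t B F \<longleftrightarrow>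
     Fi \<le> F + C * t \<and> B \<le> Bi + (F + C * t) * (ln r0 - ln (r0 - t))"

lemma growth_controlled_propagates:
  fixes B F f :: "real \<Rightarrow> real"
  assumes "growth_controlled r0 C Bi Fi s (B s) (F s)"
    and st: "0 \<le> s" "s \<le> t" "t < r0" "0 \<le> C" "0 \<le> Fi"
    and B: "\<And>\<tau>. \<tau> \<in> {s..t} \<Longrightarrow> (B has_real_derivative F \<tau> / (r0 - \<tau>)) (at \<tau> within {s..t})"
    and F: "\<And>\<tau>. \<tau> \<in> {s..t} \<Longrightarrow> (F has_real_derivative f \<tau>) (at \<tau> within {s..t})"
    and f: "\<And>\<tau>. \<tau> \<in> {s..t} \<Longrightarrow> - C \<le> f \<tau>"
  shows "growth_controlled r0 C Bi Fi t (B t) (F t)"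
proof -
  note growth = bernoulli_growth[OF st(2,3,4) B F f]
  have F1: "F s + C * s \<le> F t + C * t" using growth(1) by (simp add: algebra_simps)
  have C: "C * (t - s) \<le> C * t" using st by (simp add: algebra_simps)
  have L: "ln (r0 - t) \<le> ln (r0 - s)" "ln (r0 - s) \<le> ln r0" using st by auto
  have "B t \<le> B s + (F t + C * t) * (ln (r0 - s) - ln (r0 - t))"
    using growth(2) mult_right_mono[of "F t + C * (t - s)" "F t + C * t" "ln (r0 - s) - ln (r0 - t)"] C L
    by linarith
  moreover have "B s \<le> Bi + (F t + C * t) * (ln r0 - ln (r0 - s))"
    using assms(1) mult_right_mono[OF F1, of "ln r0 - ln (r0 - s)"] L
    unfolding growth_controlled_def by linarith
  ultimately show ?thesis
    using assms(1) F1 unfolding growth_controlled_def by (auto simp: algebra_simps)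
qed

context polytropic_gas
begin

text \<open>If \<open>k \<Lambda> < 1\<close>, where \<open>\<Lambda>\<close> is the logarithm of the ratio of the radii, then a strong
  entrance field makes \<open>F\<close> exceed \<open>k B\<close> throughout. The bound on \<open>ln (r0 / r1)\<close> in the
  theorem has its origin here.\<close>

lemma growth_controlled_dominates:
  assumes gc: "growth_controlled r0 C Bi Fi t B F"
    and t: "0 \<le> t" "t \<le> T" "T < r0" "0 \<le> C" "0 \<le> Fi"
    and \<Lambda>: "\<Lambda> = ln r0 - ln (r0 - T)" "k * \<Lambda> < 1"
    and large: "k * (Bi + \<Lambda> * (C * T)) < (1 - k * \<Lambda>) * (Fi - C * T)"
  shows "k * B < F"
proof -
  have L: "ln r0 - ln (r0 - t) \<le> \<Lambda>" "0 \<le> ln r0 - ln (r0 - t)" using t by (auto simp: \<Lambda>)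
  have F: "Fi \<le> F + C * t" using gc by (simp add: growth_controlled_def)
  have Ct: "C * t \<le> C * T" using t by (simp add: mult_left_mono)
  have "B \<le> Bi + (F + C * t) * (ln r0 - ln (r0 - t))"
    using gc by (simp add: growth_controlled_def)
  also have "\<dots> \<le> Bi + (F + C * T) * \<Lambda>"
    using L F Ct t by (intro add_mono mult_mono) auto
  finally have "k * B \<le> k * (Bi + (F + C * T) * \<Lambda>)"
    using k_pos by (intro mult_left_mono) auto
  also have "\<dots> = k * (Bi + \<Lambda> * (C * T)) + k * \<Lambda> * F" by (simp add: algebra_simps)
  also have "\<dots> < (1 - k * \<Lambda>) * (Fi - C * T) + k * \<Lambda> * F" using large by simp
  also have "\<dots> \<le> (1 - k * \<Lambda>) * F + k * \<Lambda> * F"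
    using \<Lambda> F Ct by (intro add_right_mono mult_left_mono) auto
  also have "\<dots> = F" by (simp add: algebra_simps)
  finally show ?thesis .
qed

end

section \<open>Branches extended to the real line\<close>

text \<open>An exponential matches the identity to first order at \<open>d\<close> and stays above \<open>c\<close>. Composing
  a branch with such a map moves its argument away from the sonic value.\<close>

lemma C1_retraction_above:
  fixes c d :: real
  assumes "c < d"
  obtains \<kappa> \<kappa>' where "\<And>w. (\<kappa> has_real_derivative \<kappa>' w) (at w)" "continuous_on UNIV \<kappa>'"
    "\<And>w. 0 \<le> \<kappa>' w" "\<And>w. \<kappa>' w \<le> 1"
    "\<And>w. c < \<kappa> w" "\<And>w. \<kappa> w \<le> max w d" "\<And>w. d \<le> w \<Longrightarrow> \<kappa> w = w" "\<And>w. d \<le> w \<Longrightarrow> \<kappa>' w = 1"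
proof -
  define e where "e = d - c"
  have e: "0 < e" using assms by (simp add: e_def)
  define \<kappa> where "\<kappa> w = (if w \<in> {d..} then w else d - e + e * exp ((w - d) / e))" for w
  define \<kappa>' where "\<kappa>' w = (if w \<in> {d..} then 1 else exp ((w - d) / e))" for w
  show thesis
  proof (rule that[of \<kappa> \<kappa>'])
    fix w
    have "(\<kappa> has_vector_derivative \<kappa>' w) (at w within UNIV)"
      unfolding \<kappa>_def \<kappa>'_def
    proof (rule has_vector_derivative_If_within_closures[where T = "{..<d}"])
      show "((\<lambda>w. d - e + e * exp ((w - d) / e)) has_vector_derivative exp ((w - d) / e))
          (at w within {..<d} \<union> closure {d..} \<inter> closure {..<d})"
        unfolding has_real_derivative_iff_has_vector_derivative[symmetric]
        using e by (auto intro!: derivative_eq_intros)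
    qed (auto simp: e_def)
    then show "(\<kappa> has_real_derivative \<kappa>' w) (at w)"
      by (simp add: has_real_derivative_iff_has_vector_derivative)
    show "0 \<le> \<kappa>' w" "\<kappa>' w \<le> 1" using e by (auto simp: \<kappa>'_def divide_le_0_iff)
    have le: "e * exp ((w - d) / e) \<le> e" if "w < d" using e that by (simp add: divide_le_0_iff)
    have "c = d - e" by (simp add: e_def)
    with e le show "c < \<kappa> w" "\<kappa> w \<le> max w d"
      by (auto simp: \<kappa>_def)
    show "\<kappa> w = w" "\<kappa>' w = 1" if "d \<le> w" using that by (auto simp: \<kappa>_def \<kappa>'_def)
  next
    have "\<kappa>' = (\<lambda>w. exp (min 0 ((w - d) / e)))"
      using e by (auto simp: \<kappa>'_def fun_eq_iff min_def divide_le_0_iff zero_le_divide_iff)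
    then show "continuous_on UNIV \<kappa>'" by (simp only:) (intro continuous_intros, use e in auto)
  qed
qed

lemma C1_retraction_below:
  fixes c d :: real
  assumes "d < c"
  obtains \<kappa> \<kappa>' where "\<And>w. (\<kappa> has_real_derivative \<kappa>' w) (at w)" "continuous_on UNIV \<kappa>'"
    "\<And>w. 0 \<le> \<kappa>' w" "\<And>w. \<kappa>' w \<le> 1"
    "\<And>w. \<kappa> w < c" "\<And>w. w \<le> d \<Longrightarrow> \<kappa> w = w" "\<And>w. w \<le> d \<Longrightarrow> \<kappa>' w = 1"
proof -
  from assms have "- c < - d" by simp
  then obtain \<kappa> \<kappa>' where \<kappa>: "\<And>w. (\<kappa> has_real_derivative \<kappa>' w) (at w)" "continuous_on UNIV \<kappa>'"
    "\<And>w. 0 \<le> \<kappa>' w" "\<And>w. \<kappa>' w \<le> 1"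
    "\<And>w. - c < \<kappa> w" "\<And>w. - d \<le> w \<Longrightarrow> \<kappa> w = w" "\<And>w. - d \<le> w \<Longrightarrow> \<kappa>' w = 1"
    by (rule C1_retraction_above) blast
  show thesis
  proof (rule that[of "\<lambda>w. - \<kappa> (- w)" "\<lambda>w. \<kappa>' (- w)"])
    fix w
    show "((\<lambda>w. - \<kappa> (- w)) has_real_derivative \<kappa>' (- w)) (at w)"
      using DERIV_minus[OF DERIV_chain2[OF \<kappa>(1) DERIV_minus[OF DERIV_ident]]] by simp
    show "0 \<le> \<kappa>' (- w)" "\<kappa>' (- w) \<le> 1" "- \<kappa> (- w) < c"
      using \<kappa>(3,4,5)[of "- w"] by auto
    show "- \<kappa> (- w) = w" "\<kappa>' (- w) = 1" if "w \<le> d" using \<kappa>(6,7)[of "- w"] that by auto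
  next
    show "continuous_on UNIV (\<lambda>w. \<kappa>' (- w))"
      by (rule continuous_on_compose2[OF \<kappa>(2)]) (auto intro: continuous_intros)
  qed
qed

context polytropic_gas
begin

text \<open>A globally Lipschitz and continuously differentiable replacement of the branch \<open>h\<close>,
  equal to it on \<open>D\<close>. All its values are values of \<open>h\<close>, which keeps the density positive even
  where a solution leaves \<open>D\<close>.\<close>

definition extends_branch ::
  "(real \<Rightarrow> real) \<Rightarrow> real set \<Rightarrow> real \<Rightarrow> (real \<Rightarrow> real) \<Rightarrow> (real \<Rightarrow> real) \<Rightarrow> bool" where
  "extends_branch h D L hh hh' \<longleftrightarrow>
     (\<forall>w. (hh has_real_derivative hh' w) (at w)) \<and> continuous_on UNIV hh' \<and>
     (\<forall>w. \<bar>hh' w\<bar> \<le> L) \<and> (\<forall>w. \<exists>v>1 / k. hh w = h v) \<and>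
     (\<forall>w\<in>D. hh w = h w \<and> hh' w = 1 / g' (h w))"

lemma extends_branch_compose:
  assumes h: "branch h"
    and \<kappa>: "\<And>w. (\<kappa> has_real_derivative \<kappa>' w) (at w)" "continuous_on UNIV \<kappa>'" "\<And>w. \<bar>\<kappa>' w\<bar> \<le> 1"
    and lower: "\<And>w. 1 / k < \<kappa> w" and L: "\<And>w. \<bar>1 / g' (h (\<kappa> w))\<bar> \<le> L"
    and id: "\<And>w. w \<in> D \<Longrightarrow> \<kappa> w = w \<and> \<kappa>' w = 1"
  shows "extends_branch h D L (\<lambda>w. h (\<kappa> w)) (\<lambda>w. 1 / g' (h (\<kappa> w)) * \<kappa>' w)"
  unfolding extends_branch_def
proof (intro conjI allI ballI)
  fix w
  show "((\<lambda>w. h (\<kappa> w)) has_real_derivative 1 / g' (h (\<kappa> w)) * \<kappa>' w) (at w)"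
    by (rule DERIV_chain2[OF branchD(4)[OF h lower] \<kappa>(1)])
  have "\<bar>1 / g' (h (\<kappa> w)) * \<kappa>' w\<bar> \<le> \<bar>1 / g' (h (\<kappa> w))\<bar> * 1"
    unfolding abs_mult by (intro mult_left_mono \<kappa>) simp
  then show "\<bar>1 / g' (h (\<kappa> w)) * \<kappa>' w\<bar> \<le> L" using L[of w] by linarith
  show "\<exists>v>1 / k. h (\<kappa> w) = h v" using lower by blast
next
  have "continuous_on UNIV \<kappa>" by (rule DERIV_continuous_on[OF \<kappa>(1)])
  then have "continuous_on UNIV (\<lambda>w. 1 / g' (h (\<kappa> w)))"
    by (rule continuous_on_compose2[OF branch_deriv_cont[OF h order_refl]]) (use lower in auto)
  then show "continuous_on UNIV (\<lambda>w. 1 / g' (h (\<kappa> w)) * \<kappa>' w)"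
    by (intro continuous_on_mult \<kappa>)
qed (use id in auto)

lemma supersonic_antimono:
  assumes "1 / k < v" "v \<le> w"
  shows "supersonic w \<le> supersonic v"
  using supersonic[of v] supersonic[of w] assms g_less_supersonic[of "supersonic v" "supersonic w"]
  by (cases "supersonic w \<le> supersonic v") auto

lemma subsonic_mono:
  assumes "1 / k < v" "v \<le> w"
  shows "subsonic v \<le> subsonic w"
  using subsonic[of v] subsonic[of w] assms g_less_subsonic[of "subsonic w" "subsonic v"]
  by (cases "subsonic v \<le> subsonic w") auto

text \<open>Towards the supersonic end \<open>z\<close> tends to 0 and the slope \<open>1 / g' z\<close> of the branch only
  gets smaller, so it suffices to stay away from the sonic value.\<close>

lemma supersonic_extension:
  assumes "1 / k < w0"
  obtains L hh hh' where "extends_branch supersonic {w0..} L hh hh'"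
proof -
  define c where "c = (1 / k + w0) / 2"
  have c: "1 / k < c" "c < w0" using assms by (auto simp: c_def)
  obtain \<kappa> \<kappa>' where \<kappa>: "\<And>w. (\<kappa> has_real_derivative \<kappa>' w) (at w)" "continuous_on UNIV \<kappa>'"
    "\<And>w. 0 \<le> \<kappa>' w" "\<And>w. \<kappa>' w \<le> 1"
    "\<And>w. c < \<kappa> w" "\<And>w. w0 \<le> w \<Longrightarrow> \<kappa> w = w" "\<And>w. w0 \<le> w \<Longrightarrow> \<kappa>' w = 1"
    by (rule C1_retraction_above[OF c(2)]) blast
  define L where "L = 1 / (1 - supersonic c powr (\<gamma> + 1))"
  have zc: "0 < supersonic c" "supersonic c < 1" using supersonic[OF c(1)] by auto
  have pc: "supersonic c powr (\<gamma> + 1) < 1"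
    using powr_less_one_iff[of "\<gamma> + 1" "supersonic c"] zc gamma_gt_1 by simp
  have "\<bar>1 / g' (supersonic v)\<bar> \<le> L" if "c < v" for v
  proof -
    define z where "z = supersonic v"
    have z: "0 < z" "z < 1" "z \<le> supersonic c"
      using supersonic[of v] supersonic_antimono[OF c(1), of v] c that by (auto simp: z_def)
    have "z powr (\<gamma> + 1) \<le> supersonic c powr (\<gamma> + 1)"
      using z gamma_gt_1 by (intro powr_mono2) auto
    then have 1: "1 - supersonic c powr (\<gamma> + 1) \<le> 1 - z powr (\<gamma> + 1)" by simp
    have "1 - z powr (\<gamma> + 1) \<le> (1 - z powr (\<gamma> + 1)) / z ^ 3"
      using z 1 pc power_le_one[of z 3] by (simp add: pos_le_divide_eq mult_left_le)
    also have "\<dots> = \<bar>g' z\<bar>"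
      using z 1 pc by (simp add: g'_def abs_if divide_less_0_iff minus_divide_left)
    finally have "1 - supersonic c powr (\<gamma> + 1) \<le> \<bar>g' z\<bar>" using 1 by linarith
    then have "1 / \<bar>g' z\<bar> \<le> L"
      unfolding L_def using pc by (intro divide_left_mono mult_pos_pos) auto
    then show ?thesis by (simp add: z_def)
  qed
  then have "extends_branch supersonic {w0..} L (\<lambda>w. supersonic (\<kappa> w)) (\<lambda>w. 1 / g' (supersonic (\<kappa> w)) * \<kappa>' w)"
    using \<kappa> c by (intro extends_branch_compose branch_supersonic) (auto intro: less_trans)
  then show thesis by (rule that)
qed

text \<open>For \<open>\<gamma> \<ge> 2\<close> the term \<open>z powr (\<gamma> - 2)\<close> of \<open>g' z\<close> is at least 1, which bounds the
  slope of the branch up to infinity. Solutions of the planar system then exist on long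
  intervals.\<close>

lemma subsonic_extension_large_gamma:
  assumes "1 / k < w0" "2 \<le> \<gamma>"
  obtains L hh hh' where "extends_branch subsonic {w0..} L hh hh'"
proof -
  define c where "c = (1 / k + w0) / 2"
  have c: "1 / k < c" "c < w0" using assms by (auto simp: c_def)
  obtain \<kappa> \<kappa>' where \<kappa>: "\<And>w. (\<kappa> has_real_derivative \<kappa>' w) (at w)" "continuous_on UNIV \<kappa>'"
    "\<And>w. 0 \<le> \<kappa>' w" "\<And>w. \<kappa>' w \<le> 1"
    "\<And>w. c < \<kappa> w" "\<And>w. w0 \<le> w \<Longrightarrow> \<kappa> w = w" "\<And>w. w0 \<le> w \<Longrightarrow> \<kappa>' w = 1"
    by (rule C1_retraction_above[OF c(2)]) blast
  define L where "L = 1 / (1 - 1 / subsonic c ^ 3)"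
  have zc: "1 < subsonic c" using subsonic[OF c(1)] by auto
  have pc: "1 / subsonic c ^ 3 < 1"
    using zc one_less_power[OF zc, of 3] by simp
  have "\<bar>1 / g' (subsonic v)\<bar> \<le> L" if "c < v" for v
  proof -
    define z where "z = subsonic v"
    have z: "1 < z" "subsonic c \<le> z"
      using subsonic[of v] subsonic_mono[OF c(1), of v] c that by (auto simp: z_def)
    have "g' z = z powr (\<gamma> - 2) - 1 / z ^ 3"
      using z by (simp add: g'_def powr_to_power diff_divide_distrib)
    moreover have "1 \<le> z powr (\<gamma> - 2)" using z assms(2) by (intro ge_one_powr_ge_zero) auto
    moreover have "1 / z ^ 3 \<le> 1 / subsonic c ^ 3"
      using z zc by (intro divide_left_mono power_mono mult_pos_pos zero_less_power) auto
    ultimately have "1 - 1 / subsonic c ^ 3 \<le> g' z" by linarith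
    then have "1 / g' z \<le> L" "0 < g' z"
      unfolding L_def using pc by (auto intro!: divide_left_mono mult_pos_pos)
    then show ?thesis by (simp add: z_def)
  qed
  then have "extends_branch subsonic {w0..} L (\<lambda>w. subsonic (\<kappa> w)) (\<lambda>w. 1 / g' (subsonic (\<kappa> w)) * \<kappa>' w)"
    using \<kappa> c by (intro extends_branch_compose branch_subsonic) (auto intro: less_trans)
  then show thesis by (rule that)
qed

text \<open>For \<open>\<gamma> < 2\<close> the branch grows faster than linearly, and solutions may blow up. Here the
  argument is cut off from above too.\<close>

lemma subsonic_extension_bounded:
  assumes "1 / k < w0" "w0 \<le> w1"
  obtains L hh hh' where "extends_branch subsonic {w0..w1} L hh hh'"
    "\<And>w. hh w \<le> subsonic (w1 + 1)"
proof -
  define c where "c = (1 / k + w0) / 2"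
  have c: "1 / k < c" "c < w0" using assms by (auto simp: c_def)
  obtain \<kappa> \<kappa>' where \<kappa>: "\<And>w. (\<kappa> has_real_derivative \<kappa>' w) (at w)" "continuous_on UNIV \<kappa>'"
    "\<And>w. 0 \<le> \<kappa>' w" "\<And>w. \<kappa>' w \<le> 1"
    "\<And>w. c < \<kappa> w" "\<And>w. \<kappa> w \<le> max w w0" "\<And>w. w0 \<le> w \<Longrightarrow> \<kappa> w = w" "\<And>w. w0 \<le> w \<Longrightarrow> \<kappa>' w = 1"
    by (rule C1_retraction_above[OF c(2)]) blast
  obtain \<mu> \<mu>' where \<mu>: "\<And>w. (\<mu> has_real_derivative \<mu>' w) (at w)" "continuous_on UNIV \<mu>'"
    "\<And>w. 0 \<le> \<mu>' w" "\<And>w. \<mu>' w \<le> 1"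
    "\<And>w. \<mu> w < w1 + 1" "\<And>w. w \<le> w1 \<Longrightarrow> \<mu> w = w" "\<And>w. w \<le> w1 \<Longrightarrow> \<mu>' w = 1"
    by (rule C1_retraction_below[of w1 "w1 + 1"]) auto
  define \<nu> where "\<nu> w = \<kappa> (\<mu> w)" for w
  define \<nu>' where "\<nu>' w = \<kappa>' (\<mu> w) * \<mu>' w" for w
  have \<nu>_range: "c < \<nu> w" "\<nu> w \<le> w1 + 1" for w
    using \<kappa>(5,6)[of "\<mu> w"] \<mu>(5)[of w] assms by (auto simp: \<nu>_def)
  have "continuous_on {c..w1 + 1} (\<lambda>w. 1 / g' (subsonic w))"
    by (rule branch_deriv_cont[OF branch_subsonic]) (use c in auto)
  then have "bounded ((\<lambda>w. 1 / g' (subsonic w)) ` {c..w1 + 1})"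
    by (intro compact_imp_bounded compact_continuous_image) auto
  then obtain L where "\<forall>y\<in>(\<lambda>w. 1 / g' (subsonic w)) ` {c..w1 + 1}. norm y \<le> L"
    unfolding bounded_iff by blast
  then have L: "\<bar>1 / g' (subsonic w)\<bar> \<le> L" if "c < w" "w \<le> w1 + 1" for w using that by auto
  have \<mu>_cont: "continuous_on UNIV \<mu>" by (rule DERIV_continuous_on[OF \<mu>(1)])
  have "extends_branch subsonic {w0..w1} L (\<lambda>w. subsonic (\<nu> w)) (\<lambda>w. 1 / g' (subsonic (\<nu> w)) * \<nu>' w)"
  proof (rule extends_branch_compose[OF branch_subsonic])
    fix w
    show "(\<nu> has_real_derivative \<nu>' w) (at w)"
      unfolding \<nu>_def[abs_def] \<nu>'_def by (rule DERIV_chain2[OF \<kappa>(1) \<mu>(1)])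
    show "\<bar>\<nu>' w\<bar> \<le> 1"
      using \<kappa>(3,4)[of "\<mu> w"] \<mu>(3,4)[of w] by (simp add: \<nu>'_def mult_le_one)
    show "1 / k < \<nu> w" using c \<nu>_range[of w] by linarith
    show "\<bar>1 / g' (subsonic (\<nu> w))\<bar> \<le> L" by (rule L[OF \<nu>_range])
    show "\<nu> w = w \<and> \<nu>' w = 1" if "w \<in> {w0..w1}"
      using that \<mu>(6,7)[of w] \<kappa>(7,8)[of w] by (simp add: \<nu>_def \<nu>'_def)
  next
    show "continuous_on UNIV \<nu>'"
      unfolding \<nu>'_def
      by (intro continuous_intros \<mu>(2) continuous_on_compose2[OF \<kappa>(2) \<mu>_cont]) auto
  qed
  moreover have "subsonic (\<nu> w) \<le> subsonic (w1 + 1)" for w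
    using \<nu>_range[of w] c by (intro subsonic_mono) auto
  ultimately show thesis by (rule that)
qed

lemma extends_branchD:
  assumes "extends_branch h D L hh hh'"
  shows "(hh has_real_derivative hh' w) (at w)" "continuous_on UNIV hh'" "\<bar>hh' w\<bar> \<le> L"
    "\<exists>v>1 / k. hh w = h v" "w \<in> D \<Longrightarrow> hh w = h w" "w \<in> D \<Longrightarrow> hh' w = 1 / g' (h w)"
  using assms by (auto simp: extends_branch_def)

lemma extends_branch_pos:
  assumes "extends_branch h D L hh hh'" "branch h"
  shows "0 < hh w"
  using extends_branchD(4)[OF assms(1), of w] branchD(1)[OF assms(2)] by auto

lemma extends_branch_lipschitz:
  assumes "extends_branch h D L hh hh'"
  shows "\<bar>hh v - hh w\<bar> \<le> L * \<bar>v - w\<bar>"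
  using field_differentiable_bound[of UNIV hh hh' L v w] extends_branchD(1,3)[OF assms] by auto

section \<open>Solutions of the planar system\<close>

lemma density_source_lipschitz:
  assumes "0 < J" "0 < a" "0 < x" "x \<le> r" and lip: "\<And>v w. \<bar>h v - h w\<bar> \<le> L * \<bar>v - w\<bar>"
  shows "\<bar>density_source J a h x B - density_source J a h x B'\<bar>
    \<le> J * r powr (k / 2) / sqrt a * (L * (r powr k / a)) * \<bar>B - B'\<bar>"
proof -
  have "0 \<le> L" using lip[of 0 1] abs_ge_zero[of "h 0 - h 1"] by simp
  have mono: "x powr p \<le> r powr p" if "0 < p" for p using assms that by (intro powr_mono2) auto
  have "\<bar>density_source J a h x B - density_source J a h x B'\<bar>
      = J * x powr (k / 2) / sqrt a * \<bar>h (B * x powr k / a) - h (B' * x powr k / a)\<bar>"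
    unfolding density_source_def right_diff_distrib[symmetric] abs_mult
    using assms(1,2) by simp
  also have "\<dots> \<le> J * x powr (k / 2) / sqrt a * (L * \<bar>B * x powr k / a - B' * x powr k / a\<bar>)"
    using assms(1,2) by (intro mult_left_mono lip) auto
  also have "\<bar>B * x powr k / a - B' * x powr k / a\<bar> = x powr k / a * \<bar>B - B'\<bar>"
    using assms(2) by (simp add: abs_mult mult.commute flip: diff_divide_distrib left_diff_distrib)
  also have "J * x powr (k / 2) / sqrt a * (L * (x powr k / a * \<bar>B - B'\<bar>))
      \<le> J * r powr (k / 2) / sqrt a * (L * (r powr k / a * \<bar>B - B'\<bar>))"
    using assms(1,2) k_pos \<open>0 \<le> L\<close>
    by (intro mult_mono divide_right_mono mult_left_mono mono mult_nonneg_nonneg order_refl) auto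
  finally show ?thesis by (simp add: mult.assoc)
qed

definition planar_field ::
  "real \<Rightarrow> (real \<Rightarrow> real) \<Rightarrow> real \<Rightarrow> real \<Rightarrow> (real \<Rightarrow> real) \<Rightarrow> real \<Rightarrow> real \<times> real \<Rightarrow> real \<times> real" where
  "planar_field r0 b J a h t y =
     (snd y / (r0 - t), density_source J a h (r0 - t) (fst y) - (r0 - t) * b t)"

lemma planar_field_lipschitz:
  assumes "0 < J" "0 < a" "0 \<le> t" "t \<le> T" "T < r0"
    and lip: "\<And>v w. \<bar>h v - h w\<bar> \<le> L * \<bar>v - w\<bar>"
  shows "norm (planar_field r0 b J a h t y - planar_field r0 b J a h t y')
    \<le> (1 / (r0 - T) + J * r0 powr (k / 2) / sqrt a * (L * (r0 powr k / a))) * norm (y - y')"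
proof -
  let ?M = "J * r0 powr (k / 2) / sqrt a * (L * (r0 powr k / a))"
  have "0 \<le> L" using lip[of 0 1] abs_ge_zero[of "h 0 - h 1"] by simp
  then have "0 \<le> ?M" using assms by simp
  have components: "\<bar>fst v\<bar> \<le> norm v" "\<bar>snd v\<bar> \<le> norm v" for v :: "real \<times> real"
    using norm_fst_le[of "fst v" "snd v"] norm_snd_le[of "snd v" "fst v"] by simp_all
  have "norm (planar_field r0 b J a h t y - planar_field r0 b J a h t y')
      \<le> \<bar>snd y / (r0 - t) - snd y' / (r0 - t)\<bar>
        + \<bar>density_source J a h (r0 - t) (fst y) - density_source J a h (r0 - t) (fst y')\<bar>"
    by (simp add: planar_field_def norm_Pair real_norm_def sqrt_sum_squares_le_sum_abs)
  also have "\<bar>snd y / (r0 - t) - snd y' / (r0 - t)\<bar> = 1 / (r0 - t) * \<bar>snd (y - y')\<bar>"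
    using assms by (simp flip: diff_divide_distrib)
  also have "\<dots> \<le> 1 / (r0 - T) * norm (y - y')"
    using assms by (intro mult_mono divide_left_mono components) auto
  also have "\<bar>density_source J a h (r0 - t) (fst y) - density_source J a h (r0 - t) (fst y')\<bar>
      \<le> ?M * \<bar>fst y - fst y'\<bar>"
    by (rule density_source_lipschitz[OF assms(1,2) _ _ lip]) (use assms in auto)
  also have "\<dots> \<le> ?M * norm (y - y')"
    using components(1)[of "y - y'"] \<open>0 \<le> ?M\<close> by (intro mult_left_mono) auto
  finally show ?thesis by (simp add: algebra_simps)
qed

lemma reduced_system_iff:
  "reduced_system r0 b J a h S B F \<longleftrightarrow> (\<forall>t\<in>S.
     ((\<lambda>t. (B t, F t)) has_vector_derivative planar_field r0 b J a h t (B t, F t)) (at t within S))"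
proof -
  have "((\<lambda>t. (B t, F t)) has_vector_derivative (u, v)) (at t within S) \<longleftrightarrow>
      (B has_real_derivative u) (at t within S) \<and> (F has_real_derivative v) (at t within S)" for t u v
    unfolding has_real_derivative_iff_has_vector_derivative
    using has_vector_derivative_Pair[of B u t S F v]
      bounded_linear.has_vector_derivative[OF bounded_linear_fst, of "\<lambda>t. (B t, F t)" "(u, v)" "at t within S"]
      bounded_linear.has_vector_derivative[OF bounded_linear_snd, of "\<lambda>t. (B t, F t)" "(u, v)" "at t within S"]
    by auto
  then show ?thesis by (simp add: reduced_system_def planar_field_def)
qed

lemma reduced_system_subset:
  "reduced_system r0 b J a h S B F \<Longrightarrow> S' \<subseteq> S \<Longrightarrow> reduced_system r0 b J a h S' B F"
  unfolding reduced_system_def by (meson DERIV_subset subsetD)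

lemma reduced_system_cong:
  assumes "reduced_system r0 b J a h S B F"
    and "\<And>t. t \<in> S \<Longrightarrow> h (B t * (r0 - t) powr k / a) = h' (B t * (r0 - t) powr k / a)"
  shows "reduced_system r0 b J a h' S B F"
  using assms by (simp add: reduced_system_def density_source_def)

lemma density_source_cont:
  assumes "continuous_on UNIV h" "continuous_on S B" "\<And>t. t \<in> S \<Longrightarrow> t < r0" "0 < a"
  shows "continuous_on S (\<lambda>t. density_source J a h (r0 - t) (B t))"
proof -
  have p: "continuous_on S (\<lambda>t. (r0 - t) powr p)" for p
    using assms(3) by (intro continuous_intros) fastforce
  have "continuous_on S (\<lambda>t. h (B t * (r0 - t) powr k / a))"
    by (rule continuous_on_compose2[OF assms(1)]) (use assms in \<open>auto intro!: continuous_intros p\<close>)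
  then show ?thesis
    unfolding density_source_def using assms(4) by (intro continuous_intros p) auto
qed

lemma reduced_system_exists:
  assumes "s \<in> {0..T}" "T < r0" "0 < J" "0 < a" and b: "continuous_on {0..T} b"
    and ext: "extends_branch h D L hh hh'"
  obtains B F where "reduced_system r0 b J a hh {0..T} B F" "B s = Bs" "F s = Fs"
proof -
  have hh_cont: "continuous_on UNIV hh"
    by (rule DERIV_continuous_on[OF extends_branchD(1)[OF ext]])
  obtain y where y: "y s = (Bs, Fs)"
    "\<And>t. t \<in> {0..T} \<Longrightarrow> (y has_vector_derivative planar_field r0 b J a hh t (y t)) (at t within {0..T})"
  proof (rule ode_solution_exists[OF assms(1), where f = "planar_field r0 b J a hh" and ?y0.0 = "(Bs, Fs)"])
    fix y :: "real \<Rightarrow> real \<times> real" assume y: "continuous_on {0..T} y"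
    show "continuous_on {0..T} (\<lambda>t. planar_field r0 b J a hh t (y t))"
      unfolding planar_field_def
      using assms(2,4) by (intro continuous_intros y b density_source_cont hh_cont) auto
  next
    fix t y y' assume "t \<in> {0..T}"
    then show "norm (planar_field r0 b J a hh t y - planar_field r0 b J a hh t y')
      \<le> (1 / (r0 - T) + J * r0 powr (k / 2) / sqrt a * (L * (r0 powr k / a))) * norm (y - y')"
      by (intro planar_field_lipschitz extends_branch_lipschitz[OF ext] assms) auto
  qed blast
  have "reduced_system r0 b J a hh {0..T} (\<lambda>t. fst (y t)) (\<lambda>t. snd (y t))"
    unfolding reduced_system_iff using y(2) by simp
  then show thesis by (rule that) (simp_all add: y(1))
qed

text \<open>A branch is Lipschitz on compact subsets of its domain only, but the values of two given
  solutions lie in such a set. Clamping the argument to it turns both into solutions of a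
  globally Lipschitz equation.\<close>

lemma reduced_system_unique:
  assumes "0 \<le> s" "T < r0" "0 < J" "0 < a" and h: "branch h"
    and sol: "reduced_system r0 b J a h {s..T} B F" "reduced_system r0 b J a h {s..T} B' F'"
    and range: "\<And>t. t \<in> {s..T} \<Longrightarrow> 1 / k < B t * (r0 - t) powr k / a"
      "\<And>t. t \<in> {s..T} \<Longrightarrow> 1 / k < B' t * (r0 - t) powr k / a"
    and init: "B s = B' s" "F s = F' s" and t: "t \<in> {s..T}"
  shows "B t = B' t" "F t = F' t"
proof -
  define w where "w B t = B t * (r0 - t) powr k / a" for B and t :: real
  have cont: "continuous_on {s..T} (w B)" if "reduced_system r0 b J a h {s..T} B F" for B F
  proof -
    have "continuous_on {s..T} B"
      using that by (intro DERIV_continuous_on[where D = "\<lambda>t. F t / (r0 - t)"]) (auto simp: reduced_system_def)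
    then show ?thesis unfolding w_def using assms(2,4) by (intro continuous_intros) auto
  qed
  let ?W = "w B ` {s..T} \<union> w B' ` {s..T}"
  have comp: "compact ?W"
    by (intro compact_Un compact_continuous_image cont[OF sol(1)] cont[OF sol(2)]) auto
  have ne: "?W \<noteq> {}" using t by auto
  obtain c d where cd: "c \<in> ?W" "d \<in> ?W" "\<And>v. v \<in> ?W \<Longrightarrow> c \<le> v \<and> v \<le> d"
    using compact_attains_inf[OF comp ne] compact_attains_sup[OF comp ne] by meson
  have "1 / k < c" using cd(1) range by (auto simp: w_def)
  then have sub: "{c..d} \<subseteq> {1 / k<..}" by auto
  have "bounded ((\<lambda>w. 1 / g' (h w)) ` {c..d})"
    by (intro compact_imp_bounded compact_continuous_image branch_deriv_cont[OF h sub]) auto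
  then obtain L where "\<forall>y\<in>(\<lambda>w. 1 / g' (h w)) ` {c..d}. norm y \<le> L"
    unfolding bounded_iff by blast
  then have L: "norm (1 / g' (h w)) \<le> L" if "w \<in> {c..d}" for w using that by auto
  have hL: "\<bar>h v - h w\<bar> \<le> L * \<bar>v - w\<bar>" if "v \<in> {c..d}" "w \<in> {c..d}" for v w
  proof -
    have "(h has_real_derivative 1 / g' (h z)) (at z within {c..d})" if "z \<in> {c..d}" for z
      using sub that by (intro DERIV_subset[OF branchD(4)[OF h]]) auto
    from field_differentiable_bound[OF _ this L that] show ?thesis by simp
  qed
  define hc where "hc v = h (max c (min d v))" for v
  have cd': "c \<le> d" using cd by blast
  have "0 \<le> L" using order_trans[OF norm_ge_zero L[of c]] cd' by simp
  have hc: "\<bar>hc v - hc w\<bar> \<le> L * \<bar>v - w\<bar>" for v w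
  proof -
    have "\<bar>hc v - hc w\<bar> \<le> L * \<bar>max c (min d v) - max c (min d w)\<bar>"
      unfolding hc_def using cd' by (intro hL) auto
    also have "\<dots> \<le> L * \<bar>v - w\<bar>"
      using \<open>0 \<le> L\<close> by (intro mult_left_mono) (auto simp: max_def min_def abs_if)
    finally show ?thesis .
  qed
  have hceq: "h (w Y \<tau>) = hc (w Y \<tau>)" if "\<tau> \<in> {s..T}" "Y = B \<or> Y = B'" for Y \<tau>
    using cd(3)[of "w Y \<tau>"] that by (auto simp: hc_def)
  have sol': "reduced_system r0 b J a hc {s..T} B F" "reduced_system r0 b J a hc {s..T} B' F'"
    by (rule reduced_system_cong[OF sol(1)], use hceq in \<open>simp add: w_def\<close>)
      (rule reduced_system_cong[OF sol(2)], use hceq in \<open>simp add: w_def\<close>)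
  define y y' where "y = (\<lambda>t. (B t, F t))" and "y' = (\<lambda>t. (B' t, F' t))"
  let ?K = "1 / (r0 - T) + J * r0 powr (k / 2) / sqrt a * (L * (r0 powr k / a))"
  have "norm (y t - y' t) \<le> (norm (y s - y' s) + 0) * exp ((2 * ?K + 1) * (t - s))"
  proof (rule gronwall_norm)
    show "0 \<le> ?K" using assms(2-4) \<open>0 \<le> L\<close> by simp
    fix \<tau> assume \<tau>: "\<tau> \<in> {s..t}"
    then have \<tau>': "\<tau> \<in> {s..T}" and sub: "{s..t} \<subseteq> {s..T}" using t by auto
    show "((\<lambda>t. y t - y' t) has_vector_derivative
        planar_field r0 b J a hc \<tau> (y \<tau>) - planar_field r0 b J a hc \<tau> (y' \<tau>)) (at \<tau> within {s..t})"
      using sol' \<tau>' unfolding reduced_system_iff y_def y'_def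
      by (intro has_vector_derivative_diff has_vector_derivative_within_subset[OF _ sub]) auto
    have "norm (planar_field r0 b J a hc \<tau> (y \<tau>) - planar_field r0 b J a hc \<tau> (y' \<tau>))
        \<le> ?K * norm (y \<tau> - y' \<tau>)"
      by (rule planar_field_lipschitz[OF assms(3,4) _ _ assms(2) hc]) (use \<tau>' assms(1) in auto)
    then show "norm (planar_field r0 b J a hc \<tau> (y \<tau>) - planar_field r0 b J a hc \<tau> (y' \<tau>))
        \<le> ?K * norm (y \<tau> - y' \<tau>) + 0" by simp
  qed (use t in auto)
  then show "B t = B' t" "F t = F' t"
    using init by (simp_all add: y_def y'_def zero_prod_def)
qed

end

context polytropic_gas
begin

section \<open>The shock relations\<close>

text \<open>The inverse square of the Mach number; in terms of it the shock relations are rational.\<close>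

definition zeta :: "flow_state \<Rightarrow> real" where
  "zeta s = \<gamma> * pres s / (rho s * (vel s)\<^sup>2)"

definition positive_state :: "flow_state \<Rightarrow> bool" where
  "positive_state s \<longleftrightarrow> 0 < rho s \<and> 0 < vel s \<and> 0 < pres s"

text \<open>The inverse square of the Mach number behind a shock, in terms of the one ahead of it.\<close>

definition shock_zeta :: "real \<Rightarrow> real" where
  "shock_zeta \<zeta> = (2 * \<gamma> - (\<gamma> - 1) * \<zeta>) / (\<gamma> - 1 + 2 * \<zeta>)"

text \<open>The ratio of the values of \<open>a\<close> behind and ahead of a shock.\<close>

definition shock_factor :: "real \<Rightarrow> real" where
  "shock_factor \<zeta> = ((\<gamma> - 1 + 2 * \<zeta>) / (\<gamma> + 1))\<^sup>2 * (shock_zeta \<zeta> / \<zeta>) powr (2 / (\<gamma> + 1))"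

definition shock_state :: "flow_state \<Rightarrow> flow_state" where
  "shock_state l = (let q = (\<gamma> - 1 + 2 * zeta l) / (\<gamma> + 1) in
     \<lparr>rho = rho l / q, vel = vel l * q,
      pres = rho l / q * (vel l * q)\<^sup>2 * shock_zeta (zeta l) / \<gamma>, elec = elec l\<rparr>)"

lemma zed_eq_zeta: "zed s = zeta s powr (1 / (\<gamma> + 1))"
  by (simp add: zed_def zeta_def)

lemma zeta_pos: "positive_state s \<Longrightarrow> 0 < zeta s"
  using gamma_gt_1 by (simp add: zeta_def positive_state_def)

lemma zeta_eq_zed: "positive_state s \<Longrightarrow> zeta s = zed s powr (\<gamma> + 1)"
  using zeta_pos[of s] gamma_gt_1 by (simp add: zed_eq_zeta powr_powr)

lemma pres_zeta: "positive_state s \<Longrightarrow> pres s = rho s * (vel s)\<^sup>2 * zeta s / \<gamma>"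
  using gamma_gt_1 by (simp add: zeta_def positive_state_def)

lemma bernoulli_zeta:
  assumes "positive_state s"
  shows "k * bernoulli \<gamma> s = (vel s)\<^sup>2 * ((\<gamma> - 1 + 2 * zeta s) / (\<gamma> + 1))"
proof -
  have "\<gamma> * pres s / ((\<gamma> - 1) * rho s) = (vel s)\<^sup>2 * zeta s / (\<gamma> - 1)"
    using assms by (simp add: zeta_def positive_state_def)
  then have "bernoulli \<gamma> s = (vel s)\<^sup>2 * (1 / 2 + zeta s / (\<gamma> - 1))"
    by (simp add: bernoulli_def distrib_left)
  also have "1 / 2 + zeta s / (\<gamma> - 1) = (\<gamma> - 1 + 2 * zeta s) / (2 * (\<gamma> - 1))"
    using gamma_gt_1 by (simp add: field_simps)
  finally show ?thesis
    using gamma_gt_1 by (simp add: k_def)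
qed

lemma mach_zeta:
  assumes "positive_state s"
  shows "mach \<gamma> s < 1 \<longleftrightarrow> 1 < zeta s" "1 < mach \<gamma> s \<longleftrightarrow> zeta s < 1"
proof -
  have s: "0 < rho s" "0 < vel s" "0 < pres s" using assms by (auto simp: positive_state_def)
  note st = gas_state_complete[OF zero_less_one s]
  have J: "0 < 1 * rho s * vel s" using s by simp
  have "zeta s = zed s powr (\<gamma> + 1)" by (rule zeta_eq_zed[OF assms])
  then have "1 < zeta s \<longleftrightarrow> 1 < zed s" "zeta s < 1 \<longleftrightarrow> zed s < 1"
    using one_less_powr_iff[of "\<gamma> + 1" "zed s"] powr_less_one_iff[of "\<gamma> + 1" "zed s"] st(2) gamma_gt_1
    by auto
  then show "mach \<gamma> s < 1 \<longleftrightarrow> 1 < zeta s" "1 < mach \<gamma> s \<longleftrightarrow> zeta s < 1"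
    using mach_gas_state_iff[OF J st(3) zero_less_one st(2), of "elec s"]
    unfolding st(1)[symmetric] by auto
qed

text \<open>At given flux and Bernoulli value the momentum flux depends on the velocity through
  \<open>u + k B / u\<close>, which takes the same value at \<open>u\<close> and at \<open>k B / u\<close>.\<close>

lemma momentum_flux_eq:
  assumes "positive_state s"
  shows "rho s * (vel s)\<^sup>2 + pres s
    = (\<gamma> + 1) / (2 * \<gamma>) * (rho s * vel s * (vel s + k * bernoulli \<gamma> s / vel s))"
proof -
  have "vel s * (vel s + (vel s)\<^sup>2 * q / vel s) = (vel s)\<^sup>2 * (1 + q)" for q
    using assms by (simp add: positive_state_def power2_eq_square distrib_left)
  then have "vel s * (vel s + k * bernoulli \<gamma> s / vel s) = (vel s)\<^sup>2 * (1 + (\<gamma> - 1 + 2 * zeta s) / (\<gamma> + 1))"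
    unfolding bernoulli_zeta[OF assms] .
  also have "1 + (\<gamma> - 1 + 2 * zeta s) / (\<gamma> + 1) = (2 * \<gamma> + 2 * zeta s) / (\<gamma> + 1)"
    using gamma_gt_1 by (simp add: field_simps)
  also have "\<dots> = 2 * \<gamma> / (\<gamma> + 1) * (1 + zeta s / \<gamma>)"
    using gamma_gt_1 by (simp add: distrib_left add_divide_distrib)
  finally have "(\<gamma> + 1) / (2 * \<gamma>) * (vel s * (vel s + k * bernoulli \<gamma> s / vel s))
      = (vel s)\<^sup>2 * (1 + zeta s / \<gamma>)"
    using gamma_gt_1 by simp
  then have "(\<gamma> + 1) / (2 * \<gamma>) * (rho s * vel s * (vel s + k * bernoulli \<gamma> s / vel s))
      = rho s * ((vel s)\<^sup>2 * (1 + zeta s / \<gamma>))"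
    by (simp add: mult_ac)
  then show ?thesis
    using pres_zeta[OF assms] by (simp add: algebra_simps)
qed

text \<open>Prandtl's relation: the velocities on the two sides multiply to \<open>k B\<close>, the squared
  velocity of a sonic state with the same Bernoulli value. The other solution, equal
  velocities, is excluded since it would entail equal Mach numbers.\<close>

lemma rankine_hugoniot_iff_prandtl:
  assumes l: "positive_state l" "zeta l < 1" and r: "positive_state r" "1 < zeta r"
  shows "rankine_hugoniot \<gamma> l r \<longleftrightarrow>
    rho l * vel l = rho r * vel r \<and> bernoulli \<gamma> l = bernoulli \<gamma> r \<and> elec l = elec r \<and>
    vel l * vel r = k * bernoulli \<gamma> l"
proof -
  have "rho l * (vel l)\<^sup>2 + pres l = rho r * (vel r)\<^sup>2 + pres r \<longleftrightarrow>
      vel l * vel r = k * bernoulli \<gamma> l"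
    if flux: "rho l * vel l = rho r * vel r" and B: "bernoulli \<gamma> l = bernoulli \<gamma> r"
  proof -
    define K where "K = k * bernoulli \<gamma> l"
    have pos: "0 < vel l" "0 < vel r" "0 < rho r"
      using l r by (auto simp: positive_state_def)
    have "vel l \<noteq> vel r"
    proof
      assume eq: "vel l = vel r"
      have "(vel l)\<^sup>2 * ((\<gamma> - 1 + 2 * zeta l) / (\<gamma> + 1)) = (vel l)\<^sup>2 * ((\<gamma> - 1 + 2 * zeta r) / (\<gamma> + 1))"
        using bernoulli_zeta[OF l(1)] bernoulli_zeta[OF r(1)] unfolding B eq by (rule trans[OF sym])
      then show False using pos l r gamma_gt_1 by simp
    qed
    have "rho l * (vel l)\<^sup>2 + pres l = rho r * (vel r)\<^sup>2 + pres r \<longleftrightarrow>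
        vel l + K / vel l = vel r + K / vel r"
      unfolding momentum_flux_eq[OF l(1)] momentum_flux_eq[OF r(1)] flux B K_def
      using pos gamma_gt_1 by simp
    also have "\<dots> \<longleftrightarrow> (vel l - vel r) * (vel l * vel r - K) = 0"
      using pos by (simp add: field_simps)
    also have "\<dots> \<longleftrightarrow> vel l * vel r = K" using \<open>vel l \<noteq> vel r\<close> by simp
    finally show ?thesis by (simp add: K_def)
  qed
  then show ?thesis unfolding rankine_hugoniot_def by blast
qed

lemma shock_zeta_gt_1: "0 < \<zeta> \<Longrightarrow> \<zeta> < 1 \<Longrightarrow> 1 < shock_zeta \<zeta>"
  using gamma_gt_1 mult_strict_left_mono[of \<zeta> 1 "\<gamma> + 1"]
  by (simp add: shock_zeta_def less_divide_eq algebra_simps)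

lemma shock_zeta_conjugate:
  assumes "0 < \<zeta>"
  shows "\<gamma> - 1 + 2 * shock_zeta \<zeta> = (\<gamma> + 1)\<^sup>2 / (\<gamma> - 1 + 2 * \<zeta>)"
proof -
  have "0 < \<gamma> - 1 + 2 * \<zeta>" using assms gamma_gt_1 by simp
  then show ?thesis by (simp add: shock_zeta_def field_simps power2_eq_square)
qed

lemma shock_state:
  assumes l: "positive_state l" "zeta l < 1"
  shows "positive_state (shock_state l)" "zeta (shock_state l) = shock_zeta (zeta l)"
    "1 < zeta (shock_state l)" "rankine_hugoniot \<gamma> l (shock_state l)"
    "rho l < rho (shock_state l)"
    "invariant x (shock_state l) = invariant x l * shock_factor (zeta l)"
proof -
  (* The ratio of the velocities behind and ahead of the shock. *)
  define q where "q = (\<gamma> - 1 + 2 * zeta l) / (\<gamma> + 1)"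
  define Z where "Z = shock_zeta (zeta l)"
  have \<zeta>: "0 < zeta l" by (rule zeta_pos[OF l(1)])
  have q: "0 < q" "q < 1" using \<zeta> l(2) gamma_gt_1 by (auto simp: q_def)
  have Z: "1 < Z" unfolding Z_def by (rule shock_zeta_gt_1[OF \<zeta> l(2)])
  have comp: "rho (shock_state l) = rho l / q" "vel (shock_state l) = vel l * q"
    "pres (shock_state l) = rho l / q * (vel l * q)\<^sup>2 * Z / \<gamma>" "elec (shock_state l) = elec l"
    by (simp_all add: shock_state_def Let_def q_def Z_def)
  show pos: "positive_state (shock_state l)"
    using l(1) q Z gamma_gt_1 by (simp add: positive_state_def comp)
  show z: "zeta (shock_state l) = shock_zeta (zeta l)"
    unfolding zeta_def[of "shock_state l"] comp Z_def[symmetric]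
    using l(1) q gamma_gt_1 by (simp add: positive_state_def)
  then show z1: "1 < zeta (shock_state l)" using Z by (simp add: Z_def)
  have qz: "(\<gamma> - 1 + 2 * Z) / (\<gamma> + 1) = 1 / q"
    using shock_zeta_conjugate[OF \<zeta>] gamma_gt_1 \<zeta>
    by (simp add: Z_def q_def power2_eq_square)
  have "k * bernoulli \<gamma> (shock_state l) = (vel l * q)\<^sup>2 * (1 / q)"
    unfolding bernoulli_zeta[OF pos] z Z_def[symmetric] qz comp ..
  also have "\<dots> = (vel l)\<^sup>2 * q" using q by (simp add: power2_eq_square)
  also have "\<dots> = k * bernoulli \<gamma> l"
    unfolding bernoulli_zeta[OF l(1)] q_def ..
  finally have "bernoulli \<gamma> l = bernoulli \<gamma> (shock_state l)" using k_pos by simp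
  moreover have "vel l * vel (shock_state l) = k * bernoulli \<gamma> l"
    unfolding bernoulli_zeta[OF l(1)] q_def[symmetric] comp by (simp add: power2_eq_square)
  ultimately show "rankine_hugoniot \<gamma> l (shock_state l)"
    using rankine_hugoniot_iff_prandtl[OF l pos z1] q by (simp add: comp)
  show "rho l < rho (shock_state l)"
    using l(1) q by (simp add: comp positive_state_def less_divide_eq)
  have "(zed s)\<^sup>2 = zeta s powr (2 / (\<gamma> + 1))" if "positive_state s" for s
    using zeta_pos[OF that] by (simp add: zed_eq_zeta powr_power)
  then have "invariant x (shock_state l) = (vel l * q)\<^sup>2 * Z powr (2 / (\<gamma> + 1)) * x powr k"
    and "invariant x l = (vel l)\<^sup>2 * zeta l powr (2 / (\<gamma> + 1)) * x powr k"
    using pos l(1) z by (simp_all add: invariant_def power_mult_distrib comp Z_def)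
  moreover have "shock_factor (zeta l) = q\<^sup>2 * (Z powr (2 / (\<gamma> + 1)) / zeta l powr (2 / (\<gamma> + 1)))"
    using \<zeta> Z by (simp add: shock_factor_def q_def Z_def powr_divide)
  ultimately show "invariant x (shock_state l) = invariant x l * shock_factor (zeta l)"
    using \<zeta> by (simp add: power_mult_distrib)
qed

lemma shock_state_unique:
  assumes l: "positive_state l" "zeta l < 1" and r: "positive_state r" "1 < zeta r"
    and "rankine_hugoniot \<gamma> l r"
  shows "r = shock_state l"
proof -
  let ?s = "shock_state l"
  note s = shock_state[OF l]
  have pr: "rho l * vel l = rho r * vel r" "bernoulli \<gamma> l = bernoulli \<gamma> r" "elec l = elec r"
    "vel l * vel r = k * bernoulli \<gamma> l"
    using assms(5) rankine_hugoniot_iff_prandtl[OF l r] by auto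
  have ps: "rho l * vel l = rho ?s * vel ?s" "bernoulli \<gamma> l = bernoulli \<gamma> ?s" "elec l = elec ?s"
    "vel l * vel ?s = k * bernoulli \<gamma> l"
    using s(4) rankine_hugoniot_iff_prandtl[OF l s(1,3)] by auto
  have pos: "0 < vel l" "0 < vel r" "0 < vel ?s" "0 < rho r"
    using l(1) r(1) s(1) by (auto simp: positive_state_def)
  have v: "vel r = vel ?s" using pr(4) ps(4) pos by (metis less_irrefl mult_left_cancel)
  have \<rho>: "rho r = rho ?s" using pr(1) ps(1) pos unfolding v by auto
  have "(vel r)\<^sup>2 * ((\<gamma> - 1 + 2 * zeta r) / (\<gamma> + 1)) = (vel r)\<^sup>2 * ((\<gamma> - 1 + 2 * zeta ?s) / (\<gamma> + 1))"
    using bernoulli_zeta[OF r(1)] bernoulli_zeta[OF s(1)] pr(2) ps(2) v by simp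
  then have "zeta r = zeta ?s" using pos gamma_gt_1 by simp
  then have "pres r = pres ?s"
    using pres_zeta[OF r(1)] pres_zeta[OF s(1)] v \<rho> by simp
  then show ?thesis using v \<rho> pr(3) ps(3) by (intro flow_state.equality) auto
qed

lemma shock_factor_pos: "0 < \<zeta> \<Longrightarrow> \<zeta> < 1 \<Longrightarrow> 0 < shock_factor \<zeta>"
  using shock_zeta_gt_1[of \<zeta>] gamma_gt_1 by (simp add: shock_factor_def)

text \<open>A stronger shock produces more entropy: the logarithmic derivative is \<open>- (1 - \<zeta>)\<^sup>2\<close>
  up to a positive factor.\<close>

lemma shock_factor_decreasing:
  assumes \<zeta>: "0 < \<zeta>" "\<zeta> < 1"
  obtains D where "D < 0" "(shock_factor has_real_derivative D) (at \<zeta>)"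
proof -
  define Y where "Y \<zeta> = \<gamma> - 1 + 2 * \<zeta>" for \<zeta>
  define N where "N \<zeta> = 2 * \<gamma> - (\<gamma> - 1) * \<zeta>" for \<zeta>
  have pos: "0 < Y \<zeta>" "0 < N \<zeta>" if "0 < \<zeta>" "\<zeta> < 1" for \<zeta>
  proof -
    show "0 < Y \<zeta>" using that gamma_gt_1 by (simp add: Y_def)
    have "N \<zeta> = \<gamma> + 1 + (\<gamma> - 1) * (1 - \<zeta>)" by (simp add: N_def algebra_simps)
    moreover have "0 \<le> (\<gamma> - 1) * (1 - \<zeta>)" using that gamma_gt_1 by simp
    ultimately show "0 < N \<zeta>" using gamma_gt_1 by linarith
  qed
  define P where "P \<zeta> = 2 * (ln (Y \<zeta>) - ln (\<gamma> + 1)) + 2 / (\<gamma> + 1) * (ln (N \<zeta>) - ln (Y \<zeta>) - ln \<zeta>)" for \<zeta>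
  have eq: "shock_factor \<zeta> = exp (P \<zeta>)" if "0 < \<zeta>" "\<zeta> < 1" for \<zeta>
  proof -
    have "ln (shock_factor \<zeta>) = P \<zeta>"
      using pos[OF that] that gamma_gt_1
      by (simp add: shock_factor_def shock_zeta_def P_def Y_def[symmetric] N_def[symmetric]
          ln_mult ln_powr ln_div ln_realpow)
    then show ?thesis using shock_factor_pos[OF that] by (metis exp_ln)
  qed
  define E where "E = 4 / Y \<zeta> + 2 / (\<gamma> + 1) * (- (\<gamma> - 1) / N \<zeta> - 2 / Y \<zeta> - 1 / \<zeta>)"
  have dY: "(Y has_real_derivative 2) (at \<zeta>)" and dN: "(N has_real_derivative - (\<gamma> - 1)) (at \<zeta>)"
    unfolding Y_def[abs_def] N_def[abs_def] by (auto intro!: derivative_eq_intros)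
  have "(P has_real_derivative E) (at \<zeta>)"
    unfolding P_def[abs_def] E_def using pos[OF \<zeta>] \<zeta>
    by (auto intro!: derivative_eq_intros dY dN simp: divide_inverse)
  then have "((\<lambda>\<zeta>. exp (P \<zeta>)) has_real_derivative exp (P \<zeta>) * E) (at \<zeta>)"
    by (rule DERIV_fun_exp)
  then have "(shock_factor has_real_derivative exp (P \<zeta>) * E) (at \<zeta>)"
    by (rule has_field_derivative_transform_within_open[of _ _ _ "{0<..<1}"]) (use \<zeta> eq in auto)
  moreover have "E < 0"
  proof -
    have "E * (Y \<zeta> * N \<zeta> * \<zeta> * (\<gamma> + 1))
      = 4 * (N \<zeta> * \<zeta> * (\<gamma> + 1)) + 2 * (- (\<gamma> - 1) * (Y \<zeta> * \<zeta>) - 2 * (N \<zeta> * \<zeta>) - Y \<zeta> * N \<zeta>)"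
    proof -
      have "(4 / y + 2 / p * (- m / n - 2 / y - 1 / z)) * (y * n * z * p)
          = 4 * (n * z * p) + 2 * (- m * (y * z) - 2 * (n * z) - y * n)"
        if "y \<noteq> 0" "n \<noteq> 0" "z \<noteq> 0" "p \<noteq> 0" for y n z p m :: real
        using that by (simp add: field_simps)
      from this[of "Y \<zeta>" "N \<zeta>" \<zeta> "\<gamma> + 1" "\<gamma> - 1"] show ?thesis
        unfolding E_def using pos[OF \<zeta>] \<zeta> gamma_gt_1 by linarith
    qed
    also have "\<dots> = - (4 * \<gamma> * (\<gamma> - 1) * (1 - \<zeta>)\<^sup>2)"
      by (simp add: Y_def N_def power2_eq_square algebra_simps)
    also have "\<dots> < 0" using \<zeta> gamma_gt_1 by simp
    finally have "E * (Y \<zeta> * N \<zeta> * \<zeta> * (\<gamma> + 1)) < 0" .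
    moreover have "0 < Y \<zeta> * N \<zeta> * \<zeta> * (\<gamma> + 1)" using pos[OF \<zeta>] \<zeta> gamma_gt_1 by simp
    ultimately show ?thesis
      using mult_nonneg_nonneg[of E "Y \<zeta> * N \<zeta> * \<zeta> * (\<gamma> + 1)"] by linarith
  qed
  ultimately show thesis by (intro that[of "exp (P \<zeta>) * E"]) (auto simp: mult_less_0_iff)
qed

lemma zeta_gas_state:
  assumes "0 < J" "0 < a" "0 < x" "0 < z"
  shows "zeta (gas_state J a x z e) = z powr (\<gamma> + 1)"
  using zeta_eq_zed[of "gas_state J a x z e"] gas_state_pos[OF assms] inj_gas_state_zed[OF assms]
  by (simp add: positive_state_def)

end

section \<open>Dependence of the density on the Bernoulli value and on the entropy\<close>

context polytropic_gas
begin

text \<open>The partial derivatives of the density source. Their signs decide the theorem: on the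
  subsonic branch the density increases with \<open>B\<close>, and at given \<open>B\<close> it decreases with the
  entropy.\<close>

definition source_dB :: "real \<Rightarrow> real \<Rightarrow> (real \<Rightarrow> real) \<Rightarrow> real \<Rightarrow> real \<Rightarrow> real" where
  "source_dB J a h' x B = J * x powr (k / 2) / sqrt a * (h' (B * x powr k / a) * (x powr k / a))"

definition source_da ::
  "real \<Rightarrow> real \<Rightarrow> (real \<Rightarrow> real) \<Rightarrow> (real \<Rightarrow> real) \<Rightarrow> real \<Rightarrow> real \<Rightarrow> real" where
  "source_da J a h h' x B = - (J * x powr (k / 2) / sqrt a *
     (h (B * x powr k / a) / (2 * a) + h' (B * x powr k / a) * (B * x powr k / a / a)))"

lemma density_source_deriv_B:
  assumes "\<And>w. (h has_real_derivative h' w) (at w)"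
  shows "((\<lambda>B. density_source J a h x B) has_real_derivative source_dB J a h' x B) (at B)"
proof -
  have "((\<lambda>B. B * x powr k / a) has_real_derivative x powr k / a) (at B)"
    using DERIV_cmult_right[OF DERIV_ident, of "x powr k / a"] by simp
  from DERIV_cmult[OF DERIV_chain2[OF assms this], of "J * x powr (k / 2) / sqrt a"]
  show ?thesis by (simp add: density_source_def source_dB_def)
qed

lemma density_source_deriv_a:
  assumes h: "\<And>w. (h has_real_derivative h' w) (at w)" and a: "0 < a"
  shows "((\<lambda>a. density_source J a h x B) has_real_derivative source_da J a h h' x B) (at a)"
proof -
  have 1: "((\<lambda>a. J * x powr (k / 2) / sqrt a) has_real_derivative
      - (J * x powr (k / 2) / sqrt a / (2 * a))) (at a)"
  proof -
    have "((\<lambda>a. J * x powr (k / 2) / sqrt a) has_real_derivative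
        - (J * x powr (k / 2) * (inverse (sqrt a) / 2)) / (sqrt a * sqrt a)) (at a)"
      using DERIV_divide[OF DERIV_const DERIV_real_sqrt[OF a], of "J * x powr (k / 2)"] a by simp
    moreover have "- (p * (inverse (sqrt a) / 2)) / (sqrt a * sqrt a) = - (p / sqrt a / (2 * a))" for p
      using a by (simp add: inverse_eq_divide)
    ultimately show ?thesis by simp
  qed
  have 2: "((\<lambda>a. B * x powr k / a) has_real_derivative - (B * x powr k / a / a)) (at a)"
    using DERIV_divide[OF DERIV_const DERIV_ident, of a "B * x powr k"] a by simp
  from DERIV_mult[OF 1 DERIV_chain2[OF h 2]]
  show ?thesis
    unfolding density_source_def source_da_def
    by (rule DERIV_cong) (simp add: algebra_simps)
qed

lemma source_derivs_cont:
  assumes "continuous_on UNIV h" "continuous_on UNIV h'" "T < r0"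
  shows "continuous_on ({0..T} \<times> UNIV \<times> {0<..}) (\<lambda>(t, B, a). source_dB J a h' (r0 - t) B)"
    and "continuous_on ({0..T} \<times> UNIV \<times> {0<..}) (\<lambda>(t, B, a). source_da J a h h' (r0 - t) B)"
proof -
  let ?S = "{0..T} \<times> (UNIV :: real set) \<times> {0<..}"
  have p: "continuous_on ?S (\<lambda>y. (r0 - fst y) powr q)" for q
    using assms(3) by (intro continuous_intros) auto
  have s: "continuous_on ?S (\<lambda>y. sqrt (snd (snd y)))" by (intro continuous_intros)
  have w: "continuous_on ?S (\<lambda>y. fst (snd y) * (r0 - fst y) powr k / snd (snd y))"
    by (intro continuous_intros p) auto
  have h: "continuous_on ?S (\<lambda>y. h (fst (snd y) * (r0 - fst y) powr k / snd (snd y)))"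
    "continuous_on ?S (\<lambda>y. h' (fst (snd y) * (r0 - fst y) powr k / snd (snd y)))"
    using continuous_on_compose2[OF assms(1) w] continuous_on_compose2[OF assms(2) w] by auto
  show "continuous_on ?S (\<lambda>(t, B, a). source_dB J a h' (r0 - t) B)"
    "continuous_on ?S (\<lambda>(t, B, a). source_da J a h h' (r0 - t) B)"
    unfolding source_dB_def source_da_def case_prod_beta
    by (intro continuous_intros p s w h; auto)+
qed

lemma source_dB_bound:
  assumes "0 < J" "0 < a" "0 < x" "x \<le> r" "\<And>w. \<bar>h' w\<bar> \<le> L"
  shows "\<bar>source_dB J a h' x B\<bar> \<le> J * r powr (k / 2) / sqrt a * (L * (r powr k / a))"
proof -
  have "0 \<le> L" using assms(5)[of 0] by simp
  have mono: "x powr p \<le> r powr p" if "0 < p" for p using assms that by (intro powr_mono2) auto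
  have "\<bar>source_dB J a h' x B\<bar> = J * x powr (k / 2) / sqrt a * (\<bar>h' (B * x powr k / a)\<bar> * (x powr k / a))"
    using assms by (simp add: source_dB_def abs_mult)
  also have "\<dots> \<le> J * r powr (k / 2) / sqrt a * (L * (r powr k / a))"
    using assms \<open>0 \<le> L\<close> k_pos by (intro mult_mono divide_right_mono mono) auto
  finally show ?thesis .
qed

text \<open>The entropy parameter enters through \<open>a s\<close>, which is known to be differentiable at \<open>s0\<close>
  only; the expansion combines the uniform one in \<open>(B, a)\<close> with that derivative.\<close>

lemma density_source_expansion:
  assumes h: "\<And>w. (h has_real_derivative h' w) (at w)" "continuous_on UNIV h'"
    and "T < r0" and s0: "s0 \<in> {0..T}" and B0: "continuous_on {0..T} B0"
    and a: "0 < a s0" "(a has_real_derivative \<sigma>) (at s0 within {0..T})" and "0 < e"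
  shows "\<exists>d>0. \<forall>t\<in>{0..T}. \<forall>s\<in>{0..T}. \<forall>B. \<bar>s - s0\<bar> < d \<longrightarrow> \<bar>B - B0 t\<bar> < d \<longrightarrow>
    \<bar>density_source J (a s) h (r0 - t) B - density_source J (a s0) h (r0 - t) (B0 t)
      - source_dB J (a s0) h' (r0 - t) (B0 t) * (B - B0 t)
      - (s - s0) * (source_da J (a s0) h h' (r0 - t) (B0 t) * \<sigma>)\<bar> \<le> e * (\<bar>B - B0 t\<bar> + \<bar>s - s0\<bar>)"
proof -
  define da where "da t = source_da J (a s0) h h' (r0 - t) (B0 t)" for t
  define rem where "rem t B \<alpha> = density_source J \<alpha> h (r0 - t) B - density_source J (a s0) h (r0 - t) (B0 t)
      - source_dB J (a s0) h' (r0 - t) (B0 t) * (B - B0 t)" for t B \<alpha>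
  have h_cont: "continuous_on UNIV h" by (rule DERIV_continuous_on[OF h(1)])
  note conts = source_derivs_cont[OF h_cont h(2) \<open>T < r0\<close>, of J]
  have "continuous_on {0..T} (\<lambda>t. da t)"
  proof -
    have "continuous_on {0..T} (\<lambda>t. (t, B0 t, a s0))" by (intro continuous_intros B0)
    from continuous_on_compose2[OF conts(2) this] show ?thesis unfolding da_def using a(1) by force
  qed
  then have "bounded ((\<lambda>t. da t) ` {0..T})"
    by (intro compact_imp_bounded compact_continuous_image) auto
  then obtain R where "\<forall>y\<in>(\<lambda>t. da t) ` {0..T}. norm y \<le> R"
    unfolding bounded_iff by blast
  then have R: "\<bar>da t\<bar> \<le> R" if "t \<in> {0..T}" for t
    using that by auto
  have "0 \<le> R" using R[OF s0] by simp
  define e1 where "e1 = e / 2 / (\<bar>\<sigma>\<bar> + 2)"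
  define e2 where "e2 = min 1 (e / 2 / (R + 1))"
  have e1: "0 < e1" and e2: "0 < e2" using \<open>0 < e\<close> \<open>0 \<le> R\<close> by (auto simp: e1_def e2_def)
  obtain d1 where d1: "0 < d1" and exp1: "\<And>t B \<alpha>. t \<in> {0..T} \<Longrightarrow> \<bar>B - B0 t\<bar> < d1 \<Longrightarrow> \<bar>\<alpha> - a s0\<bar> < d1 \<Longrightarrow>
      \<bar>rem t B \<alpha> - da t * (\<alpha> - a s0)\<bar> \<le> e1 * (\<bar>B - B0 t\<bar> + \<bar>\<alpha> - a s0\<bar>)"
    by (rule uniform_first_order_expansion[where p = 0 and q = T and e = e1 and ?a0.0 = "a s0" and ?x0.0 = B0
          and G = "\<lambda>t B \<alpha>. density_source J \<alpha> h (r0 - t) B"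
          and Gx = "\<lambda>t B \<alpha>. source_dB J \<alpha> h' (r0 - t) B"
          and Ga = "\<lambda>t B \<alpha>. source_da J \<alpha> h h' (r0 - t) B"])
      (use a e1 B0 conts in \<open>auto intro: density_source_deriv_B density_source_deriv_a h
        simp: rem_def da_def\<close>)
  obtain d2 where d2: "0 < d2" and a_lin: "\<And>s. s \<in> {0..T} \<Longrightarrow> \<bar>s - s0\<bar> < d2 \<Longrightarrow>
      \<bar>a s - a s0 - \<sigma> * (s - s0)\<bar> \<le> e2 * \<bar>s - s0\<bar>"
  proof -
    have "\<forall>e>0. \<exists>d>0. \<forall>s\<in>{0..T}. norm (s - s0) < d \<longrightarrow>
        norm (a s - a s0 - \<sigma> * (s - s0)) \<le> e * norm (s - s0)"
      using a(2) unfolding has_field_derivative_def has_derivative_within_alt by simp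
    then obtain d where "0 < d" "\<forall>s\<in>{0..T}. norm (s - s0) < d \<longrightarrow>
        norm (a s - a s0 - \<sigma> * (s - s0)) \<le> e2 * norm (s - s0)" using e2 by meson
    then show ?thesis by (intro that[of d]) auto
  qed
  define d where "d = Min {d1, d2, d1 / (\<bar>\<sigma>\<bar> + 1)}"
  have d: "0 < d" "d \<le> d1" "d \<le> d2" "d \<le> d1 / (\<bar>\<sigma>\<bar> + 1)"
    using d1 d2 by (auto simp: d_def)
  show ?thesis
    unfolding rem_def[symmetric] da_def[symmetric]
  proof (intro exI conjI ballI allI impI)
    show "0 < d" by (rule d)
    fix t s B assume t: "t \<in> {0..T}" and s: "s \<in> {0..T}" "\<bar>s - s0\<bar> < d" and B: "\<bar>B - B0 t\<bar> < d"
    define \<delta> where "\<delta> = \<bar>s - s0\<bar>"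
    have lin: "\<bar>a s - a s0 - \<sigma> * (s - s0)\<bar> \<le> e2 * \<delta>"
      unfolding \<delta>_def using a_lin[OF s(1)] s d by auto
    have "e2 * \<delta> \<le> 1 * \<delta>" by (rule mult_right_mono) (auto simp: e2_def \<delta>_def)
    then have "\<bar>a s - a s0\<bar> \<le> \<delta> + \<bar>\<sigma> * (s - s0)\<bar>" using lin by linarith
    then have a_le: "\<bar>a s - a s0\<bar> \<le> (\<bar>\<sigma>\<bar> + 1) * \<delta>"
      unfolding abs_mult distrib_right \<delta>_def by (simp add: add.commute)
    also have "\<dots> < d1"
    proof -
      have "\<delta> < d1 / (\<bar>\<sigma>\<bar> + 1)" using s(2) d(4) by (simp add: \<delta>_def)
      moreover have "0 < \<bar>\<sigma>\<bar> + 1" by simp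
      ultimately show ?thesis by (simp only: pos_less_divide_eq mult.commute)
    qed
    finally have "\<bar>a s - a s0\<bar> < d1" .
    from exp1[OF t _ this, of B] B d(2)
    have "\<bar>rem t B (a s) - da t * (a s - a s0)\<bar> \<le> e1 * (\<bar>B - B0 t\<bar> + \<bar>a s - a s0\<bar>)"
      by linarith
    also have "\<dots> \<le> e1 * (\<bar>B - B0 t\<bar> + (\<bar>\<sigma>\<bar> + 1) * \<delta>)"
      using e1 a_le by (intro mult_left_mono) auto
    also have "\<dots> \<le> e * \<bar>B - B0 t\<bar> + e / 2 * \<delta>"
    proof -
      have e1_eq: "e1 * (\<bar>\<sigma>\<bar> + 2) = e / 2"
        by (rule nonzero_eq_divide_eq[THEN iffD1, OF _ e1_def]) (use abs_ge_zero[of \<sigma>] in linarith)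
      have "e1 * 1 \<le> e1 * (\<bar>\<sigma>\<bar> + 2)" using e1 by (intro mult_left_mono) auto
      then have "e1 \<le> e" using e1_eq \<open>0 < e\<close> by simp
      moreover have "e1 * (\<bar>\<sigma>\<bar> + 1) \<le> e / 2"
      proof -
        have "e1 * (\<bar>\<sigma>\<bar> + 1) \<le> e1 * (\<bar>\<sigma>\<bar> + 2)" using e1 by (intro mult_left_mono) auto
        also have "\<dots> = e / 2" by (rule e1_eq)
        finally show ?thesis .
      qed
      ultimately show ?thesis
        unfolding distrib_left mult.assoc[symmetric]
        by (intro add_mono mult_right_mono) (auto simp: \<delta>_def)
    qed
    finally have m1: "\<bar>rem t B (a s) - da t * (a s - a s0)\<bar> \<le> e * \<bar>B - B0 t\<bar> + e / 2 * \<delta>" .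
    have "\<bar>da t * (a s - a s0)
        - (s - s0) * (da t * \<sigma>)\<bar>
      = \<bar>da t\<bar> * \<bar>a s - a s0 - \<sigma> * (s - s0)\<bar>"
      by (simp add: algebra_simps flip: abs_mult)
    also have "\<dots> \<le> R * (e2 * \<delta>)" by (intro mult_mono R t lin) (use \<open>0 \<le> R\<close> in auto)
    also have "\<dots> \<le> e / 2 * \<delta>"
    proof -
      have "R * e2 \<le> (R + 1) * (e / 2 / (R + 1))"
        using \<open>0 \<le> R\<close> e2 by (intro mult_mono) (auto simp: e2_def)
      also have "\<dots> = e / 2"
        unfolding times_divide_eq_right[of "R + 1" "e / 2"]
        by (rule nonzero_mult_div_cancel_left) (use \<open>0 \<le> R\<close> in linarith)
      finally show ?thesis unfolding mult.assoc[symmetric] by (rule mult_right_mono) (simp add: \<delta>_def)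
    qed
    finally have m2: "\<bar>da t * (a s - a s0)
        - (s - s0) * (da t * \<sigma>)\<bar> \<le> e / 2 * \<delta>" .
    have "e * \<bar>B - B0 t\<bar> + e / 2 * \<delta> + e / 2 * \<delta> = e * (\<bar>B - B0 t\<bar> + \<bar>s - s0\<bar>)"
      by (simp add: \<delta>_def algebra_simps)
    then show "\<bar>rem t B (a s) - (s - s0) * (da t * \<sigma>)\<bar> \<le> e * (\<bar>B - B0 t\<bar> + \<bar>s - s0\<bar>)"
      using m1 m2 by linarith
  qed
qed

end

section \<open>Flows in a strong field\<close>

text \<open>If the density is bounded, then \<open>B\<close> gains little on a short interval; this keeps a
  solution below the level at which a bounded extension departs from the subsonic branch.\<close>

lemma upper_growth:
  fixes B F f :: "real \<Rightarrow> real"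
  assumes st: "s \<le> t" "t < r0" "0 \<le> Q"
    and B: "\<And>\<tau>. \<tau> \<in> {s..t} \<Longrightarrow> (B has_real_derivative F \<tau> / (r0 - \<tau>)) (at \<tau> within {s..t})"
    and F: "\<And>\<tau>. \<tau> \<in> {s..t} \<Longrightarrow> (F has_real_derivative f \<tau>) (at \<tau> within {s..t})"
    and f: "\<And>\<tau>. \<tau> \<in> {s..t} \<Longrightarrow> f \<tau> \<le> Q"
    and M: "F s + Q * (t - s) \<le> M"
  shows "F t \<le> F s + Q * (t - s)" and "B t \<le> B s + M * (ln (r0 - s) - ln (r0 - t))"
proof -
  have F_le: "F \<tau> \<le> F s + Q * (\<tau> - s)" if \<tau>: "\<tau> \<in> {s..t}" for \<tau>
  proof -
    have sub: "{s..\<tau>} \<subseteq> {s..t}" using \<tau> by auto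
    have "Q * s - F s \<le> Q * \<tau> - F \<tau>"
    proof (rule nondecreasing_if_derivative_nonneg_within[where f = "\<lambda>u. Q * u - F u" and f' = "\<lambda>\<tau>. Q - f \<tau>"])
      show "s \<le> \<tau>" using \<tau> by simp
      fix u assume u: "u \<in> {s..\<tau>}"
      show "((\<lambda>u. Q * u - F u) has_real_derivative Q - f u) (at u within {s..\<tau>})"
        using u sub by (auto intro!: derivative_eq_intros DERIV_subset[OF F])
    next
      fix u assume "s < u" "u < \<tau>"
      then show "0 \<le> Q - f u" using f[of u] \<tau> by simp
    qed
    then show ?thesis by (simp add: algebra_simps)
  qed
  show "F t \<le> F s + Q * (t - s)" using F_le[of t] st by simp
  have "- M * ln (r0 - s) - B s \<le> - M * ln (r0 - t) - B t"
  proof (rule nondecreasing_if_derivative_nonneg_within[OF st(1), where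
        f = "\<lambda>\<tau>. - M * ln (r0 - \<tau>) - B \<tau>" and f' = "\<lambda>\<tau>. (M - F \<tau>) / (r0 - \<tau>)"])
    fix \<tau> assume \<tau>: "\<tau> \<in> {s..t}"
    show "((\<lambda>\<tau>. - M * ln (r0 - \<tau>) - B \<tau>) has_real_derivative (M - F \<tau>) / (r0 - \<tau>)) (at \<tau> within {s..t})"
      using \<tau> st by (auto intro!: derivative_eq_intros B simp: diff_divide_distrib)
  next
    fix \<tau> assume \<tau>: "s < \<tau>" "\<tau> < t"
    have "Q * (\<tau> - s) \<le> Q * (t - s)" using \<tau> st by (intro mult_left_mono) auto
    then have "F \<tau> \<le> M" using F_le[of \<tau>] \<tau> M by simp
    then show "0 \<le> (M - F \<tau>) / (r0 - \<tau>)" using \<tau> st by simp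
  qed
  then show "B t \<le> B s + M * (ln (r0 - s) - ln (r0 - t))"
    unfolding right_diff_distrib[of M] by linarith
qed

text \<open>Supersonic entrance data, given by flux, entropy parameter, Bernoulli value and
  \<open>F_in = r0 E0\<close>, on an interval on which the field dominates. The constant \<open>C\<close> bounds the
  loss of \<open>F\<close> to the background charge.\<close>

locale strong_field = polytropic_gas +
  fixes r0 T J C a_in B_in F_in :: real and b :: "real \<Rightarrow> real"
  assumes T: "0 < T" "T < r0" and J: "0 < J" and a_in: "0 < a_in"
    and b_cont: "continuous_on {0..T} b"
    and b_bounds: "\<And>t. t \<in> {0..T} \<Longrightarrow> 0 \<le> b t" "\<And>t. t \<in> {0..T} \<Longrightarrow> (r0 - t) * b t \<le> C"
    and entry: "1 / k < B_in * r0 powr k / a_in"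
    and short: "k * (ln r0 - ln (r0 - T)) < 1"
    and strong: "k * (B_in + (ln r0 - ln (r0 - T)) * (C * T))
      < (1 - k * (ln r0 - ln (r0 - T))) * (F_in - C * T)"
begin

text \<open>The value of \<open>a\<close> behind a shock at the entrance, the smallest one behind any shock.\<close>

definition a_first :: real where
  "a_first = a_in * shock_factor (supersonic (B_in * r0 powr k / a_in) powr (\<gamma> + 1))"

text \<open>Behind a shock \<open>w\<close> stays below this level as long as \<open>B\<close> has gained at most 1.\<close>

definition w_max :: real where "w_max = (B_in + 1) * r0 powr k / a_first"

text \<open>A bound for the product of radius and density, ahead of the shock and, for an extension
  of the subsonic branch with values up to \<open>subsonic (w_max + 1)\<close>, also behind it.\<close>

definition source_max :: real where
  "source_max = J * r0 powr (k / 2) * (1 / sqrt a_in + subsonic (w_max + 1) / sqrt a_first)"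

lemma r0: "0 < r0" using T by simp

lemma C: "0 \<le> C"
proof -
  have "0 \<le> (r0 - 0) * b 0" using b_bounds(1)[of 0] T by simp
  also have "\<dots> \<le> C" using b_bounds(2)[of 0] T by simp
  finally show ?thesis .
qed

lemma Lambda_pos: "0 < ln r0 - ln (r0 - T)" using T by simp

lemma B_in: "0 < B_in"
proof (rule ccontr)
  assume "\<not> 0 < B_in"
  then have "B_in * r0 powr k / a_in \<le> 0" using a_in by (simp add: mult_le_0_iff divide_le_0_iff)
  moreover have "0 < 1 / k" using k_pos by simp
  ultimately show False using entry by linarith
qed

lemma F_in: "0 \<le> F_in"
proof -
  have "0 \<le> k * (B_in + (ln r0 - ln (r0 - T)) * (C * T))"
    using k_pos B_in Lambda_pos C T by simp
  then have "0 < (1 - k * (ln r0 - ln (r0 - T))) * (F_in - C * T)" using strong by linarith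
  then have "0 < F_in - C * T" using short by (simp add: zero_less_mult_iff)
  moreover have "0 \<le> C * T" using C T by simp
  ultimately show ?thesis by linarith
qed

lemma a_first: "0 < a_first"
proof -
  have "supersonic (B_in * r0 powr k / a_in) powr (\<gamma> + 1) < 1"
    using supersonic[OF entry] powr_less_one_iff gamma_gt_1 by simp
  then show ?thesis
    using supersonic[OF entry] shock_factor_pos a_in by (simp add: a_first_def)
qed

lemma density_source_pos:
  assumes "branch h" "extends_branch h D L hh hh'" "0 < a" "0 < x"
  shows "0 \<le> density_source J a hh x B"
  using extends_branch_pos[OF assms(2,1)] J assms(3,4)
  by (simp add: density_source_def less_imp_le)

text \<open>A positive density bounds the loss of \<open>F\<close> by \<open>C\<close>. Hence \<open>F > k B\<close>, and the flow moves
  away from the sonic state. This holds for an extended branch as well, which shows afterwards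
  that the solution never leaves the genuine part of the extension on the sonic side.\<close>

lemma accelerating:
  assumes h: "branch h" and ext: "extends_branch h D L hh hh'" and a: "0 < a"
    and s: "0 \<le> s" and t: "t \<in> {s..T}"
    and red: "reduced_system r0 b J a hh {s..T} B F"
    and init: "growth_controlled r0 C B_in F_in s (B s) (F s)"
  shows "growth_controlled r0 C B_in F_in t (B t) (F t)" and "k * B t < F t"
    and "B s * (r0 - s) powr k / a \<le> B t * (r0 - t) powr k / a"
proof -
  have gc: "growth_controlled r0 C B_in F_in t (B t) (F t)" if t: "t \<in> {s..T}" for t
  proof (rule growth_controlled_propagates[where s = s and B = B and F = F, OF init])
    fix \<tau> assume \<tau>: "\<tau> \<in> {s..t}"
    have sub: "{s..t} \<subseteq> {s..T}" using t by auto
    show "(B has_real_derivative F \<tau> / (r0 - \<tau>)) (at \<tau> within {s..t})"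
      "(F has_real_derivative density_source J a hh (r0 - \<tau>) (B \<tau>) - (r0 - \<tau>) * b \<tau>) (at \<tau> within {s..t})"
      using reduced_system_subset[OF red sub] \<tau> by (auto simp: reduced_system_def)
    show "- C \<le> density_source J a hh (r0 - \<tau>) (B \<tau>) - (r0 - \<tau>) * b \<tau>"
      using density_source_pos[OF h ext a, of "r0 - \<tau>" "B \<tau>"] b_bounds(2)[of \<tau>] \<tau> t T s by simp
  qed (use s t T C F_in in auto)
  show "growth_controlled r0 C B_in F_in t (B t) (F t)" by (rule gc[OF t])
  have dom: "k * B t < F t" if t: "t \<in> {s..T}" for t
    by (rule growth_controlled_dominates[OF gc[OF t] _ _ T(2) C F_in refl short strong])
      (use s t in auto)
  show "k * B t < F t" by (rule dom[OF t])
  have sub: "{s..t} \<subseteq> {s..T}" using t by auto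
  show "B s * (r0 - s) powr k / a \<le> B t * (r0 - t) powr k / a"
  proof (rule nondecreasing_if_derivative_nonneg_within[where f = "\<lambda>t. B t * (r0 - t) powr k / a" and
        f' = "\<lambda>t. (r0 - t) powr (k - 1) * (F t - k * B t) / a"])
    fix \<tau> assume \<tau>: "\<tau> \<in> {s..t}"
    show "((\<lambda>t. B t * (r0 - t) powr k / a) has_real_derivative
        (r0 - \<tau>) powr (k - 1) * (F \<tau> - k * B \<tau>) / a) (at \<tau> within {s..t})"
      using reduced_system_subset[OF red sub] \<tau> t T
      by (intro scaled_bernoulli_derivative) (auto simp: reduced_system_def)
  next
    fix \<tau> assume "s < \<tau>" "\<tau> < t"
    then have "k * B \<tau> < F \<tau>" using t by (intro dom) auto
    then show "0 \<le> (r0 - \<tau>) powr (k - 1) * (F \<tau> - k * B \<tau>) / a" using a by simp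
  qed (use t in auto)
qed

lemma upstream_exists:
  obtains B F where "reduced_system r0 b J a_in supersonic {0..T} B F" "B 0 = B_in" "F 0 = F_in"
    "\<And>t. t \<in> {0..T} \<Longrightarrow> growth_controlled r0 C B_in F_in t (B t) (F t)"
    "\<And>t. t \<in> {0..T} \<Longrightarrow> B_in * r0 powr k / a_in \<le> B t * (r0 - t) powr k / a_in"
proof -
  obtain L hh hh' where ext: "extends_branch supersonic {B_in * r0 powr k / a_in..} L hh hh'"
    using supersonic_extension[OF entry] .
  obtain B F where red: "reduced_system r0 b J a_in hh {0..T} B F" and init: "B 0 = B_in" "F 0 = F_in"
    by (rule reduced_system_exists[OF _ T(2) J a_in b_cont ext, of 0]) (use T in auto)
  have gc0: "growth_controlled r0 C B_in F_in 0 (B 0) (F 0)"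
    using init by (simp add: growth_controlled_def)
  note acc = accelerating[OF branch_supersonic ext a_in order_refl _ red gc0]
  have w: "B_in * r0 powr k / a_in \<le> B t * (r0 - t) powr k / a_in" if "t \<in> {0..T}" for t
    using acc(3)[OF that] init by simp
  have "reduced_system r0 b J a_in supersonic {0..T} B F"
    by (rule reduced_system_cong[OF red]) (use extends_branchD(5)[OF ext] w in simp)
  then show thesis by (rule that[OF _ init acc(1) w])
qed

end

text \<open>The flow ahead of the shock is the same for all shock positions. The state behind a
  shock at \<open>t\<close> becomes a function of \<open>t\<close>.\<close>

locale upstream_flow = strong_field +
  fixes B F :: "real \<Rightarrow> real"
  assumes up: "reduced_system r0 b J a_in supersonic {0..T} B F"
    and up_init: "B 0 = B_in" "F 0 = F_in"
    and up_growth: "\<And>t. t \<in> {0..T} \<Longrightarrow> growth_controlled r0 C B_in F_in t (B t) (F t)"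
    and up_range: "\<And>t. t \<in> {0..T} \<Longrightarrow> B_in * r0 powr k / a_in \<le> B t * (r0 - t) powr k / a_in"
begin

definition w_up :: "real \<Rightarrow> real" where "w_up t = B t * (r0 - t) powr k / a_in"

definition U :: "real \<Rightarrow> flow_state" where
  "U t = gas_state J a_in (r0 - t) (supersonic (w_up t)) (F t / (r0 - t))"

definition a_down :: "real \<Rightarrow> real" where
  "a_down t = a_in * shock_factor (supersonic (w_up t) powr (\<gamma> + 1))"

definition w_down :: "real \<Rightarrow> real" where "w_down t = B t * (r0 - t) powr k / a_down t"

lemma x_pos: "t \<in> {0..T} \<Longrightarrow> 0 < r0 - t" using T by simp

lemma B_deriv: "t \<in> {0..T} \<Longrightarrow> (B has_real_derivative F t / (r0 - t)) (at t within {0..T})"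
  using up by (simp add: reduced_system_def)

lemma w_up: "t \<in> {0..T} \<Longrightarrow> 1 / k < w_up t"
  using entry up_range[of t] by (simp add: w_up_def)

lemma z_up:
  assumes "t \<in> {0..T}"
  shows "0 < supersonic (w_up t)" "supersonic (w_up t) < 1" "g (supersonic (w_up t)) = w_up t"
    "0 < supersonic (w_up t) powr (\<gamma> + 1)" "supersonic (w_up t) powr (\<gamma> + 1) < 1"
  using supersonic[OF w_up[OF assms]] powr_less_one_iff[of "\<gamma> + 1" "supersonic (w_up t)"] gamma_gt_1
  by auto

lemma U:
  assumes "t \<in> {0..T}"
  shows "positive_state (U t)" "zeta (U t) = supersonic (w_up t) powr (\<gamma> + 1)" "zeta (U t) < 1"
    "1 < mach \<gamma> (U t)" "bernoulli \<gamma> (U t) = B t" "elec (U t) = F t / (r0 - t)"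
    "(r0 - t) * rho (U t) * vel (U t) = J" "invariant (r0 - t) (U t) = a_in"
    "(r0 - t) * rho (U t) = density_source J a_in supersonic (r0 - t) (B t)"
proof -
  note args = J a_in x_pos[OF assms] z_up(1)[OF assms]
  show "positive_state (U t)" using gas_state_pos[OF args] by (simp add: U_def positive_state_def)
  show z: "zeta (U t) = supersonic (w_up t) powr (\<gamma> + 1)" using zeta_gas_state[OF args] by (simp add: U_def)
  show "zeta (U t) < 1" using z_up[OF assms] by (simp add: z)
  show "1 < mach \<gamma> (U t)" using mach_gas_state_iff(2)[OF args] z_up[OF assms] by (simp add: U_def)
  show "bernoulli \<gamma> (U t) = B t"
    using bernoulli_gas_state[OF args] z_up(3)[OF assms] a_in x_pos[OF assms] by (simp add: U_def w_up_def)
  show "elec (U t) = F t / (r0 - t)" by (simp add: U_def)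
  show "(r0 - t) * rho (U t) * vel (U t) = J" using flux_gas_state[OF args] by (simp add: U_def)
  show "invariant (r0 - t) (U t) = a_in" using inj_gas_state_zed(2)[OF args] by (simp add: U_def)
  show "(r0 - t) * rho (U t) = density_source J a_in supersonic (r0 - t) (B t)"
    using density_source_gas_state[OF J a_in x_pos[OF assms], of supersonic "B t"]
    by (simp add: U_def w_up_def)
qed

lemma U_EP: "EP_solution_on \<gamma> r0 b {0..T} U"
  by (rule EP_solution_from_reduced[OF T(2) J a_in branch_supersonic up _ b_cont])
    (use w_up in \<open>auto simp: U_def w_up_def fun_eq_iff\<close>)

lemma a_down_pos: "t \<in> {0..T} \<Longrightarrow> 0 < a_down t"
  using shock_factor_pos[OF z_up(4,5)] a_in by (simp add: a_down_def)

lemma a_down_0: "a_down 0 = a_first"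
  by (simp add: a_down_def a_first_def w_up_def up_init)

text \<open>A shock keeps \<open>J\<close>, \<open>B\<close> and \<open>F\<close>; it changes the branch and the value of \<open>a\<close>. It
  compresses the gas, so \<open>F\<close> grows faster behind it than ahead of it.\<close>

lemma shock:
  assumes t: "t \<in> {0..T}"
  shows "shock_state (U t) = gas_state J (a_down t) (r0 - t) (subsonic (w_down t)) (F t / (r0 - t))"
    and "1 / k < w_down t"
    and "density_source J a_in supersonic (r0 - t) (B t) \<le> density_source J (a_down t) subsonic (r0 - t) (B t)"
proof -
  let ?R = "shock_state (U t)"
  note x = x_pos[OF t]
  note R = shock_state[OF U(1,3)[OF t]]
  have RH: "rho (U t) * vel (U t) = rho ?R * vel ?R" "bernoulli \<gamma> ?R = B t" "elec ?R = F t / (r0 - t)"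
    using R(4) U(5,6)[OF t] by (auto simp: rankine_hugoniot_def)
  have pos: "0 < rho ?R" "0 < vel ?R" "0 < pres ?R" using R(1) by (auto simp: positive_state_def)
  note st = gas_state_complete[OF x pos]
  have "(r0 - t) * rho ?R * vel ?R = J" using U(7)[OF t] RH(1) by (simp add: mult.assoc)
  moreover have "invariant (r0 - t) ?R = a_down t"
    using R(6)[of "r0 - t"] U(2,8)[OF t] by (simp add: a_down_def)
  ultimately have R_eq: "?R = gas_state J (a_down t) (r0 - t) (zed ?R) (F t / (r0 - t))"
    using st(1) RH(3) by simp
  note args = J a_down_pos[OF t] x st(2)
  have z1: "1 < zed ?R"
    using mach_zeta(1)[OF R(1)] R(3) mach_gas_state_iff(1)[OF args] R_eq by metis
  have "a_down t / (r0 - t) powr k * g (zed ?R) = B t"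
    using bernoulli_gas_state[OF args] R_eq RH(2) by metis
  then have gz: "g (zed ?R) = w_down t"
    using a_down_pos[OF t] x by (auto simp: w_down_def field_simps)
  then have zz: "zed ?R = subsonic (w_down t)" using subsonic_g[OF z1] by simp
  show Req: "?R = gas_state J (a_down t) (r0 - t) (subsonic (w_down t)) (F t / (r0 - t))"
    using R_eq by (simp only: zz)
  show "1 / k < w_down t" using g_gt[OF st(2)] z1 gz by simp
  have "(r0 - t) * rho ?R = density_source J (a_down t) subsonic (r0 - t) (B t)"
    unfolding Req w_down_def by (rule density_source_gas_state[OF J a_down_pos[OF t] x])
  moreover have "(r0 - t) * rho (U t) \<le> (r0 - t) * rho ?R"
    using R(5) x by (intro mult_left_mono) auto
  ultimately show "density_source J a_in supersonic (r0 - t) (B t)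
      \<le> density_source J (a_down t) subsonic (r0 - t) (B t)"
    using U(9)[OF t] by simp
qed

text \<open>Since \<open>F > k B\<close>, the Mach number ahead of the shock increases strictly with the shock
  position, and so does the entropy that the shock produces.\<close>

lemma a_down_deriv:
  assumes t: "t \<in> {0..T}"
  obtains \<sigma> where "0 < \<sigma>" "(a_down has_real_derivative \<sigma>) (at t within {0..T})"
proof -
  note x = x_pos[OF t]
  have dom: "k * B t < F t"
    by (rule growth_controlled_dominates[OF up_growth[OF t] _ _ T(2) C F_in refl short strong])
      (use t in auto)
  define w' where "w' = (r0 - t) powr (k - 1) * (F t - k * B t) / a_in"
  have w': "(w_up has_real_derivative w') (at t within {0..T})" "0 < w'"
    unfolding w_up_def[abs_def] w'_def using x dom a_in
    by (auto intro!: scaled_bernoulli_derivative B_deriv t)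
  define z where "z = supersonic (w_up t)"
  have z: "0 < z" "z < 1" using z_up[OF t] by (auto simp: z_def)
  have g': "g' z < 0" using g'_neg_iff[OF z(1)] z(2) by simp
  have z': "((\<lambda>t. supersonic (w_up t)) has_real_derivative 1 / g' z * w') (at t within {0..T})"
    using DERIV_chain2[OF branchD(4)[OF branch_supersonic w_up[OF t]] w'(1)] by (simp add: z_def)
  have \<zeta>': "((\<lambda>t. supersonic (w_up t) powr (\<gamma> + 1)) has_real_derivative
      (\<gamma> + 1) * z powr (\<gamma> + 1 - 1) * (1 / g' z * w')) (at t within {0..T})"
    unfolding z_def
    by (rule DERIV_chain2[OF has_real_derivative_powr z'[unfolded z_def]]) (use z in \<open>simp add: z_def\<close>)
  obtain D where D: "D < 0" "(shock_factor has_real_derivative D) (at (supersonic (w_up t) powr (\<gamma> + 1)))"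
    using shock_factor_decreasing[OF z_up(4,5)[OF t]] by blast
  show thesis
  proof (rule that)
    show "(a_down has_real_derivative a_in * (D * ((\<gamma> + 1) * z powr (\<gamma> + 1 - 1) * (1 / g' z * w'))))
        (at t within {0..T})"
      unfolding a_down_def[abs_def] by (rule DERIV_cmult[OF DERIV_chain2[OF D(2) \<zeta>']])
    have "1 / g' z * w' < 0" using g' w'(2) by (simp add: divide_neg_pos divide_pos_neg)
    moreover have "0 < (\<gamma> + 1) * z powr (\<gamma> + 1 - 1)" using gamma_gt_1 z by simp
    ultimately have "(\<gamma> + 1) * z powr (\<gamma> + 1 - 1) * (1 / g' z * w') < 0"
      by (rule mult_pos_neg[rotated])
    then show "0 < a_in * (D * ((\<gamma> + 1) * z powr (\<gamma> + 1 - 1) * (1 / g' z * w')))"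
      by (intro mult_pos_pos a_in mult_neg_neg D(1))
  qed
qed

lemma a_down_ge:
  assumes t: "t \<in> {0..T}"
  shows "a_first \<le> a_down t"
proof -
  have "\<exists>\<sigma>. 0 < \<sigma> \<and> (a_down has_real_derivative \<sigma>) (at t within {0..T})" if "t \<in> {0..T}" for t
    using a_down_deriv[OF that] by blast
  then obtain \<sigma> where \<sigma>: "\<And>t. t \<in> {0..T} \<Longrightarrow> 0 < \<sigma> t \<and> (a_down has_real_derivative \<sigma> t) (at t within {0..T})"
    by metis
  have sub: "{0..t} \<subseteq> {0..T}" using t by auto
  have "a_down 0 \<le> a_down t"
  proof (rule nondecreasing_if_derivative_nonneg_within[where f = a_down and f' = \<sigma>])
    fix u assume "u \<in> {0..t}"
    then show "(a_down has_real_derivative \<sigma> u) (at u within {0..t})"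
      using \<sigma> sub by (blast intro: DERIV_subset)
  next
    fix u assume "0 < u" "u < t"
    then show "0 \<le> \<sigma> u" using \<sigma>[of u] t by (simp add: less_imp_le)
  qed (use t in auto)
  then show ?thesis by (simp add: a_down_0)
qed

text \<open>By compactness one truncation level serves all shock positions.\<close>

lemma w_down_lower_bound:
  obtains w0 where "1 / k < w0" "\<And>t. t \<in> {0..T} \<Longrightarrow> w0 \<le> w_down t"
proof -
  have "continuous_on {0..T} a_down"
    unfolding continuous_on_eq_continuous_within
    using a_down_deriv DERIV_continuous by metis
  moreover have "continuous_on {0..T} B" by (rule DERIV_continuous_on[OF B_deriv])
  moreover have "a_down t \<noteq> 0" if "t \<in> {0..T}" for t using a_down_pos[OF that] by simp
  ultimately have "continuous_on {0..T} w_down"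
    unfolding w_down_def using T by (intro continuous_intros) auto
  then obtain t0 where t0: "t0 \<in> {0..T}" "\<And>t. t \<in> {0..T} \<Longrightarrow> w_down t0 \<le> w_down t"
    using continuous_attains_inf[of "{0..T}" w_down] T by auto
  then show thesis using that[of "w_down t0"] shock(2) by blast
qed

lemma upstream_upper_growth:
  assumes t: "t \<in> {0..T}" and "J * r0 powr (k / 2) / sqrt a_in \<le> Q"
  shows "F t \<le> F_in + Q * t" "B t \<le> B_in + (F_in + T * Q) * (ln r0 - ln (r0 - t))"
proof -
  have Q: "0 \<le> Q" using J a_in assms(2) by (intro order_trans[OF _ assms(2)]) simp
  have red: "reduced_system r0 b J a_in supersonic {0..t} B F"
    by (rule reduced_system_subset[OF up]) (use t in auto)
  have source: "density_source J a_in supersonic (r0 - \<tau>) (B \<tau>) - (r0 - \<tau>) * b \<tau> \<le> Q"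
    if \<tau>: "\<tau> \<in> {0..t}" for \<tau>
  proof -
    have \<tau>': "\<tau> \<in> {0..T}" using \<tau> t by auto
    have "density_source J a_in supersonic (r0 - \<tau>) (B \<tau>) \<le> J * r0 powr (k / 2) / sqrt a_in * 1"
      unfolding density_source_def w_up_def[symmetric]
      using z_up[OF \<tau>'] x_pos[OF \<tau>'] \<tau>' J a_in k_pos
      by (intro mult_mono divide_right_mono mult_left_mono powr_mono2) auto
    moreover have "0 \<le> (r0 - \<tau>) * b \<tau>" using b_bounds(1)[OF \<tau>'] x_pos[OF \<tau>'] by simp
    ultimately show ?thesis using assms(2) by linarith
  qed
  have "Q * (t - 0) \<le> T * Q" using t Q by (simp add: mult.commute mult_left_mono)
  then have M: "F 0 + Q * (t - 0) \<le> F_in + T * Q" by (simp add: up_init)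
  have "F t \<le> F 0 + Q * (t - 0) \<and> B t \<le> B 0 + (F_in + T * Q) * (ln (r0 - 0) - ln (r0 - t))"
    by (intro conjI upper_growth[where s = 0 and t = t and B = B and F = F, OF _ _ Q _ _ source M])
      (use red t T in \<open>auto simp: reduced_system_def\<close>)
  then show "F t \<le> F_in + Q * t" "B t \<le> B_in + (F_in + T * Q) * (ln r0 - ln (r0 - t))"
    by (simp_all add: up_init)
qed

text \<open>For each shock position \<open>s\<close> a solution of the extended system on the whole interval.
  Ahead of \<open>s\<close> it has no physical meaning, but it lets flows with different shock positions be
  compared; behind \<open>s\<close> the extension agrees with the subsonic branch.\<close>

definition downstream_family where
  "downstream_family D L hh hh' Bs Fs \<longleftrightarrow> extends_branch subsonic D L hh hh' \<and>
    (\<forall>s\<in>{0..T}. reduced_system r0 b J (a_down s) hh {0..T} (Bs s) (Fs s) \<and> Bs s s = B s \<and> Fs s s = F s \<and>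
      (\<forall>t\<in>{s..T}. 1 / k < Bs s t * (r0 - t) powr k / a_down s \<and> Bs s t * (r0 - t) powr k / a_down s \<in> D))"

text \<open>Towards the sonic side the solutions cannot leave the range of agreement, because \<open>w\<close>
  increases. Towards the other side the extension agrees with the branch without limit if
  \<open>\<gamma> \<ge> 2\<close>; otherwise the interval is so short that \<open>B\<close> gains at most 1.\<close>

lemma downstream_family_exists:
  assumes size: "2 \<le> \<gamma> \<or> (F_in + T * source_max) * (ln r0 - ln (r0 - T)) \<le> 1"
  obtains D L hh hh' Bs Fs where "downstream_family D L hh hh' Bs Fs"
proof -
  obtain w0 where w0: "1 / k < w0" "\<And>t. t \<in> {0..T} \<Longrightarrow> w0 \<le> w_down t"
    using w_down_lower_bound by blast
  have solutions: "\<exists>Bs Fs. \<forall>s\<in>{0..T}. reduced_system r0 b J (a_down s) hh {0..T} (Bs s) (Fs s)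
      \<and> Bs s s = B s \<and> Fs s s = F s" if ext: "extends_branch subsonic D L hh hh'" for D L hh hh'
  proof -
    have "\<forall>s\<in>{0..T}. \<exists>Y. reduced_system r0 b J (a_down s) hh {0..T} (fst Y) (snd Y)
        \<and> fst Y s = B s \<and> snd Y s = F s"
    proof
      fix s assume s: "s \<in> {0..T}"
      obtain Bs Fs where "reduced_system r0 b J (a_down s) hh {0..T} Bs Fs" "Bs s = B s" "Fs s = F s"
        by (rule reduced_system_exists[OF s T(2) J a_down_pos[OF s] b_cont ext])
      then show "\<exists>Y. reduced_system r0 b J (a_down s) hh {0..T} (fst Y) (snd Y)
        \<and> fst Y s = B s \<and> snd Y s = F s" by (intro exI[of _ "(Bs, Fs)"]) simp
    qed
    then obtain Y where "\<forall>s\<in>{0..T}. reduced_system r0 b J (a_down s) hh {0..T} (fst (Y s)) (snd (Y s))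
        \<and> fst (Y s) s = B s \<and> snd (Y s) s = F s" by metis
    then show ?thesis by (intro exI[of _ "\<lambda>s. fst (Y s)"] exI[of _ "\<lambda>s. snd (Y s)"])
  qed
  have lower: "w0 \<le> Bs s t * (r0 - t) powr k / a_down s"
    if ext: "extends_branch subsonic D L hh hh'" and s: "s \<in> {0..T}" and t: "t \<in> {s..T}"
      and sol: "reduced_system r0 b J (a_down s) hh {0..T} (Bs s) (Fs s)" "Bs s s = B s" "Fs s s = F s"
    for D L hh hh' s t and Bs Fs :: "real \<Rightarrow> real \<Rightarrow> real"
  proof -
    have sub: "{s..T} \<subseteq> {0..T}" using s by auto
    have gc: "growth_controlled r0 C B_in F_in s (Bs s s) (Fs s s)"
      using up_growth[OF s] sol by simp
    have "w_down s \<le> Bs s t * (r0 - t) powr k / a_down s"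
      using accelerating(3)[OF branch_subsonic ext a_down_pos[OF s] _ t reduced_system_subset[OF sol(1) sub] gc]
        s sol(2) by (simp add: w_down_def)
    then show ?thesis using w0(2)[OF s] by simp
  qed
  show thesis
  proof (cases "2 \<le> \<gamma>")
    case True
    obtain L hh hh' where ext: "extends_branch subsonic {w0..} L hh hh'"
      using subsonic_extension_large_gamma[OF w0(1) True] .
    obtain Bs Fs where sol: "\<forall>s\<in>{0..T}. reduced_system r0 b J (a_down s) hh {0..T} (Bs s) (Fs s)
      \<and> Bs s s = B s \<and> Fs s s = F s" using solutions[OF ext] by blast
    have "downstream_family {w0..} L hh hh' Bs Fs"
      unfolding downstream_family_def
    proof (intro conjI ext ballI)
      fix s t assume s: "s \<in> {0..T}" and t: "t \<in> {s..T}"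
      have "w0 \<le> Bs s t * (r0 - t) powr k / a_down s"
        by (rule lower[OF ext s t, where Bs = Bs and Fs = Fs]) (use sol s in auto)
      then show "1 / k < Bs s t * (r0 - t) powr k / a_down s"
        "Bs s t * (r0 - t) powr k / a_down s \<in> {w0..}" using w0(1) by auto
    qed (use sol in auto)
    then show thesis by (rule that)
  next
    case False
    then have small: "(F_in + T * source_max) * (ln r0 - ln (r0 - T)) \<le> 1" using size by simp
    have T0: "0 \<in> {0..T}" using T by simp
    have first: "1 / sqrt (a_down s) \<le> 1 / sqrt a_first" if "s \<in> {0..T}" for s
      using a_down_ge[OF that] a_first by (intro divide_left_mono mult_pos_pos) auto
    have w0_le: "w0 \<le> w_max"
    proof -
      have "w_down 0 \<le> w_max"
        unfolding w_down_def w_max_def a_down_0 using a_first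
        by (intro divide_right_mono) (auto simp: up_init distrib_right)
      then show ?thesis using w0(2)[OF T0] by simp
    qed
    obtain L hh hh' where ext: "extends_branch subsonic {w0..w_max} L hh hh'"
      and bounded: "\<And>w. hh w \<le> subsonic (w_max + 1)"
      using subsonic_extension_bounded[OF w0(1) w0_le] by blast
    obtain Bs Fs where sol: "\<forall>s\<in>{0..T}. reduced_system r0 b J (a_down s) hh {0..T} (Bs s) (Fs s)
      \<and> Bs s s = B s \<and> Fs s s = F s" using solutions[OF ext] by blast
    have sub1: "1 < subsonic (w_max + 1)" using subsonic(1)[of "w_max + 1"] w0(1) w0_le by simp
    have Q1: "J * r0 powr (k / 2) / sqrt a_in \<le> source_max"
      and Q2: "J * r0 powr (k / 2) * (subsonic (w_max + 1) / sqrt a_first) \<le> source_max"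
      using J a_in a_first sub1 by (simp_all add: source_max_def distrib_left)
    have Q: "0 \<le> source_max" using J a_in by (intro order_trans[OF _ Q1]) simp
    have "downstream_family {w0..w_max} L hh hh' Bs Fs"
      unfolding downstream_family_def
    proof (intro conjI ext ballI)
      fix s t assume s: "s \<in> {0..T}" and t: "t \<in> {s..T}"
      have low: "w0 \<le> Bs s t * (r0 - t) powr k / a_down s"
        by (rule lower[OF ext s t, where Bs = Bs and Fs = Fs]) (use sol s in auto)
      then show "1 / k < Bs s t * (r0 - t) powr k / a_down s" using w0(1) by simp
      have red: "reduced_system r0 b J (a_down s) hh {s..t} (Bs s) (Fs s)"
        by (rule reduced_system_subset[of _ _ _ _ _ "{0..T}"]) (use sol s t in auto)
      have source: "density_source J (a_down s) hh (r0 - \<tau>) (Bs s \<tau>) - (r0 - \<tau>) * b \<tau> \<le> source_max"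
        if \<tau>: "\<tau> \<in> {s..t}" for \<tau>
      proof -
        have \<tau>': "\<tau> \<in> {0..T}" using \<tau> s t by auto
        have "density_source J (a_down s) hh (r0 - \<tau>) (Bs s \<tau>)
            = J * (r0 - \<tau>) powr (k / 2) * (hh (Bs s \<tau> * (r0 - \<tau>) powr k / a_down s) * (1 / sqrt (a_down s)))"
          by (simp add: density_source_def)
        also have "\<dots> \<le> J * r0 powr (k / 2) * (subsonic (w_max + 1) * (1 / sqrt a_first))"
          using x_pos[OF \<tau>'] \<tau>' J k_pos sub1 a_down_pos[OF s]
            extends_branch_pos[OF ext branch_subsonic, of "Bs s \<tau> * (r0 - \<tau>) powr k / a_down s"]
          by (intro mult_mono powr_mono2 bounded first[OF s]) auto
        finally have "density_source J (a_down s) hh (r0 - \<tau>) (Bs s \<tau>) \<le> source_max" using Q2 by simp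
        moreover have "0 \<le> (r0 - \<tau>) * b \<tau>" using b_bounds(1)[OF \<tau>'] x_pos[OF \<tau>'] by simp
        ultimately show ?thesis by linarith
      qed
      note up_bounds = upstream_upper_growth[OF s Q1]
      have M: "Fs s s + source_max * (t - s) \<le> F_in + T * source_max"
      proof -
        have "source_max * t \<le> source_max * T" using s t Q by (intro mult_left_mono) auto
        then have "source_max * t \<le> T * source_max" by (simp only: mult.commute)
        then show ?thesis using up_bounds(1) sol s by (simp add: right_diff_distrib)
      qed
      have "Bs s t \<le> Bs s s + (F_in + T * source_max) * (ln (r0 - s) - ln (r0 - t))"
        by (rule upper_growth(2)[where s = s and t = t and B = "Bs s" and F = "Fs s", OF _ _ Q _ _ source M])
          (use red t T in \<open>auto simp: reduced_system_def\<close>)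
      also have "\<dots> \<le> B_in + (F_in + T * source_max) * (ln r0 - ln (r0 - t))"
        using up_bounds(2) sol s by (simp add: right_diff_distrib)
      also have "\<dots> \<le> B_in + (F_in + T * source_max) * (ln r0 - ln (r0 - T))"
        using F_in Q T s t by (intro add_left_mono mult_left_mono) auto
      also have "\<dots> \<le> B_in + 1" using small by simp
      finally have Bs_le: "Bs s t \<le> B_in + 1" .
      have "Bs s t * (r0 - t) powr k / a_down s \<le> w_max"
      proof (cases "0 \<le> Bs s t")
        case True
        then show ?thesis
          unfolding w_max_def using Bs_le B_in T s t k_pos a_first a_down_ge[OF s]
          by (intro frac_le mult_mono powr_mono2) auto
      next
        case False
        then have "Bs s t * (r0 - t) powr k / a_down s \<le> 0"
          using a_down_pos[OF s] by (simp add: divide_le_0_iff mult_le_0_iff)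
        moreover have "0 < w0" using w0(1) k_pos by (meson divide_pos_pos less_trans zero_less_one)
        ultimately show ?thesis using low by linarith
      qed
      then show "Bs s t * (r0 - t) powr k / a_down s \<in> {w0..w_max}" using low by simp
    qed (use sol in auto)
    then show thesis by (rule that)
  qed
qed

end

section \<open>Monotonicity of the exit pressure\<close>

lemma has_vector_derivative_components:
  fixes y :: "real \<Rightarrow> real \<times> real"
  assumes "(y has_vector_derivative v) (at t within S)"
  shows "((\<lambda>t. fst (y t)) has_real_derivative fst v) (at t within S)"
    "((\<lambda>t. snd (y t)) has_real_derivative snd v) (at t within S)"
  using bounded_linear.has_vector_derivative[OF bounded_linear_fst assms]
    bounded_linear.has_vector_derivative[OF bounded_linear_snd assms]
  by (simp_all add: has_real_derivative_iff_has_vector_derivative)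

context polytropic_gas
begin

text \<open>At fixed \<open>B\<close> the logarithm of the subsonic pressure changes with \<open>ln a\<close> at the rate
  \<open>1 / 2 - \<gamma> g z / (z g' z)\<close>; the inequality makes it negative. The reason is
  \<open>\<gamma> / (\<gamma> - 1) > 1 / 2\<close>.\<close>

lemma pressure_coefficient:
  assumes "1 < z"
  shows "z * g' z < 2 * \<gamma> * g z"
proof -
  define p where "p = z powr (\<gamma> - 1)"
  have p: "0 < p" using assms by (simp add: p_def)
  have "z * g' z = z powr (\<gamma> + 1) / z\<^sup>2 - 1 / z\<^sup>2"
    using assms by (simp add: g'_def power2_eq_square power3_eq_cube diff_divide_distrib right_diff_distrib)
  also have "z powr (\<gamma> + 1) / z\<^sup>2 = p"
    using assms powr_diff[of z "\<gamma> + 1" 2] by (simp add: p_def powr_numeral)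
  finally have 1: "z * g' z < p" using assms by simp
  have "1 \<le> 2 * \<gamma> / (\<gamma> - 1)" using gamma_gt_1 by (simp add: le_divide_eq)
  then have "1 * p \<le> 2 * \<gamma> / (\<gamma> - 1) * p" using p by (intro mult_right_mono) auto
  also have "\<dots> \<le> 2 * \<gamma> * g z" using gamma_gt_1 by (simp add: g_def p_def distrib_left)
  finally show ?thesis using 1 by simp
qed

lemma pressure_pos_of_supersonic:
  assumes "1 < mach \<gamma> s" "0 < rho s" "0 < vel s"
  shows "0 < pres s"
proof (rule ccontr)
  assume "\<not> 0 < pres s"
  then have "\<gamma> * pres s / rho s \<le> 0"
    using assms gamma_gt_1 by (simp add: divide_le_0_iff mult_le_0_iff)
  then have "sqrt (\<gamma> * pres s / rho s) \<le> 0" by simp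
  then have "mach \<gamma> s \<le> 0" using assms by (simp add: mach_def divide_le_0_iff)
  then show False using assms by simp
qed

end

context upstream_flow
begin

text \<open>Displacing the shock does not change \<open>B\<close> behind it to first order, because \<open>B\<close> and its
  derivative \<open>F / x\<close> are continuous there; but it lowers \<open>F\<close>, at the rate \<open>x\<close> times the jump
  of the density. From these data the linearised system starts. It is cooperative, since the
  density increases with \<open>B\<close>, and its source is nonpositive, since the density decreases with
  the entropy, which grows with the shock position.\<close>

lemma exit_bernoulli_nonincreasing:
  assumes fam: "downstream_family D L hh hh' Bs Fs" and s0: "s0 \<in> {0..T}"
  obtains \<beta>T where "\<beta>T \<le> 0" "((\<lambda>s. Bs s T) has_real_derivative \<beta>T) (at s0 within {0..T})"
proof -
  have ext: "extends_branch subsonic D L hh hh'"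
    and red: "\<And>s. s \<in> {0..T} \<Longrightarrow> reduced_system r0 b J (a_down s) hh {0..T} (Bs s) (Fs s)"
    and init: "\<And>s. s \<in> {0..T} \<Longrightarrow> Bs s s = B s" "\<And>s. s \<in> {0..T} \<Longrightarrow> Fs s s = F s"
    and range: "\<And>s t. s \<in> {0..T} \<Longrightarrow> t \<in> {s..T} \<Longrightarrow> 1 / k < Bs s t * (r0 - t) powr k / a_down s"
      "\<And>s t. s \<in> {0..T} \<Longrightarrow> t \<in> {s..T} \<Longrightarrow> Bs s t * (r0 - t) powr k / a_down s \<in> D"
    using fam by (auto simp: downstream_family_def)
  note hh = extends_branchD[OF ext]
  have hh_cont: "continuous_on UNIV hh" by (rule DERIV_continuous_on[OF hh(1)])
  obtain \<sigma> where \<sigma>: "0 < \<sigma>" "(a_down has_real_derivative \<sigma>) (at s0 within {0..T})"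
    using a_down_deriv[OF s0] by blast
  define a0 where "a0 = a_down s0"
  have a0: "0 < a0" unfolding a0_def by (rule a_down_pos[OF s0])
  have L: "0 \<le> L" using hh(3)[of 0] by simp
  (* The Lipschitz constant of the density source; M a_first serves all shock positions. *)
  define M where "M a = J * r0 powr (k / 2) / sqrt a * (L * (r0 powr k / a))" for a
  have M_mono: "M (a_down s) \<le> M a_first" if "s \<in> {0..T}" for s
    unfolding M_def using a_down_ge[OF that] a_first J L
    by (intro mult_mono divide_left_mono mult_left_mono mult_pos_pos mult_nonneg_nonneg) auto
  have M0: "0 \<le> M a_first" unfolding M_def using J L a_first by simp
  define K where "K = 1 / (r0 - T) + M a_first"
  have K: "0 \<le> K" "M a_first \<le> K" using M0 T by (auto simp: K_def)
  have x_inv: "1 / (r0 - t) \<le> K" if "t \<in> {0..T}" for t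
  proof -
    have "1 / (r0 - t) \<le> 1 / (r0 - T)" using that T by (intro divide_left_mono mult_pos_pos) auto
    then show ?thesis using M0 by (simp add: K_def)
  qed

  define q where "q t = source_dB J a0 hh' (r0 - t) (Bs s0 t)" for t
  define r where "r t = source_da J a0 hh hh' (r0 - t) (Bs s0 t) * \<sigma>" for t
  have q_bound: "\<bar>q t\<bar> \<le> M a_first" if t: "t \<in> {0..T}" for t
  proof -
    have "\<bar>q t\<bar> \<le> M a0"
      unfolding q_def M_def by (rule source_dB_bound[OF J a0 x_pos[OF t] _ hh(3)]) (use t in simp)
    then show ?thesis using M_mono[OF s0] by (simp add: a0_def)
  qed
  have Bs_cont: "continuous_on {0..T} (Bs s0)"
    using red[OF s0] by (intro DERIV_continuous_on[where D = "\<lambda>t. Fs s0 t / (r0 - t)"])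
      (auto simp: reduced_system_def)
  have curve: "continuous_on {0..T} (\<lambda>t. (t, Bs s0 t, a0))"
    "(\<lambda>t. (t, Bs s0 t, a0)) ` {0..T} \<subseteq> {0..T} \<times> UNIV \<times> {0<..}"
    using a0 by (auto intro!: continuous_intros Bs_cont)
  have q_cont: "continuous_on {0..T} q"
    using continuous_on_compose2[OF source_derivs_cont(1)[OF hh_cont hh(2) T(2), of J] curve]
    by (simp add: q_def)
  have r_cont: "continuous_on {0..T} r"
    using continuous_on_compose2[OF source_derivs_cont(2)[OF hh_cont hh(2) T(2), of J] curve]
    unfolding r_def by (intro continuous_on_mult_right) simp
  have components: "\<bar>fst v\<bar> \<le> norm v" "\<bar>snd v\<bar> \<le> norm v" for v :: "real \<times> real"
    using norm_fst_le[of "fst v" "snd v"] norm_snd_le[of "snd v" "fst v"] by simp_all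

  (* The linearised system: beta and phi are the derivatives of B and F in the shock position.
     *)
  define A where "A t v = (snd v / (r0 - t), q t * fst v)" for t and v :: "real \<times> real"
  have A_lin: "linear (A t)" for t
    by (rule linearI) (auto simp: A_def add_divide_distrib algebra_simps)
  have A_bound: "norm (A t v) \<le> K * norm v" if t: "t \<in> {0..T}" for t v
  proof -
    have "norm (A t v) \<le> \<bar>snd v / (r0 - t)\<bar> + \<bar>q t * fst v\<bar>"
      unfolding A_def norm_Pair real_norm_def power2_abs by (rule sqrt_sum_squares_le_sum_abs)
    also have "\<bar>snd v / (r0 - t)\<bar> = 1 / (r0 - t) * \<bar>snd v\<bar>" using x_pos[OF t] by simp
    also have "\<dots> \<le> 1 / (r0 - T) * norm v"
      using t T by (intro mult_mono divide_left_mono components mult_pos_pos) auto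
    also have "\<bar>q t * fst v\<bar> \<le> M a_first * norm v"
      unfolding abs_mult by (intro mult_mono q_bound t components M0) auto
    finally show ?thesis by (simp add: K_def distrib_right)
  qed
  obtain \<eta> where \<eta>0: "\<eta> s0 = (0, density_source J a_in supersonic (r0 - s0) (B s0)
        - density_source J a0 hh (r0 - s0) (B s0))"
    and \<eta>: "\<And>t. t \<in> {0..T} \<Longrightarrow> (\<eta> has_vector_derivative A t (\<eta> t) + (0, r t)) (at t within {0..T})"
  proof (rule ode_solution_exists[OF s0, where f = "\<lambda>t v. A t v + (0, r t)" and L = K])
    fix y :: "real \<Rightarrow> real \<times> real" assume "continuous_on {0..T} y"
    then show "continuous_on {0..T} (\<lambda>t. A t (y t) + (0, r t))"
      unfolding A_def using T by (intro continuous_intros q_cont r_cont) auto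
  next
    fix t v v' assume t: "t \<in> {0..T}"
    show "norm (A t v + (0, r t) - (A t v' + (0, r t))) \<le> K * norm (v - v')"
      using A_bound[OF t, of "v - v'"] by (simp add: linear_diff[OF A_lin])
  qed blast

  have "bounded (r ` {0..T})"
    by (intro compact_imp_bounded compact_continuous_image r_cont) auto
  then obtain R where R: "\<forall>y\<in>r ` {0..T}. norm y \<le> R" unfolding bounded_iff by blast
  have main: "((\<lambda>s. (Bs s T, Fs s T)) has_vector_derivative \<eta> T) (at s0 within {0..T})"
  proof (rule solution_differentiable_in_starting_time[OF s0 K(1), where
        f = "\<lambda>t v s. planar_field r0 b J (a_down s) hh t v" and y = "\<lambda>s t. (Bs s t, Fs s t)" and
        A = A and r = "\<lambda>t. (0, r t)" and R = R and U = "\<lambda>s. (B s, F s)" and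
        U' = "planar_field r0 b J a_in supersonic s0 (B s0, F s0)"])
    fix t s and v v' :: "real \<times> real" assume t: "t \<in> {0..T}" and s: "s \<in> {0..T}"
    have "norm (planar_field r0 b J (a_down s) hh t v - planar_field r0 b J (a_down s) hh t v')
        \<le> (1 / (r0 - T) + M (a_down s)) * norm (v - v')"
      unfolding M_def
      by (rule planar_field_lipschitz[OF J a_down_pos[OF s] _ _ T(2) extends_branch_lipschitz[OF ext]])
        (use t in auto)
    also have "\<dots> \<le> K * norm (v - v')"
      using M_mono[OF s] by (intro mult_right_mono) (auto simp: K_def)
    finally show "norm (planar_field r0 b J (a_down s) hh t v - planar_field r0 b J (a_down s) hh t v')
        \<le> K * norm (v - v')" .
    show "((\<lambda>t. (Bs s t, Fs s t)) has_vector_derivative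
        planar_field r0 b J (a_down s) hh t (Bs s t, Fs s t)) (at t within {0..T})"
      using red[OF s] t by (simp add: reduced_system_iff)
  next
    fix s assume "s \<in> {0..T}"
    then show "(Bs s s, Fs s s) = (B s, F s)" by (simp add: init)
  next
    show "((\<lambda>s. (B s, F s)) has_vector_derivative planar_field r0 b J a_in supersonic s0 (B s0, F s0))
        (at s0 within {0..T})"
      using up s0 by (simp add: reduced_system_iff)
  next
    fix t assume "t \<in> {0..T}"
    show "linear (A t)" by (rule A_lin)
  next
    fix t v assume "t \<in> {0..T}"
    then show "norm (A t v) \<le> K * norm v" by (rule A_bound)
  next
    fix t assume "t \<in> {0..T}"
    then show "norm (0 :: real, r t) \<le> R" using R by (simp add: norm_Pair)
  next
    fix e :: real assume e: "0 < e"
    obtain d where "0 < d" and d: "\<And>t s x. t \<in> {0..T} \<Longrightarrow> s \<in> {0..T} \<Longrightarrow> \<bar>s - s0\<bar> < d \<Longrightarrow> \<bar>x - Bs s0 t\<bar> < d \<Longrightarrow>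
      \<bar>density_source J (a_down s) hh (r0 - t) x - density_source J (a_down s0) hh (r0 - t) (Bs s0 t)
      - source_dB J (a_down s0) hh' (r0 - t) (Bs s0 t) * (x - Bs s0 t)
      - (s - s0) * (source_da J (a_down s0) hh hh' (r0 - t) (Bs s0 t) * \<sigma>)\<bar> \<le> e * (\<bar>x - Bs s0 t\<bar> + \<bar>s - s0\<bar>)"
      using density_source_expansion[where J = J, OF hh(1,2) T(2) s0 Bs_cont a_down_pos[OF s0] \<sigma>(2) e] by blast
    show "\<exists>d>0. \<forall>t\<in>{0..T}. \<forall>s\<in>{0..T}. \<forall>v. \<bar>s - s0\<bar> < d \<longrightarrow> norm (v - (Bs s0 t, Fs s0 t)) < d \<longrightarrow>
      norm (planar_field r0 b J (a_down s) hh t v - planar_field r0 b J (a_down s0) hh t (Bs s0 t, Fs s0 t)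
        - A t (v - (Bs s0 t, Fs s0 t)) - (s - s0) *\<^sub>R (0, r t)) \<le> e * (norm (v - (Bs s0 t, Fs s0 t)) + \<bar>s - s0\<bar>)"
    proof (intro exI conjI ballI allI impI)
      show "0 < d" by fact
      fix t s v assume t: "t \<in> {0..T}" and s: "s \<in> {0..T}" "\<bar>s - s0\<bar> < d"
        and v: "norm (v - (Bs s0 t, Fs s0 t)) < d"
      let ?E = "density_source J (a_down s) hh (r0 - t) (fst v) - density_source J a0 hh (r0 - t) (Bs s0 t)
          - q t * (fst v - Bs s0 t) - (s - s0) * r t"
      let ?P = "planar_field r0 b J (a_down s) hh t v - planar_field r0 b J (a_down s0) hh t (Bs s0 t, Fs s0 t)
        - A t (v - (Bs s0 t, Fs s0 t)) - (s - s0) *\<^sub>R (0, r t)"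
      have "?P = (0, ?E)"
        unfolding planar_field_def A_def a0_def[symmetric]
        by (simp add: prod_eq_iff diff_divide_distrib)
      then have "norm ?P = \<bar>?E\<bar>"
        by (simp add: norm_Pair)
      also have f: "\<bar>fst v - Bs s0 t\<bar> \<le> norm (v - (Bs s0 t, Fs s0 t))"
        using components(1)[of "v - (Bs s0 t, Fs s0 t)"] by simp
      have "\<bar>?E\<bar> \<le> e * (\<bar>fst v - Bs s0 t\<bar> + \<bar>s - s0\<bar>)"
        unfolding q_def r_def a0_def by (rule d[OF t s]) (use f v in linarith)
      also have "\<dots> \<le> e * (norm (v - (Bs s0 t, Fs s0 t)) + \<bar>s - s0\<bar>)"
        using f e by (intro mult_left_mono) auto
      finally show "norm ?P \<le> e * (norm (v - (Bs s0 t, Fs s0 t)) + \<bar>s - s0\<bar>)" .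
    qed
  next
    fix t assume "t \<in> {0..T}"
    then show "(\<eta> has_vector_derivative A t (\<eta> t) + (0, r t)) (at t within {0..T})" by (rule \<eta>)
  next
    show "\<eta> s0 = planar_field r0 b J a_in supersonic s0 (B s0, F s0)
        - planar_field r0 b J (a_down s0) hh s0 (B s0, F s0)"
      by (simp add: \<eta>0 planar_field_def a0_def)
  qed

  define \<beta> where "\<beta> = (\<lambda>t. fst (\<eta> t))"
  define \<phi> where "\<phi> = (\<lambda>t. snd (\<eta> t))"
  have w: "1 / k < Bs s0 t * (r0 - t) powr k / a0" "Bs s0 t * (r0 - t) powr k / a0 \<in> D"
    if "t \<in> {s0..T}" for t using range[OF s0 that] by (auto simp: a0_def)
  have hh'_pos: "0 < hh' (Bs s0 t * (r0 - t) powr k / a0)" if "t \<in> {s0..T}" for t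
    using hh(6)[OF w(2)[OF that]] subsonic[OF w(1)[OF that]] g'_pos_iff by simp
  have hh_pos: "0 < hh v" for v by (rule extends_branch_pos[OF ext branch_subsonic])
  have sub: "{s0..T} \<subseteq> {0..T}" using s0 by auto
  have "\<beta> T \<le> 0"
  proof (rule cooperative_system_nonpos[where a = s0 and b = T and \<beta> = \<beta> and K = K and m = "\<lambda>t. 1 / (r0 - t)" and q = q and r = r
        and \<phi> = \<phi>])
    show "s0 \<le> T" using s0 by simp
    show "0 \<le> K" by (rule K)
    fix t assume t: "t \<in> {s0..T}"
    then have t': "t \<in> {0..T}" using sub by auto
    note d = has_vector_derivative_components[OF has_vector_derivative_within_subset[OF \<eta>[OF t'] sub]]
    show "(\<beta> has_real_derivative 1 / (r0 - t) * \<phi> t) (at t within {s0..T})"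
      "(\<phi> has_real_derivative q t * \<beta> t + r t) (at t within {s0..T})"
      using d by (simp_all add: \<beta>_def \<phi>_def A_def)
    show "0 \<le> 1 / (r0 - t) \<and> 1 / (r0 - t) \<le> K" using x_pos[OF t'] x_inv[OF t'] by simp
    have "0 \<le> q t" unfolding q_def source_dB_def using hh'_pos[OF t] J a0 by simp
    then show "0 \<le> q t \<and> q t \<le> K" using q_bound[OF t'] K(2) by simp
    have w0: "0 \<le> Bs s0 t * (r0 - t) powr k / a0"
      using w(1)[OF t] k_pos by (meson divide_pos_pos less_imp_le less_trans zero_less_one)
    have nonneg: "0 \<le> c * (h1 / (2 * a0) + h2 * (\<omega> / a0))"
      if "0 \<le> c" "0 < h1" "0 < h2" "0 \<le> \<omega>" for c h1 h2 \<omega>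
      using that a0 by simp
    have "source_da J a0 hh hh' (r0 - t) (Bs s0 t) \<le> 0"
      unfolding source_da_def neg_le_0_iff_le
      by (rule nonneg[OF _ hh_pos hh'_pos[OF t] w0]) (use J a0 in simp)
    then show "r t \<le> 0" unfolding r_def using \<sigma> by (simp add: mult_le_0_iff)
  next
    show "\<beta> s0 \<le> 0" by (simp add: \<beta>_def \<eta>0)
    have "hh (B s0 * (r0 - s0) powr k / a0) = subsonic (B s0 * (r0 - s0) powr k / a0)"
      using hh(5)[OF w(2), of s0] s0 init[OF s0] by simp
    then have "density_source J a0 hh (r0 - s0) (B s0) = density_source J a0 subsonic (r0 - s0) (B s0)"
      by (simp add: density_source_def)
    then show "\<phi> s0 \<le> 0" using shock(3)[OF s0] by (simp add: \<phi>_def \<eta>0 a0_def)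
  qed

  moreover have "((\<lambda>s. Bs s T) has_real_derivative \<beta> T) (at s0 within {0..T})"
    using has_vector_derivative_components(1)[OF main] by (simp add: \<beta>_def)
  ultimately show thesis by (rule that)
qed

text \<open>At the exit \<open>p\<close> is a constant times \<open>sqrt a * z powr \<gamma>\<close>, where
  \<open>z = subsonic (B x\<^sup>k / a)\<close>. The decrease of \<open>B\<close> lowers it, and the growth of \<open>a\<close>
  lowers the power of \<open>z\<close> by a larger factor than it raises \<open>sqrt a\<close>.\<close>

lemma exit_pressure_decreasing:
  assumes fam: "downstream_family D L hh hh' Bs Fs" and s0: "s0 \<in> {0..T}"
  obtains d where "d < 0" "((\<lambda>s. pres (gas_state J (a_down s) (r0 - T)
    (subsonic (Bs s T * (r0 - T) powr k / a_down s)) (Fs s T / (r0 - T)))) has_real_derivative d) (at s0 within {0..T})"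
proof -
  have range: "1 / k < Bs s T * (r0 - T) powr k / a_down s" if "s \<in> {0..T}" for s
    using fam that by (auto simp: downstream_family_def)
  obtain \<beta>T where \<beta>T: "\<beta>T \<le> 0" "((\<lambda>s. Bs s T) has_real_derivative \<beta>T) (at s0 within {0..T})"
    using exit_bernoulli_nonincreasing[OF fam s0] .
  obtain \<sigma> where \<sigma>: "0 < \<sigma>" "(a_down has_real_derivative \<sigma>) (at s0 within {0..T})"
    using a_down_deriv[OF s0] by blast
  define a0 where "a0 = a_down s0"
  have a0: "0 < a0" unfolding a0_def by (rule a_down_pos[OF s0])
  define X where "X = r0 - T"
  have X: "0 < X" using T by (simp add: X_def)
  define W where "W s = Bs s T * X powr k / a_down s" for s
  have W: "1 / k < W s" if "s \<in> {0..T}" for s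
    using range[OF that] by (simp add: W_def X_def)
  define z where "z = subsonic (W s0)"
  have z: "1 < z" "g z = W s0" using subsonic[OF W[OF s0]] by (auto simp: z_def)
  have gz: "0 < g' z" using g'_pos_iff z(1) by simp
  have W': "(W has_real_derivative (\<beta>T * X powr k * a0 - Bs s0 T * X powr k * \<sigma>) / (a0 * a0)) (at s0 within {0..T})"
    unfolding W_def a0_def
    by (rule DERIV_divide[OF DERIV_cmult_right[OF \<beta>T(2)] \<sigma>(2)]) (use a0 in \<open>simp add: a0_def\<close>)
  define w' where "w' = (\<beta>T * X powr k * a0 - Bs s0 T * X powr k * \<sigma>) / (a0 * a0)"
  have w': "w' \<le> - (W s0 * \<sigma> / a0)"
  proof -
    have "w' = \<beta>T * X powr k / a0 - W s0 * \<sigma> / a0"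
      unfolding w'_def W_def a0_def[symmetric] using a0 by (simp add: diff_divide_distrib)
    moreover have "\<beta>T * X powr k / a0 \<le> 0"
      using \<beta>T(1) a0 by (simp add: divide_le_0_iff mult_le_0_iff)
    ultimately show ?thesis by linarith
  qed
  have z': "((\<lambda>s. subsonic (W s)) has_real_derivative 1 / g' z * w') (at s0 within {0..T})"
    using DERIV_chain2[OF branchD(4)[OF branch_subsonic W[OF s0]] W'] by (simp add: z_def w'_def)
  have zp': "((\<lambda>s. subsonic (W s) powr \<gamma>) has_real_derivative \<gamma> * z powr (\<gamma> - 1) * (1 / g' z * w')) (at s0 within {0..T})"
    unfolding z_def by (rule DERIV_chain2[OF has_real_derivative_powr z'[unfolded z_def]]) (use z in \<open>simp add: z_def\<close>)
  have sq': "((\<lambda>s. sqrt (a_down s)) has_real_derivative inverse (sqrt a0) / 2 * \<sigma>) (at s0 within {0..T})"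
    unfolding a0_def by (rule DERIV_chain2[OF DERIV_real_sqrt[OF a_down_pos[OF s0]] \<sigma>(2)])
  define c where "c = J / \<gamma> * X powr (- (k / 2) - 1)"
  have c: "0 < c" using J gamma_gt_1 X by (simp add: c_def)
  define d where "d = c * (inverse (sqrt a0) / 2 * \<sigma> * z powr \<gamma> + \<gamma> * z powr (\<gamma> - 1) * (1 / g' z * w') * sqrt a0)"
  have "((\<lambda>s. c * (sqrt (a_down s) * subsonic (W s) powr \<gamma>)) has_real_derivative d) (at s0 within {0..T})"
    unfolding d_def using DERIV_cmult[OF DERIV_mult[OF sq' zp'], of c] by (simp add: a0_def z_def)
  then have "((\<lambda>s. pres (gas_state J (a_down s) (r0 - T)
    (subsonic (Bs s T * (r0 - T) powr k / a_down s)) (Fs s T / (r0 - T)))) has_real_derivative d) (at s0 within {0..T})"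
  proof (rule has_real_derivative_cong_on[OF _ s0, rotated])
    fix s assume s: "s \<in> {0..T}"
    have "0 < subsonic (W s)" using subsonic(1)[OF W[OF s]] by simp
    from gas_state_powr(3)[OF a_down_pos[OF s] X this, of J "Fs s T / X"]
    show "pres (gas_state J (a_down s) (r0 - T) (subsonic (Bs s T * (r0 - T) powr k / a_down s)) (Fs s T / (r0 - T)))
        = c * (sqrt (a_down s) * subsonic (W s) powr \<gamma>)"
      by (simp add: W_def X_def c_def)
  qed
  moreover have "d < 0"
  proof -
    have "d = c * sqrt a0 * z powr \<gamma> * (\<sigma> / (2 * a0) + \<gamma> * (w' / (z * g' z)))"
    proof -
      have "inverse (sqrt a0) = sqrt a0 / a0" using a0 by (simp add: field_simps)
      moreover have "z powr (\<gamma> - 1) = z powr \<gamma> / z" using z(1) by (simp add: powr_diff)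
      ultimately show ?thesis unfolding d_def by (simp add: algebra_simps)
    qed
    moreover have "\<sigma> / (2 * a0) + \<gamma> * (w' / (z * g' z)) < 0"
    proof -
      have "\<gamma> * (w' / (z * g' z)) \<le> \<gamma> * (- (W s0 * \<sigma> / a0) / (z * g' z))"
        using w' z(1) gz gamma_gt_1 by (intro mult_left_mono divide_right_mono) auto
      moreover have "\<sigma> / (2 * a0) < \<gamma> * (W s0 * \<sigma> / a0 / (z * g' z))"
      proof -
        have "1 < 2 * \<gamma> * g z / (z * g' z)"
          using pressure_coefficient[OF z(1)] z(1) gz by (simp add: less_divide_eq)
        then have "\<sigma> / (2 * a0) * 1 < \<sigma> / (2 * a0) * (2 * \<gamma> * g z / (z * g' z))"
          using \<sigma> a0 by (intro mult_strict_left_mono) auto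
        then show ?thesis by (simp add: z(2) mult_ac)
      qed
      ultimately show ?thesis by simp
    qed
    moreover have "0 < c * sqrt a0 * z powr \<gamma>" using c a0 z(1) by simp
    ultimately show ?thesis using mult_pos_neg by metis
  qed
  ultimately show thesis using that by blast
qed

lemma downstream_part:
  assumes fam: "downstream_family D L hh hh' Bs Fs" and s: "s \<in> {0..T}"
    and V: "V = (\<lambda>t. gas_state J (a_down s) (r0 - t) (subsonic (Bs s t * (r0 - t) powr k / a_down s)) (Fs s t / (r0 - t)))"
  shows "reduced_system r0 b J (a_down s) subsonic {s..T} (Bs s) (Fs s)"
    and "transonic_shock \<gamma> r0 b T (U 0) s U V"
proof -
  have ext: "extends_branch subsonic D L hh hh'"
    and red: "reduced_system r0 b J (a_down s) hh {0..T} (Bs s) (Fs s)"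
    and init: "Bs s s = B s" "Fs s s = F s"
    and range: "\<And>t. t \<in> {s..T} \<Longrightarrow> 1 / k < Bs s t * (r0 - t) powr k / a_down s"
      "\<And>t. t \<in> {s..T} \<Longrightarrow> Bs s t * (r0 - t) powr k / a_down s \<in> D"
    using fam s by (auto simp: downstream_family_def)
  have sub: "{s..T} \<subseteq> {0..T}" using s by auto
  show red': "reduced_system r0 b J (a_down s) subsonic {s..T} (Bs s) (Fs s)"
    by (rule reduced_system_cong[OF reduced_system_subset[OF red sub]])
      (rule extends_branchD(5)[OF ext range(2)])
  have "EP_solution_on \<gamma> r0 b {s..T} V"
    by (rule EP_solution_from_reduced[OF T(2) J a_down_pos[OF s] branch_subsonic red' range(1)
          continuous_on_subset[OF b_cont sub] V])
  moreover have "0 < rho (V t) \<and> 0 < vel (V t) \<and> 0 < pres (V t) \<and> mach \<gamma> (V t) < 1" if t: "t \<in> {s..T}" for t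
  proof -
    have t': "t \<in> {0..T}" using t sub by auto
    have z: "1 < subsonic (Bs s t * (r0 - t) powr k / a_down s)" by (rule subsonic(1)[OF range(1)[OF t]])
    then have z0: "0 < subsonic (Bs s t * (r0 - t) powr k / a_down s)" by simp
    note args = J a_down_pos[OF s] x_pos[OF t'] z0
    show ?thesis unfolding V using gas_state_pos[OF args] mach_gas_state_iff(1)[OF args] z by blast
  qed
  moreover have "rankine_hugoniot \<gamma> (U s) (V s)"
    using shock_state(4)[OF U(1,3)[OF s]] by (simp add: V shock(1)[OF s] w_down_def init)
  ultimately show "transonic_shock \<gamma> r0 b T (U 0) s U V"
    unfolding transonic_shock_def using U_EP U(1,4) by (auto simp: positive_state_def)
qed

lemma upstream_unique:
  assumes "EP_solution_on \<gamma> r0 b {0..T} U'" "U' 0 = U 0"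
    and "\<And>t. t \<in> {0..T} \<Longrightarrow> 0 < rho (U' t) \<and> 0 < vel (U' t) \<and> 1 < mach \<gamma> (U' t)"
    and t: "t \<in> {0..T}"
  shows "U' t = U t"
proof -
  have T0: "0 \<in> {0..T}" using T by simp
  have pos: "0 < rho (U' t)" "0 < vel (U' t)" "0 < pres (U' t)" "1 < mach \<gamma> (U' t)" if "t \<in> {0..T}" for t
    using assms(3)[OF that] pressure_pos_of_supersonic[of "U' t"] by auto
  have z: "0 < zed (U' t)" "zed (U' t) < 1" if t: "t \<in> {0..T}" for t
  proof -
    note p = pos[OF t] x_pos[OF t]
    note st = gas_state_complete[OF p(5) p(1,2,3)]
    show "0 < zed (U' t)" by (rule st(2))
    have "0 < (r0 - t) * rho (U' t) * vel (U' t)" using p by simp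
    from mach_gas_state_iff(2)[OF this st(3) p(5) st(2)] p(4) st(1)
    show "zed (U' t) < 1" by metis
  qed
  have J': "J = (r0 - 0) * rho (U' 0) * vel (U' 0)" using U(7)[OF T0] by (simp add: assms(2))
  have a': "a_in = invariant (r0 - 0) (U' 0)" using U(8)[OF T0] by (simp add: assms(2))
  define B' where "B' = (\<lambda>t. bernoulli \<gamma> (U' t))"
  define F' where "F' = (\<lambda>t. (r0 - t) * elec (U' t))"
  note red = EP_solution_reduces[where h = supersonic, OF less_imp_le[OF T(1)] T(2) assms(1) _ J' a' supersonic_g[OF z] B'_def F'_def]
  have w: "1 / k < B' t * (r0 - t) powr k / a_in" if t: "t \<in> {0..T}" for t
    using red(2)[OF _ _ _ t] g_gt[OF z(1)[OF t]] z(2)[OF t] pos by simp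
  have init: "B' 0 = B 0" "F' 0 = F 0"
    using U(5,6)[OF T0] r0 by (simp_all add: B'_def F'_def assms(2))
  have "B' t = B t" "F' t = F t"
    using reduced_system_unique[OF order_refl T(2) J a_in branch_supersonic red(1) up w _ init t]
      pos w_up by (auto simp: w_up_def)
  then show ?thesis using red(3)[OF _ _ _ t] pos by (simp add: U_def w_up_def)
qed

lemma downstream_unique:
  assumes fam: "downstream_family D L hh hh' Bs Fs" and s: "s \<in> {0..T}"
    and EP: "EP_solution_on \<gamma> r0 b {s..T} V'"
    and V': "\<And>t. t \<in> {s..T} \<Longrightarrow> 0 < rho (V' t) \<and> 0 < vel (V' t) \<and> 0 < pres (V' t) \<and> mach \<gamma> (V' t) < 1"
    and RH: "rankine_hugoniot \<gamma> (U s) (V' s)" and t: "t \<in> {s..T}"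
  shows "V' t = gas_state J (a_down s) (r0 - t) (subsonic (Bs s t * (r0 - t) powr k / a_down s)) (Fs s t / (r0 - t))"
proof -
  have sT: "s \<le> T" "s \<in> {s..T}" using s by auto
  have sub: "{s..T} \<subseteq> {0..T}" using s by auto
  have pos: "0 < rho (V' t)" "0 < vel (V' t)" "0 < pres (V' t)" "mach \<gamma> (V' t) < 1" "0 < r0 - t" if "t \<in> {s..T}" for t
    using V'[OF that] x_pos[of t] that sub by auto
  have z: "1 < zed (V' t)" if t: "t \<in> {s..T}" for t
  proof -
    note p = pos[OF t]
    note st = gas_state_complete[OF p(5) p(1,2,3)]
    have "0 < (r0 - t) * rho (V' t) * vel (V' t)" using p by simp
    from mach_gas_state_iff(1)[OF this st(3) p(5) st(2)] p(4) st(1)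
    show "1 < zed (V' t)" by metis
  qed
  have Vpos: "positive_state (V' s)" using pos[OF sT(2)] by (simp add: positive_state_def)
  have Vs: "V' s = shock_state (U s)"
    by (rule shock_state_unique[OF U(1,3)[OF s] Vpos _ RH]) (use mach_zeta(1)[OF Vpos] pos[OF sT(2)] in simp)
  note R = shock_state[OF U(1,3)[OF s]]
  have RH': "rho (U s) * vel (U s) = rho (V' s) * vel (V' s)" "bernoulli \<gamma> (V' s) = B s" "elec (V' s) = F s / (r0 - s)"
    using RH U(5,6)[OF s] by (auto simp: rankine_hugoniot_def)
  have J': "J = (r0 - s) * rho (V' s) * vel (V' s)" using U(7)[OF s] RH'(1) by (simp add: mult.assoc)
  have a': "a_down s = invariant (r0 - s) (V' s)"
    using R(6)[of "r0 - s"] U(2,8)[OF s] by (simp add: a_down_def Vs)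
  define B' where "B' = (\<lambda>t. bernoulli \<gamma> (V' t))"
  define F' where "F' = (\<lambda>t. (r0 - t) * elec (V' t))"
  note red = EP_solution_reduces[where h = subsonic, OF sT(1) T(2) EP _ J' a' subsonic_g[OF z] B'_def F'_def]
  have w: "1 / k < B' t * (r0 - t) powr k / a_down s" if t: "t \<in> {s..T}" for t
    using red(2)[OF _ _ t] g_gt[of "zed (V' t)"] z[OF t] pos by simp
  have Bs: "Bs s s = B s" "Fs s s = F s"
    and range: "\<And>t. t \<in> {s..T} \<Longrightarrow> 1 / k < Bs s t * (r0 - t) powr k / a_down s"
    using fam s by (auto simp: downstream_family_def)
  have init: "B' s = Bs s s" "F' s = Fs s s"
    using RH' pos(5)[OF sT(2)] by (simp_all add: B'_def F'_def Bs)
  have "B' t = Bs s t" "F' t = Fs s t"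
    using reduced_system_unique[OF _ T(2) J a_down_pos[OF s] branch_subsonic red(1)
        downstream_part(1)[OF fam s refl] w range init t] s pos by auto
  then show ?thesis using red(3)[OF _ _ t] pos by simp
qed

end

theorem (in strong_field) unique_shocks_and_exit_pressure:
  assumes size: "2 \<le> \<gamma> \<or> (F_in + T * source_max) * (ln r0 - ln (r0 - T)) \<le> 1"
    and s0: "s0 = gas_state J a_in r0 (supersonic (B_in * r0 powr k / a_in)) (F_in / r0)"
  shows "unique_shocks_with_decreasing_exit_pressure \<gamma> r0 b T s0"
proof -
  obtain B F where BF: "reduced_system r0 b J a_in supersonic {0..T} B F" "B 0 = B_in" "F 0 = F_in"
    "\<And>t. t \<in> {0..T} \<Longrightarrow> growth_controlled r0 C B_in F_in t (B t) (F t)"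
    "\<And>t. t \<in> {0..T} \<Longrightarrow> B_in * r0 powr k / a_in \<le> B t * (r0 - t) powr k / a_in"
    using upstream_exists by blast
  interpret upstream_flow \<gamma> r0 T J C a_in B_in F_in b B F
    by unfold_locales (use BF in auto)
  obtain D L hh hh' Bs Fs where fam: "downstream_family D L hh hh' Bs Fs"
    using downstream_family_exists[OF size] .
  define V where "V s t = gas_state J (a_down s) (r0 - t)
    (subsonic (Bs s t * (r0 - t) powr k / a_down s)) (Fs s t / (r0 - t))" for s t
  have U0: "U 0 = s0" by (simp add: U_def w_up_def s0 BF)
  show ?thesis
    unfolding unique_shocks_with_decreasing_exit_pressure_def
  proof (intro exI[of _ U] exI[of _ V] conjI ballI allI impI)
    fix s assume s: "s \<in> {0..T}"
    show "transonic_shock \<gamma> r0 b T s0 s U (V s)"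
      unfolding U0[symmetric] by (rule downstream_part(2)[OF fam s]) (simp add: V_def fun_eq_iff)
    show "\<exists>d<0. ((\<lambda>s. pres (V s T)) has_real_derivative d) (at s within {0..T})"
      using exit_pressure_decreasing[OF fam s] unfolding V_def by blast
    fix U' V' assume tr: "transonic_shock \<gamma> r0 b T s0 s U' V'"
    show U': "U' t = U t" if "t \<in> {0..T}" for t
      by (rule upstream_unique[OF _ _ _ that]) (use tr in \<open>auto simp: transonic_shock_def U0\<close>)
    have RH: "rankine_hugoniot \<gamma> (U s) (V' s)"
      using tr U'[OF s] by (auto simp: transonic_shock_def)
    show "V' t = V s t" if "t \<in> {s..T}" for t
      unfolding V_def by (rule downstream_unique[where Bs = Bs and Fs = Fs and s = s and t = t and V' = V', OF fam s _ _ RH that])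
        (use tr in \<open>auto simp: transonic_shock_def\<close>)
  qed
qed

section \<open>Choice of the entrance field and of the interval\<close>

text \<open>The derivative is continuous, hence bounded, so its supremum is nonnegative and the
  supremum of \<open>b\<close> alone obeys the bound on the norm.\<close>

lemma admissible_background_bounds:
  assumes adm: "admissible_background r0 b0 b" and "0 < r0"
  shows "continuous_on {0..r0} b" and "\<And>t. t \<in> {0..r0} \<Longrightarrow> 0 < b t \<and> b t \<le> b0"
proof -
  obtain b' where b': "continuous_on {0..r0} b'"
    "\<And>t. t \<in> {0..r0} \<Longrightarrow> (b has_real_derivative b' t) (at t within {0..r0})"
    using adm unfolding admissible_background_def C1_on_def by blast
  show cont: "continuous_on {0..r0} b" by (rule DERIV_continuous_on[OF b'(2)])
  have vd: "vector_derivative b (at t within {0..r0}) = b' t" if "t \<in> {0..r0}" for t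
    using vector_derivative_within_closed_interval[of 0 r0 t b "b' t"] b'(2)[OF that] that \<open>0 < r0\<close>
    by (simp add: has_real_derivative_iff_has_vector_derivative)
  have bdd: "bdd_above ((\<lambda>t. \<bar>f t\<bar>) ` {0..r0})" if "continuous_on {0..r0} f" for f :: "real \<Rightarrow> real"
    by (intro bounded_imp_bdd_above compact_imp_bounded compact_continuous_image)
      (use that in \<open>auto intro: continuous_intros\<close>)
  have "0 \<le> (SUP t\<in>{0..r0}. \<bar>b' t\<bar>)"
    by (rule cSUP_upper2[OF bdd[OF b'(1)], of 0]) (use \<open>0 < r0\<close> in auto)
  moreover have "(SUP t\<in>{0..r0}. \<bar>vector_derivative b (at t within {0..r0})\<bar>) = (SUP t\<in>{0..r0}. \<bar>b' t\<bar>)"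
    by (intro SUP_cong) (simp_all add: vd)
  ultimately have sup: "(SUP t\<in>{0..r0}. \<bar>b t\<bar>) \<le> b0"
    using adm unfolding admissible_background_def C1_norm_def by linarith
  fix t assume t: "t \<in> {0..r0}"
  have "b t \<le> \<bar>b t\<bar>" by simp
  also have "\<dots> \<le> (SUP t\<in>{0..r0}. \<bar>b t\<bar>)" by (rule cSUP_upper[OF t bdd[OF cont]])
  finally show "0 < b t \<and> b t \<le> b0" using sup adm t by (auto simp: admissible_background_def)
qed

theorem theorem2p2:
  fixes \<gamma> r0 b0 \<rho>0 u0 p0 :: real
  assumes "\<gamma> > 1" and "r0 > 0" and "b0 > 0"
    and "\<rho>0 > 0" and "u0 > 0" and "p0 > 0"
    and "sqrt (u0\<^sup>2 / (\<gamma> * p0 / \<rho>0)) > 1"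
  shows
    "(\<exists>E_low>0. \<forall>E0\<ge>E_low. \<exists>T0. 0 < T0 \<and> T0 < r0 \<and>
        (\<forall>b. admissible_background r0 b0 b \<longrightarrow>
           (\<forall>T. 0 < T \<and> T \<le> T0 \<longrightarrow>
              unique_shocks_with_decreasing_exit_pressure \<gamma> r0 b T
                \<lparr>rho = \<rho>0, vel = u0, pres = p0, elec = E0\<rparr>)))
     \<and>
     (\<gamma> \<ge> 2 \<longrightarrow>
        (\<forall>r1. 0 < r1 \<and> r1 < r0 \<and> ln (r0 / r1) < (\<gamma> + 1) / (2 * (\<gamma> - 1)) \<longrightarrow>
           (\<exists>E_star>0. \<forall>b. admissible_background r0 b0 b \<longrightarrow>
              (\<forall>E0\<ge>E_star.
                 unique_shocks_with_decreasing_exit_pressure \<gamma> r0 b (r0 - r1)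
                   \<lparr>rho = \<rho>0, vel = u0, pres = p0, elec = E0\<rparr>))))"
proof -
  interpret polytropic_gas \<gamma> by unfold_locales fact
  define entrance where "entrance E = \<lparr>rho = \<rho>0, vel = u0, pres = p0, elec = E\<rparr>" for E
  have fields: "rho (entrance E) = \<rho>0" "vel (entrance E) = u0" "pres (entrance E) = p0"
    "elec (entrance E) = E" for E
    by (simp_all add: entrance_def)
  have pos: "positive_state (entrance E)" for E
    using assms by (simp add: positive_state_def fields)
  define J where "J = r0 * \<rho>0 * u0"
  define z where "z = zed (entrance 0)"
  define a_in where "a_in = invariant r0 (entrance 0)"
  define B_in where "B_in = bernoulli \<gamma> (entrance 0)"
  define C where "C = r0 * b0"
  have J: "0 < J" using assms by (simp add: J_def)
  have C: "0 < C" using assms by (simp add: C_def)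
  have state: "entrance E = gas_state J a_in r0 z E" "0 < z" "0 < a_in" for E
  proof -
    have p: "0 < rho (entrance E)" "0 < vel (entrance E)" "0 < pres (entrance E)"
      using assms by (simp_all add: fields)
    have e: "zed (entrance E) = z" "invariant r0 (entrance E) = a_in"
      by (simp_all add: z_def a_in_def invariant_def zed_def fields)
    show "entrance E = gas_state J a_in r0 z E" "0 < z" "0 < a_in"
      using gas_state_complete[OF \<open>r0 > 0\<close> p] unfolding e fields J_def by blast+
  qed
  have "1 < u0\<^sup>2 / (\<gamma> * p0 / \<rho>0)" using assms(7) by simp
  then have "zeta (entrance 0) < 1"
    using assms by (simp add: zeta_def fields less_divide_eq divide_less_eq field_simps)
  then have "z < 1"
    using zeta_eq_zed[OF pos] powr_less_one_iff[of "\<gamma> + 1" z] state(2) assms(1) by (simp add: z_def)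
  have gz: "B_in * r0 powr k / a_in = g z"
    using bernoulli_gas_state[OF J state(3) \<open>r0 > 0\<close> state(2), of 0] state(3) \<open>r0 > 0\<close>
    unfolding state(1)[symmetric] B_in_def by simp
  have entry: "1 / k < B_in * r0 powr k / a_in"
    using g_gt[OF state(2)] \<open>z < 1\<close> by (simp add: gz)
  have B_in: "0 < B_in"
    using assms by (simp add: B_in_def bernoulli_def fields add_pos_pos)
  have sonic: "supersonic (B_in * r0 powr k / a_in) = z"
    using supersonic_g[OF state(2) \<open>z < 1\<close>] by (simp add: gz)

  have main: "unique_shocks_with_decreasing_exit_pressure \<gamma> r0 b T (entrance E)"
    if T: "0 < T" "T < r0" and b: "admissible_background r0 b0 b"
      and short: "k * (ln r0 - ln (r0 - T)) < 1"
      and strong: "k * (B_in + (ln r0 - ln (r0 - T)) * (C * T))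
        < (1 - k * (ln r0 - ln (r0 - T))) * (r0 * E - C * T)"
      and size: "2 \<le> \<gamma> \<or> (r0 * E + T * strong_field.source_max \<gamma> r0 J a_in B_in) * (ln r0 - ln (r0 - T)) \<le> 1"
    for T b E
  proof -
    note bb = admissible_background_bounds[OF b \<open>r0 > 0\<close>]
    interpret strong_field \<gamma> r0 T J C a_in B_in "r0 * E" b
    proof unfold_locales
      show "continuous_on {0..T} b" by (rule continuous_on_subset[OF bb(1)]) (use T in auto)
      fix t assume t: "t \<in> {0..T}"
      then have t': "t \<in> {0..r0}" using T by auto
      show "0 \<le> b t" using bb(2)[OF t'] by simp
      show "(r0 - t) * b t \<le> C"
        unfolding C_def using bb(2)[OF t'] t T by (intro mult_mono) auto
    qed (use T J state(3) entry short strong in auto)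
    show ?thesis
      by (rule unique_shocks_and_exit_pressure[OF size]) (use state(1) sonic \<open>r0 > 0\<close> in simp)
  qed

  (* On an interval with k * \<Lambda> <= 1/2 the field dominates as soon as r0 * E0 > 2 * k *
     B_in + 2 * C * r0, whatever the length; this fixes the threshold before T0. Then 1 / S
     bounds \<Lambda> so that the Bernoulli function gains at most 1. *)
  have part_a: "\<exists>E_low>0. \<forall>E0\<ge>E_low. \<exists>T0. 0 < T0 \<and> T0 < r0 \<and>
        (\<forall>b. admissible_background r0 b0 b \<longrightarrow>
           (\<forall>T. 0 < T \<and> T \<le> T0 \<longrightarrow> unique_shocks_with_decreasing_exit_pressure \<gamma> r0 b T (entrance E0)))"
  proof (rule exI[of _ "(2 * k * B_in + 2 * (C * r0)) / r0 + 1"], intro conjI allI impI)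
    show "0 < (2 * k * B_in + 2 * (C * r0)) / r0 + 1"
      using k_pos B_in C \<open>r0 > 0\<close> by (intro add_nonneg_pos divide_nonneg_pos add_nonneg_nonneg mult_nonneg_nonneg) auto
    fix E0 assume "(2 * k * B_in + 2 * (C * r0)) / r0 + 1 \<le> E0"
    then have E0: "2 * k * B_in + 2 * (C * r0) < r0 * E0"
      using \<open>r0 > 0\<close> by (simp add: field_simps)
    define Q where "Q = \<bar>strong_field.source_max \<gamma> r0 J a_in B_in\<bar>"
    have F: "0 < r0 * E0" using E0 k_pos B_in C \<open>r0 > 0\<close>
      by (intro less_trans[OF _ E0] add_pos_pos mult_pos_pos) auto
    define S where "S = r0 * E0 + r0 * Q + 1"
    have S: "0 < S" using F \<open>r0 > 0\<close> by (simp add: S_def Q_def add_pos_nonneg)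
    define \<nu> where "\<nu> = min (1 / (2 * k)) (1 / S)"
    have \<nu>: "0 < \<nu>" "\<nu> \<le> 1 / (2 * k)" "\<nu> \<le> 1 / S" using k_pos S by (auto simp: \<nu>_def)
    define T0 where "T0 = r0 * (1 - exp (- \<nu>))"
    show "\<exists>T0. 0 < T0 \<and> T0 < r0 \<and> (\<forall>b. admissible_background r0 b0 b \<longrightarrow>
        (\<forall>T. 0 < T \<and> T \<le> T0 \<longrightarrow> unique_shocks_with_decreasing_exit_pressure \<gamma> r0 b T (entrance E0)))"
    proof (intro exI[of _ T0] conjI allI impI)
      show "0 < T0" using \<open>r0 > 0\<close> \<nu>(1) by (simp add: T0_def)
      show T0: "T0 < r0" using \<open>r0 > 0\<close> by (simp add: T0_def)
      fix b T assume b: "admissible_background r0 b0 b" and T: "0 < T \<and> T \<le> T0"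
      then have Tr: "0 < T" "T < r0" using T0 by auto
      define \<Lambda> where "\<Lambda> = ln r0 - ln (r0 - T)"
      have \<Lambda>0: "0 \<le> \<Lambda>" using Tr by (simp add: \<Lambda>_def)
      have "r0 * exp (- \<nu>) \<le> r0 - T" using T by (simp add: T0_def right_diff_distrib)
      then have "ln (r0 * exp (- \<nu>)) \<le> ln (r0 - T)" using Tr \<open>r0 > 0\<close> by simp
      then have \<Lambda>: "\<Lambda> \<le> \<nu>" using \<open>r0 > 0\<close> by (simp add: \<Lambda>_def ln_mult)
      have "k * \<Lambda> \<le> k * (1 / (2 * k))" using \<Lambda> \<nu>(2) k_pos by (intro mult_left_mono) auto
      then have k\<Lambda>: "k * \<Lambda> \<le> 1 / 2" using k_pos by simp
      have CT: "C * T \<le> C * r0" "0 \<le> C * T" using C Tr by simp_all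
      show "unique_shocks_with_decreasing_exit_pressure \<gamma> r0 b T (entrance E0)"
      proof (rule main[OF Tr b])
        show "k * (ln r0 - ln (r0 - T)) < 1" using k\<Lambda> by (simp add: \<Lambda>_def)
        have "k * \<Lambda> * (C * T) \<le> 1 / 2 * (C * r0)"
          by (rule mult_mono[OF k\<Lambda> CT(1) _ CT(2)]) simp
        then have "k * (B_in + \<Lambda> * (C * T)) \<le> k * B_in + C * r0 / 2"
          by (simp add: distrib_left mult.assoc)
        also have "\<dots> < 1 / 2 * (r0 * E0 - C * r0)" using E0 C \<open>r0 > 0\<close> by simp
        also have "\<dots> \<le> (1 - k * \<Lambda>) * (r0 * E0 - C * T)"
        proof (rule mult_mono)
          have "0 < k * B_in" using k_pos B_in by simp
          then show "0 \<le> r0 * E0 - C * r0" using E0 CT by (simp add: mult.assoc)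
        qed (use k\<Lambda> CT in auto)
        finally show "k * (B_in + (ln r0 - ln (r0 - T)) * (C * T))
            < (1 - k * (ln r0 - ln (r0 - T))) * (r0 * E0 - C * T)" by (simp add: \<Lambda>_def)
        have "T * strong_field.source_max \<gamma> r0 J a_in B_in \<le> r0 * Q"
          using Tr by (intro order_trans[OF mult_left_mono mult_right_mono]) (auto simp: Q_def)
        then have "r0 * E0 + T * strong_field.source_max \<gamma> r0 J a_in B_in \<le> S" by (simp add: S_def)
        then have "(r0 * E0 + T * strong_field.source_max \<gamma> r0 J a_in B_in) * \<Lambda> \<le> S * (1 / S)"
          using \<Lambda> \<nu>(3) S \<Lambda>0 by (intro mult_mono) auto
        then show "2 \<le> \<gamma> \<or> (r0 * E0 + T * strong_field.source_max \<gamma> r0 J a_in B_in) * (ln r0 - ln (r0 - T)) \<le> 1"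
          using S by (simp add: \<Lambda>_def)
      qed
    qed
  qed

  (* Here the length of the interval is given, and the threshold solves the condition of
     domination for E0. *)
  have part_b: "\<exists>E_star>0. \<forall>b. admissible_background r0 b0 b \<longrightarrow>
              (\<forall>E0\<ge>E_star. unique_shocks_with_decreasing_exit_pressure \<gamma> r0 b (r0 - r1) (entrance E0))"
    if "2 \<le> \<gamma>" and r1: "0 < r1" "r1 < r0" and short: "ln (r0 / r1) < (\<gamma> + 1) / (2 * (\<gamma> - 1))" for r1
  proof -
    define \<Lambda> where "\<Lambda> = ln r0 - ln r1"
    have \<Lambda>: "0 < \<Lambda>" using r1 by (simp add: \<Lambda>_def)
    have "(\<gamma> + 1) / (2 * (\<gamma> - 1)) = 1 / k" by (simp add: k_def)
    then have "\<Lambda> < 1 / k" using short r1 by (simp add: \<Lambda>_def ln_div)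
    then have k\<Lambda>: "k * \<Lambda> < 1" using k_pos by (simp add: pos_less_divide_eq mult.commute)
    define N where "N = k * (B_in + \<Lambda> * (C * (r0 - r1)))"
    have N: "0 < N" using k_pos B_in \<Lambda> C r1 by (simp add: N_def add_pos_pos)
    define E where "E = (N / (1 - k * \<Lambda>) + C * (r0 - r1)) / r0 + 1"
    have "0 < E" unfolding E_def using N k\<Lambda> C r1 \<open>r0 > 0\<close> by (intro add_pos_pos divide_pos_pos mult_pos_pos) auto
    moreover have "unique_shocks_with_decreasing_exit_pressure \<gamma> r0 b (r0 - r1) (entrance E0)"
      if b: "admissible_background r0 b0 b" and E0: "E \<le> E0" for b E0
    proof (rule main[OF _ _ b])
      show "0 < r0 - r1" "r0 - r1 < r0" using r1 by auto
      show "k * (ln r0 - ln (r0 - (r0 - r1))) < 1" using k\<Lambda> by (simp add: \<Lambda>_def)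
      have "(N / (1 - k * \<Lambda>) + C * (r0 - r1)) / r0 < E0" using E0 by (simp add: E_def)
      then have "N / (1 - k * \<Lambda>) < r0 * E0 - C * (r0 - r1)"
        using \<open>r0 > 0\<close> by (simp add: pos_divide_less_eq mult.commute)
      then have "N < (1 - k * \<Lambda>) * (r0 * E0 - C * (r0 - r1))"
        using k\<Lambda> by (simp add: pos_divide_less_eq mult.commute)
      then show "k * (B_in + (ln r0 - ln (r0 - (r0 - r1))) * (C * (r0 - r1)))
        < (1 - k * (ln r0 - ln (r0 - (r0 - r1)))) * (r0 * E0 - C * (r0 - r1))"
        by (simp add: N_def \<Lambda>_def)
    qed (use \<open>2 \<le> \<gamma>\<close> in simp)
    ultimately show ?thesis by blast
  qed
  show ?thesis
    using part_a part_b unfolding entrance_def by blast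
qed

end
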